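(* Let $n,k,\ell$ be positive integers and let $b,b_1,\dots,b_n$ and $s_1,\dots,s_{\ell+1}$ be nonnegative integers with $\sum_{i=1}^n b_i=b$, $\sum_{i=1}^n i\,b_i\le n$, $\sum_{i=1}^{\ell+1}s_i=n$ and $s_1=n-b$. Then the number of multichains $\pi_1\le\pi_2\le\cdots\le\pi_\ell$ in $\widetilde{\mathrm{NC}}^{(2k)}(2n+1)$ with rank jump vector $(s_1,\dots,s_{\ell+1})$ and with $\mathrm{type}(\pi_1)=(b;b_1,\dots,b_n)$ equals $$\binom{b}{b_1,b_2,\dots,b_n}\binom{2kn+k}{s_2}\cdots\binom{2kn+k}{s_{\ell+1}}.$$
   Context: A partition of $[N]=\{1,\dots,N\}$ is noncrossing if there are no $a<b<c<d$ with $a,c$ in one block and $b,d$ in a different block. Let $m=k(2n+1)$ and $\rho(i)=i+m$ for $1\le i\le m$, $\rho(i)=i-m$ for $m<i\le 2m$ (the $180^\circ$ rotation of the circular representation of $[2m]$). $\widetilde{\mathrm{NC}}^{(2k)}(2n+1)$ is the set of noncrossing partitions of $[2k(2n+1)]$ whose block sizes are all divisible by $2k$ and which are invariant under $\rho$, ordered by refinement. For such $\pi$, let $p(\pi)$ be the number of unordered pairs $\{B,\rho(B)\}$ of blocks of $\pi$ with $\rho(B)\ne B$; the poset is graded with $\mathrm{rank}(\pi)=n-p(\pi)$, the maximum (one-block partition) having rank $n$. The type of $\pi$ is $(b;b_1,\dots,b_n)$ where $b_i$ is the number of such unordered pairs $\{B,\rho(B)\}$, $\rho(B)\neq B$, with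 $|B|=2ki$, and $b=b_1+\cdots+b_n$. For a multichain $\pi_1\le\cdots\le\pi_\ell$ (repetitions allowed) in a graded poset with maximum $\hat 1$, the rank jump vector is $(s_1,\dots,s_{\ell+1})$ with $s_1=\mathrm{rank}(\pi_1)$, $s_i=\mathrm{rank}(\pi_i)-\mathrm{rank}(\pi_{i-1})$ for $2\le i\le\ell$, $s_{\ell+1}=\mathrm{rank}(\hat1)-\mathrm{rank}(\pi_\ell)$. *)

theory Defs
  imports Main "HOL-Library.Disjoint_Sets"
begin

definition noncrossing :: "nat set set \<Rightarrow> bool" where
  "noncrossing P \<longleftrightarrow>
     (\<forall>B\<in>P. \<forall>C\<in>P. B \<noteq> C \<longrightarrow>
        \<not> (\<exists>a b c d. a < b \<and> b < c \<and> c < d \<and> a \<in> B \<and> c \<in> B \<and> b \<in> C \<and> d \<in> C))"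

definition rho :: "nat \<Rightarrow> nat \<Rightarrow> nat \<Rightarrow> nat" where
  "rho k n i = (let m = k * (2 * n + 1) in if i \<le> m then i + m else i - m)"

definition rho_block :: "nat \<Rightarrow> nat \<Rightarrow> nat set \<Rightarrow> nat set" where
  "rho_block k n B = rho k n ` B"

definition NCt :: "nat \<Rightarrow> nat \<Rightarrow> nat set set set" where
  "NCt k n = {P. partition_on {1..2 * k * (2 * n + 1)} P \<and> noncrossing P
               \<and> (\<forall>B\<in>P. (2 * k) dvd card B)
               \<and> rho_block k n ` P = P}"

definition refines :: "nat set set \<Rightarrow> nat set set \<Rightarrow> bool" where
  "refines P Q \<longleftrightarrow> (\<forall>B\<in>P. \<exists>C\<in>Q. B \<subseteq> C)"

definition pair_count_size :: "nat \<Rightarrow> nat \<Rightarrow> nat set set \<Rightarrow> nat \<Rightarrow> nat" where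
  "pair_count_size k n P i =
     card {{B, rho_block k n B} | B. B \<in> P \<and> rho_block k n B \<noteq> B \<and> card B = 2 * k * i}"

definition pair_count :: "nat \<Rightarrow> nat \<Rightarrow> nat set set \<Rightarrow> nat" where
  "pair_count k n P = card {{B, rho_block k n B} | B. B \<in> P \<and> rho_block k n B \<noteq> B}"

definition rank_NCt :: "nat \<Rightarrow> nat \<Rightarrow> nat set set \<Rightarrow> int" where
  "rank_NCt k n P = int n - int (pair_count k n P)"

definition multichains :: "nat \<Rightarrow> nat \<Rightarrow> nat \<Rightarrow> nat set set list set" where
  "multichains k n l = {cs. length cs = l \<and> set cs \<subseteq> NCt k n
       \<and> (\<forall>i. i + 1 < l \<longrightarrow> refines (cs ! i) (cs ! (i + 1)))}"

text \<open>Rank jump vector (s_1,...,s_{l+1}), indexed 1..l+1; rank of the maximum is n.\<close>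
definition has_rank_jumps :: "nat \<Rightarrow> nat \<Rightarrow> nat \<Rightarrow> nat set set list \<Rightarrow> (nat \<Rightarrow> nat) \<Rightarrow> bool" where
  "has_rank_jumps k n l cs s \<longleftrightarrow>
     int (s 1) = rank_NCt k n (cs ! 0)
     \<and> (\<forall>i\<in>{2..l}. int (s i) = rank_NCt k n (cs ! (i - 1)) - rank_NCt k n (cs ! (i - 2)))
     \<and> int (s (l + 1)) = int n - rank_NCt k n (cs ! (l - 1))"

definition has_type :: "nat \<Rightarrow> nat \<Rightarrow> nat set set \<Rightarrow> nat \<Rightarrow> (nat \<Rightarrow> nat) \<Rightarrow> bool" where
  "has_type k n P b bs \<longleftrightarrow>
     pair_count k n P = b \<and> (\<forall>i\<in>{1..n}. pair_count_size k n P i = bs i)"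

definition multinomial :: "nat \<Rightarrow> nat \<Rightarrow> (nat \<Rightarrow> nat) \<Rightarrow> nat" where
  "multinomial b n bs = fact b div (\<Prod>i=1..n. fact (bs i))"

end

theory Submission
  imports Defs "HOL-Combinatorics.Multiset_Permutations" "HOL-Library.FuncSet"
begin

text \<open>
  Let \<open>M = k(2n+1)\<close>. As \<open>\<Sum> i b\<^sub>i \<le> n\<close>, the partition \<open>\<pi>\<^sub>1\<close> has exactly one block fixed by \<open>\<rho>\<close>, and
  it meets \<open>{1..M}\<close> in \<open>j = M - 2k \<Sum> i b\<^sub>i > 0\<close> elements. If it contains \<open>1\<close>, restriction to
  \<open>{1..M}\<close> turns the multichain into a multichain of ordinary noncrossing partitions of an
  \<open>M\<close>-element set. Reading the points from left to right with a stack encodes such a chain by a word: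
  a block \<open>B\<close> of \<open>\<pi>\<^sub>1\<close> not containing the first point has as colour the least \<open>c\<close> for which its
  minimum is not the minimum of its block in \<open>\<pi>\<^sub>c\<close> (with \<open>\<pi>\<^bsub>l+1\<^esub>\<close> the one-block partition), and the
  word records \<open>|B|\<close> under this colour at the position of the last point of the block of \<open>\<pi>\<^bsub>c-1\<^esub>\<close>
  containing \<open>B\<close>. The number of letters of colour \<open>c\<close> is the rank jump \<open>s\<^sub>c\<close>, and the words that
  occur are those satisfying a ballot condition.

  Without the ballot condition there are \<open>multinomial \<sqdot> \<Prod> (M choose s\<^sub>c)\<close> words, and by the cycle
  lemma a proportion of \<open>j / M\<close> of them satisfies it. On the other side, rotating by one step shows
  that the number of multichains with a given point in the fixed block does not depend on the point,
  so it is also \<open>j / M\<close> times the number of all multichains.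
\<close>

section \<open>Noncrossing equivalence relations\<close>

text \<open>The binomials arise because a position carries at most one letter of each colour: after
  a pop of colour \<open>c\<close> at position \<open>p\<close>, the point \<open>p\<close> is
  linked to the new top of the stack at level \<open>c\<close> but not at level
  \<open>c - 1\<close>, so any further pop at \<open>p\<close> has a larger colour. Apart from the
  ballot condition, the letters of colour \<open>c\<close> therefore occupy an arbitrary set of
  \<open>s c\<close> positions among \<open>M = 2 * k * n + k\<close>, and the sizes are distributed
  freely over the letters. The ballot condition is the obstacle to a direct count: it expresses that
  the first point is never popped. The factor that it costs is the same as the one caused by asking
  the fixed block to contain a given point, and it can be cancelled because
  \<open>2 * k * n < M\<close> makes \<open>j\<close> positive. Divisibility by \<open>2 * k\<close>
  is a consequence of the type: it gives the sizes of the paired blocks of the first partition, the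
  fixed block takes what remains of \<open>2 * k * (2 * n + 1)\<close>, and the blocks of coarser
  partitions are unions of these.\<close>

definition nc_rel :: "nat rel \<Rightarrow> bool" where
  "nc_rel R \<longleftrightarrow> (\<forall>a b c d. a < b \<longrightarrow> b < c \<longrightarrow> c < d \<longrightarrow> (a, c) \<in> R \<longrightarrow> (b, d) \<in> R \<longrightarrow> (a, b) \<in> R)"

text \<open>For symmetric \<open>R\<close> the one implication says that no class has points both
  below \<open>f\<close> and from \<open>f\<close> on.\<close>

definition respects_cuts :: "nat set \<Rightarrow> nat rel \<Rightarrow> bool" where
  "respects_cuts F R \<longleftrightarrow> (\<forall>f\<in>F. \<forall>u v. (u, v) \<in> R \<longrightarrow> f \<le> u \<longrightarrow> f \<le> v)"

definition merge :: "nat rel \<Rightarrow> nat set \<Rightarrow> nat rel" where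
  "merge R G = R \<union> (R `` G) \<times> (R `` G)"

text \<open>The intended inverse of \<open>merge\<close>: if no class passes over the elements of
  \<open>G\<close>, then the classes that merging has joined are separated again by cutting at these
  elements.\<close>

definition cut :: "nat rel \<Rightarrow> nat set \<Rightarrow> nat rel" where
  "cut R B = {(u, v) \<in> R. \<forall>b\<in>B. b \<le> u \<longleftrightarrow> b \<le> v}"

lemma nc_relD: "nc_rel R \<Longrightarrow> a < b \<Longrightarrow> b < c \<Longrightarrow> c < d \<Longrightarrow> (a, c) \<in> R \<Longrightarrow> (b, d) \<in> R \<Longrightarrow> (a, b) \<in> R"
  unfolding nc_rel_def by blast

lemma respects_cutsD: "respects_cuts F R \<Longrightarrow> f \<in> F \<Longrightarrow> (u, v) \<in> R \<Longrightarrow> f \<le> u \<Longrightarrow> f \<le> v"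
  unfolding respects_cuts_def by blast

lemma equivD:
  assumes "equiv A R"
  shows "\<And>x. x \<in> A \<Longrightarrow> (x, x) \<in> R" "\<And>x y. (x, y) \<in> R \<Longrightarrow> (y, x) \<in> R"
    "\<And>x y z. (x, y) \<in> R \<Longrightarrow> (y, z) \<in> R \<Longrightarrow> (x, z) \<in> R"
    "\<And>x y. (x, y) \<in> R \<Longrightarrow> x \<in> A" "\<And>x y. (x, y) \<in> R \<Longrightarrow> y \<in> A"
  using assms unfolding equiv_def refl_on_def sym_def trans_def by blast+

lemma equiv_merge:
  assumes "equiv A R"
  shows "equiv A (merge R G)"
proof (rule equivI)
  note E = equivD[OF assms]
  show "merge R G \<subseteq> A \<times> A" by (auto simp: merge_def dest: E(4,5))
  show "refl_on A (merge R G)" using E(1) unfolding merge_def refl_on_def by blast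
  show "sym (merge R G)" using E(2) unfolding merge_def sym_def by blast
  show "trans (merge R G)" using E(2,3) unfolding merge_def trans_def by blast
qed

lemma equiv_cut:
  assumes "equiv A R"
  shows "equiv A (cut R B)"
proof (rule equivI)
  note E = equivD[OF assms]
  show "cut R B \<subseteq> A \<times> A" using E(4,5) unfolding cut_def by blast
  show "refl_on A (cut R B)" using E(1) unfolding cut_def refl_on_def by blast
  show "sym (cut R B)" using E(2) unfolding cut_def sym_def by blast
  show "trans (cut R B)" using E(3) unfolding cut_def trans_def by fastforce
qed

lemma nc_cut:
  assumes "nc_rel R"
  shows "nc_rel (cut R B)"
  unfolding nc_rel_def
proof (intro allI impI)
  fix a b c d :: nat
  assume *: "a < b" "b < c" "c < d" "(a, c) \<in> cut R B" "(b, d) \<in> cut R B"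
  then have "(a, b) \<in> R" using nc_relD[OF assms] unfolding cut_def by blast
  moreover have "x \<le> a \<longleftrightarrow> x \<le> b" if "x \<in> B" for x
    using * that unfolding cut_def by fastforce
  ultimately show "(a, b) \<in> cut R B" unfolding cut_def by blast
qed

lemma respects_cuts_cut: "respects_cuts F R \<Longrightarrow> respects_cuts (F \<union> B) (cut R B)"
  unfolding respects_cuts_def cut_def by blast

text \<open>No class passes over an element of \<open>G\<close>, so the classes that meet
  \<open>G\<close> lie one after the other, each from its own element up to the next.\<close>

lemma merge_class_cut:
  assumes "equiv A R" "respects_cuts G R" "g \<in> G" "g' \<in> G" "(g, u) \<in> R" "(g', v) \<in> R" "g < g'"
  shows "g \<le> u" "u < g'" "g' \<le> v"
proof -
  note E = equivD[OF assms(1)]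
  show "g \<le> u" using respects_cutsD[OF assms(2,3,5)] by simp
  show "g' \<le> v" using respects_cutsD[OF assms(2,4,6)] by simp
  show "u < g'" using respects_cutsD[OF assms(2,4) E(2)[OF assms(5)]] assms(7) by force
qed

text \<open>An old pair that crosses a newly joined one lies entirely above an element
  \<open>g\<close> of \<open>G\<close>, over which it cannot pass; noncrossing of \<open>R\<close>
  then puts it into the class of \<open>g\<close>, hence into the merged class. Two new pairs are in
  the merged class anyway.\<close>

lemma nc_merge:
  assumes eq: "equiv A R" and nc: "nc_rel R" and rc: "respects_cuts G R"
  shows "nc_rel (merge R G)"
  unfolding nc_rel_def
proof (intro allI impI)
  fix a b c d :: nat
  assume o: "a < b" "b < c" "c < d" and ac: "(a, c) \<in> merge R G" and bd: "(b, d) \<in> merge R G"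
  note E = equivD[OF eq]
  let ?S = "R `` G"
  have same: "(u, v) \<in> R \<or> (\<exists>g g'. g \<in> G \<and> g' \<in> G \<and> (g, u) \<in> R \<and> (g', v) \<in> R \<and> g < g')"
    if uv: "(u, v) \<in> merge R G" "u < v" for u v
  proof (rule ccontr)
    assume n: "\<not> ?thesis"
    then obtain g g' where g: "g \<in> G" "g' \<in> G" "(g, u) \<in> R" "(g', v) \<in> R"
      using uv unfolding merge_def by blast
    consider "g < g'" | "g = g'" | "g' < g" by linarith
    then show False
    proof cases
      case 2
      then show False using g n E(2,3) by blast
    next
      case 3
      then show False using merge_class_cut[OF eq rc g(2,1,4,3)] uv by simp
    qed (use g n in blast)
  qed
  from same[OF ac] o consider "(a, c) \<in> R"
    | g g' where "g \<in> G" "g' \<in> G" "(g, a) \<in> R" "(g', c) \<in> R" "g < g'" by fastforce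
  then show "(a, b) \<in> merge R G"
  proof cases
    case 1
    from same[OF bd] o consider "(b, d) \<in> R"
      | g g' where "g \<in> G" "g' \<in> G" "(g, b) \<in> R" "(g', d) \<in> R" "g < g'" by fastforce
    then show ?thesis
    proof cases
      case 1
      then show ?thesis using nc_relD[OF nc o \<open>(a, c) \<in> R\<close>] unfolding merge_def by blast
    next
      case (2 g g')
      have l: "g \<le> b" "b < g'" using merge_class_cut[OF eq rc 2] by auto
      have "g \<le> a" using respects_cutsD[OF rc 2(1) E(2)[OF 1]] l o by simp
      then have "(g, a) \<in> R"
        using nc_relD[OF nc _ o(1,2) 2(3) 1] E(1)[OF E(4)[OF 1]] by (cases "g = a") auto
      then show ?thesis using 2 unfolding merge_def by blast
    qed
  next
    case (2 g g')
    have l: "g \<le> a" "a < g'" "g' \<le> c" using merge_class_cut[OF eq rc 2] by auto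
    from same[OF bd] o consider "(b, d) \<in> R"
      | h h' where "h \<in> G" "(h, b) \<in> R" by fastforce
    then show ?thesis
    proof cases
      case 1
      have "g' \<le> b" using respects_cutsD[OF rc 2(2) E(2)[OF 1]] l o by simp
      then have "(g', b) \<in> R"
        using nc_relD[OF nc _ o(2,3) 2(4) 1] E(1)[OF E(4)[OF 1]] by (cases "g' = b") auto
      then show ?thesis using 2 unfolding merge_def by blast
    qed (use 2 in \<open>auto simp: merge_def\<close>)
  qed
qed

text \<open>\<open>G\<close> may have one element more than \<open>B\<close>, its least: the new top
  of the stack, to which a block is attached. The classes of \<open>G\<close> are successive, so
  cutting at all elements but the first separates them.\<close>

lemma cut_merge:
  assumes eq: "equiv A R" and rc: "respects_cuts G R" and B: "B \<subseteq> G"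
    and B': "\<And>g g'. g \<in> G \<Longrightarrow> g' \<in> G \<Longrightarrow> g < g' \<Longrightarrow> g' \<in> B"
  shows "cut (merge R G) B = R"
proof
  note E = equivD[OF eq]
  show "R \<subseteq> cut (merge R G) B"
  proof (rule subrelI)
    fix u v assume uv: "(u, v) \<in> R"
    have "b \<le> u \<longleftrightarrow> b \<le> v" if "b \<in> B" for b
      using respects_cutsD[OF rc _ uv] respects_cutsD[OF rc _ E(2)[OF uv]] B that by blast
    then show "(u, v) \<in> cut (merge R G) B" using uv unfolding cut_def merge_def by blast
  qed
  show "cut (merge R G) B \<subseteq> R"
  proof (rule subrelI, rule ccontr)
    fix u v assume uv: "(u, v) \<in> cut (merge R G) B" and n: "(u, v) \<notin> R"
    then obtain g g' where g: "g \<in> G" "g' \<in> G" "(g, u) \<in> R" "(g', v) \<in> R"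
      unfolding cut_def merge_def by blast
    consider "g < g'" | "g = g'" | "g' < g" by linarith
    then show False
    proof cases
      case 1
      then have "u < g'" "g' \<le> v" using merge_class_cut[OF eq rc g] by auto
      then show False using B'[OF g(1,2) 1] uv unfolding cut_def by fastforce
    next
      case 2
      then show False using n g E(2,3) by blast
    next
      case 3
      then have "v < g" "g \<le> u" using merge_class_cut[OF eq rc g(2,1,4,3)] by auto
      then show False using B'[OF g(2,1) 3] uv unfolding cut_def by fastforce
    qed
  qed
qed

text \<open>By \<open>near\<close>, a pair straddling a cut belongs to the class of the cut point,
  so only the class containing \<open>G\<close> is split; \<open>bot\<close> provides an element of
  \<open>G\<close> in the piece below all cuts. Thus \<open>G\<close> meets every piece of that
  class, and merging restores it.\<close>

lemma merge_cut:
  assumes eq: "equiv A R" and G: "\<And>g g'. g \<in> G \<Longrightarrow> g' \<in> G \<Longrightarrow> (g, g') \<in> R"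
    and BG: "B \<subseteq> G" "finite B"
    and near: "\<And>u b v. b \<in> B \<Longrightarrow> u < b \<Longrightarrow> b < v \<Longrightarrow> (u, v) \<in> R \<Longrightarrow> (u, b) \<in> R"
    and bot: "\<And>u b. b \<in> B \<Longrightarrow> (u, b) \<in> R \<Longrightarrow> \<forall>b'\<in>B. u < b' \<Longrightarrow>
                \<exists>x\<in>G. x \<le> u \<and> (\<forall>b'\<in>B. x < b')"
  shows "merge (cut R B) G = R"
proof
  note E = equivD[OF eq]
  show "merge (cut R B) G \<subseteq> R"
    using G E(2,3) unfolding merge_def cut_def by blast
  have inS: "u \<in> cut R B `` G" if b: "b \<in> B" "(u, b) \<in> R" for u b
  proof (cases "\<forall>b'\<in>B. u < b'")
    case True
    with bot[OF b] obtain x where x: "x \<in> G" "x \<le> u" "\<forall>b'\<in>B. x < b'" by blast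
    then have "(x, u) \<in> R" using G[of x b] BG b E(2,3) by blast
    then show ?thesis using x True unfolding cut_def by fastforce
  next
    case False
    \<comment> \<open>The last cut at or below \<open>u\<close>: it lies in the same piece as
      \<open>u\<close>.\<close>
    define g where "g = Max {b\<in>B. b \<le> u}"
    have g: "g \<in> B" "g \<le> u" "b \<in> B \<Longrightarrow> b \<le> u \<Longrightarrow> b \<le> g" for b
    proof -
      have "g \<in> {b\<in>B. b \<le> u}"
        unfolding g_def by (rule Max_in) (use False BG(2) in \<open>auto simp: not_less\<close>)
      then show "g \<in> B" "g \<le> u" by auto
      show "b \<le> g" if "b \<in> B" "b \<le> u" for b
        unfolding g_def by (rule Max_ge) (use that BG(2) in auto)
    qed
    have "(g, u) \<in> R" using G[of g b] BG b g E(2,3) by blast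
    moreover have "b \<le> g \<longleftrightarrow> b \<le> u" if "b \<in> B" for b
      using g that by fastforce
    ultimately show ?thesis using g BG unfolding cut_def by blast
  qed
  show "R \<subseteq> merge (cut R B) G"
  proof (rule subrelI)
    fix u v assume uv: "(u, v) \<in> R"
    show "(u, v) \<in> merge (cut R B) G"
    proof (cases "\<forall>b\<in>B. b \<le> u \<longleftrightarrow> b \<le> v")
      case True
      then show ?thesis using uv unfolding merge_def cut_def by blast
    next
      case False
      then obtain b where b: "b \<in> B" "u < b \<and> b \<le> v \<or> v < b \<and> b \<le> u" by force
      have "(u, b) \<in> R"
        using b near[OF b(1), of u v] near[OF b(1), of v u] uv E(2,3) by (metis le_neq_implies_less)
      moreover from this have "(v, b) \<in> R" using uv E(2,3) by blast
      ultimately show ?thesis using inS[OF b(1)] unfolding merge_def by blast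
    qed
  qed
qed

lemma merge_respects_cuts:
  assumes "equiv A R" "respects_cuts F R" "G \<subseteq> F" "H \<subseteq> F" "\<And>f g. f \<in> H \<Longrightarrow> g \<in> G \<Longrightarrow> f \<le> g"
  shows "respects_cuts H (merge R G)"
  unfolding respects_cuts_def
proof (intro ballI allI impI)
  fix f u v assume *: "f \<in> H" "(u, v) \<in> merge R G" "f \<le> u"
  show "f \<le> v"
  proof (cases "(u, v) \<in> R")
    case True
    then show ?thesis using respects_cutsD[OF assms(2)] assms(4) * by blast
  next
    case False
    then obtain g where g: "g \<in> G" "(g, v) \<in> R" using * unfolding merge_def by blast
    then have "g \<le> v" using respects_cutsD[OF assms(2)] assms(3) by blast
    then show ?thesis using assms(5)[OF *(1) g(1)] by simp
  qed
qed

section \<open>The stack and its states\<close>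

text \<open>Multichains are indexed by \<open>1..l\<close> and set to \<open>{}\<close> elsewhere, so that equality of
  chains is equality of functions.\<close>
definition nc_chain :: "nat \<Rightarrow> nat \<Rightarrow> (nat \<Rightarrow> nat rel) \<Rightarrow> bool" where
  "nc_chain l p E \<longleftrightarrow> (\<forall>i\<in>{1..l}. equiv {..p} (E i) \<and> nc_rel (E i)) \<and>
     (\<forall>i j. 1 \<le> i \<longrightarrow> i \<le> j \<longrightarrow> j \<le> l \<longrightarrow> E i \<subseteq> E j) \<and> (\<forall>i. i \<notin> {1..l} \<longrightarrow> E i = {})"

text \<open>The configuration reached when a word has been read up to position \<open>p\<close>: \<open>F\<close> is the
  stack of elements that do not yet belong to a block. No class may pass over a stack element.\<close>
definition state :: "nat \<Rightarrow> nat \<Rightarrow> nat set \<Rightarrow> (nat \<Rightarrow> nat rel) \<Rightarrow> bool" where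
  "state l p F E \<longleftrightarrow> nc_chain l p E \<and> F \<subseteq> {..p} \<and> 0 \<in> F \<and>
     (\<forall>i\<in>{1..l}. respects_cuts F (E i)) \<and> (\<forall>f\<in>F. E 1 `` {f} = {f})"

text \<open>The states in which all letters read at position \<open>p\<close> have colour less than \<open>c\<close>:
  the condition says that \<open>p\<close> has already been linked to the top of the stack at level \<open>c - 1\<close>.
  For \<open>c = l + 2\<close> there is no condition.\<close>
definition states :: "nat \<Rightarrow> nat \<Rightarrow> nat \<Rightarrow> (nat set \<times> (nat \<Rightarrow> nat rel)) set" where
  "states l p c = {(F, E). state l p F E \<and> (c \<le> l + 1 \<longrightarrow> (Max F, p) \<in> E (c - 1))}"

text \<open>Popping the stack elements above \<open>x\<close> with colour \<open>c\<close>: they form a block at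
  level 1, and this block is attached to \<open>x\<close> at the levels \<open>i \<ge> c\<close>.\<close>
definition pop_rel :: "nat \<Rightarrow> nat \<Rightarrow> nat \<Rightarrow> nat set \<Rightarrow> (nat \<Rightarrow> nat rel) \<Rightarrow> (nat \<Rightarrow> nat rel)" where
  "pop_rel l c x F E = (\<lambda>i. if i \<in> {1..l}
     then merge (E i) (F \<inter> {x<..} \<union> (if c \<le> i then {x} else {})) else {})"

text \<open>Stack elements are left out because their blocks are still open. For
  \<open>F = {0}\<close> these are the minima of all classes other than that of \<open>0\<close>,
  the statistic that turns into the pair count.\<close>

definition heads :: "nat \<Rightarrow> nat set \<Rightarrow> nat rel \<Rightarrow> nat set" where
  "heads p F R = {y. y \<le> p \<and> y \<notin> F \<and> (\<forall>v<y. (v, y) \<notin> R)}"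

lemma nc_chainD:
  assumes "nc_chain l p E"
  shows "i \<in> {1..l} \<Longrightarrow> equiv {..p} (E i)" "i \<in> {1..l} \<Longrightarrow> nc_rel (E i)"
    "1 \<le> i \<Longrightarrow> i \<le> j \<Longrightarrow> j \<le> l \<Longrightarrow> E i \<subseteq> E j" "i \<notin> {1..l} \<Longrightarrow> E i = {}"
  using assms unfolding nc_chain_def by blast+

lemma stateD:
  assumes "state l p F E"
  shows "nc_chain l p E" "F \<subseteq> {..p}" "finite F" "0 \<in> F" "i \<in> {1..l} \<Longrightarrow> respects_cuts F (E i)"
    "f \<in> F \<Longrightarrow> E 1 `` {f} = {f}" "Max F \<in> F" "f \<in> F \<Longrightarrow> f \<le> Max F" "Max F \<le> p"
proof -
  show *: "nc_chain l p E" "F \<subseteq> {..p}" "0 \<in> F" "i \<in> {1..l} \<Longrightarrow> respects_cuts F (E i)"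
    "f \<in> F \<Longrightarrow> E 1 `` {f} = {f}"
    using assms unfolding state_def by blast+
  show f: "finite F" using *(2) finite_subset by blast
  show "Max F \<in> F" using f *(3) by (metis Max_in empty_iff)
  then show "Max F \<le> p" using *(2) by blast
  show "f \<in> F \<Longrightarrow> f \<le> Max F" using f by simp
qed

lemma state_image:
  assumes st: "state l p F E" and A: "A \<subseteq> F"
  shows "E 1 `` A = A"
proof -
  have "E 1 `` A = (\<Union>a\<in>A. E 1 `` {a})" by blast
  also have "\<dots> = (\<Union>a\<in>A. {a})" by (rule SUP_cong[OF refl]) (use stateD(6)[OF st] A in blast)
  finally show ?thesis by simp
qed

section \<open>A single pop and how it is read back from the resulting state\<close>

locale popped =
  fixes l p c x :: nat and F F' Y :: "nat set" and E E' :: "nat \<Rightarrow> nat rel"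
  assumes l: "0 < l" and c: "2 \<le> c" "c \<le> l + 1"
    and st: "state l p F E" and top: "(Max F, p) \<in> E (c - 1)"
    and x: "x \<in> F" "x < Max F"
  defines "F' \<equiv> F \<inter> {..x}" and "E' \<equiv> pop_rel l c x F E" and "Y \<equiv> F \<inter> {x<..}"
begin

definition G where "G i = Y \<union> (if c \<le> i then {x} else {})"

lemma E'_eq: "i \<in> {1..l} \<Longrightarrow> E' i = merge (E i) (G i)"
  unfolding E'_def pop_rel_def G_def Y_def by simp

lemma eqE: "i \<in> {1..l} \<Longrightarrow> equiv {..p} (E i)"
  and ncE: "i \<in> {1..l} \<Longrightarrow> nc_rel (E i)"
  using nc_chainD[OF stateD(1)[OF st]] by blast+

lemma GF: "G i \<subseteq> F" using x unfolding G_def Y_def by auto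

lemma rcG: "i \<in> {1..l} \<Longrightarrow> respects_cuts (G i) (E i)"
  using stateD(5)[OF st] GF unfolding respects_cuts_def by blast

lemma maxY: "Max F \<in> Y"
  using stateD(7)[OF st] x unfolding Y_def by simp

lemma finY: "finite Y"
  using stateD(3)[OF st] unfolding Y_def by simp

lemma minY: "Min Y \<in> Y" "y \<in> Y \<Longrightarrow> Min Y \<le> y"
  using maxY finY by (auto intro: Min_in)

lemma eqE': "i \<in> {1..l} \<Longrightarrow> equiv {..p} (E' i)"
  using eqE equiv_merge by (simp add: E'_eq)

lemma img:
  assumes i: "i \<in> {1..l}" and g: "g \<in> G i"
  shows "E' i `` {g} = E i `` G i"
proof -
  have "(g, g) \<in> E i" using equivD(1)[OF eqE[OF i], of g] g GF stateD(2)[OF st] by blast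
  then have 1: "g \<in> E i `` G i" using g by (rule ImageI)
  have 2: "E i `` {g} \<subseteq> E i `` G i" by (rule Image_mono) (use g in auto)
  have "E' i `` {g} = E i `` {g} \<union> E i `` G i"
    unfolding E'_eq[OF i] merge_def using 1 by (simp add: Un_Image Sigma_Image)
  then show ?thesis using 2 by (simp add: Un_absorb1)
qed

lemmas E1Y = state_image[OF st]

text \<open>Since \<open>c\<close> is at least 2, \<open>x\<close> is not joined at level 1, where
  stack elements are singletons; so the popped block is exactly one class.\<close>

lemma E'1Y: "y \<in> Y \<Longrightarrow> E' 1 `` {y} = Y"
  using img[of 1 y] l c E1Y[of "G 1"] GF[of 1] unfolding G_def by auto

lemma chain': "nc_chain l p E'"
  unfolding nc_chain_def
proof (intro conjI allI impI ballI)
  fix i assume i: "i \<in> {1..l}"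
  show "equiv {..p} (E' i)" by (rule eqE'[OF i])
  show "nc_rel (E' i)" unfolding E'_eq[OF i] by (rule nc_merge[OF eqE ncE rcG]) (use i in auto)
next
  fix i j :: nat assume ij: "1 \<le> i" "i \<le> j" "j \<le> l"
  then have "E i \<subseteq> E j" "G i \<subseteq> G j"
    using nc_chainD(3)[OF stateD(1)[OF st]] unfolding G_def by auto
  then show "E' i \<subseteq> E' j" using ij by (simp add: E'_eq merge_def) blast
qed (auto simp: E'_def pop_rel_def)

lemma maxF': "Max F' = x"
  unfolding F'_def by (rule Max_eqI) (use x stateD(3)[OF st] in auto)

lemma state': "state l p F' E'"
  unfolding state_def
proof (intro conjI ballI)
  show "nc_chain l p E'" by (rule chain')
  show "F' \<subseteq> {..p}" "0 \<in> F'" using stateD(2,4)[OF st] unfolding F'_def by auto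
  show "respects_cuts F' (E' i)" if "i \<in> {1..l}" for i
    unfolding E'_eq[OF that]
    by (rule merge_respects_cuts[OF eqE stateD(5)[OF st] GF])
      (use that x in \<open>auto simp: F'_def G_def Y_def split: if_splits\<close>)
  show "E' 1 `` {f} = {f}" if "f \<in> F'" for f
  proof -
    have "f \<notin> Y" "f \<in> F" using that unfolding F'_def Y_def by auto
    moreover have "E 1 `` G 1 = Y" using c E1Y[of Y] unfolding G_def Y_def by auto
    ultimately show ?thesis using l stateD(6)[OF st] by (simp add: E'_eq merge_def) blast
  qed
qed

lemma Fun: "F = F' \<union> Y" "F' \<inter> Y = {}"
  unfolding F'_def Y_def by auto

lemma top_mono: "i \<in> {1..l} \<Longrightarrow> c - 1 \<le> i \<Longrightarrow> (Max F, p) \<in> E i"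
proof -
  assume "i \<in> {1..l}" "c - 1 \<le> i"
  then have "E (c - 1) \<subseteq> E i" using nc_chainD(3)[OF stateD(1)[OF st], of "c - 1" i] c by auto
  then show ?thesis using top by blast
qed

text \<open>\<open>Max F\<close> is a cut, so before the pop \<open>x\<close> is related to nothing
  from \<open>Max F\<close> on. A link between \<open>x\<close> and \<open>p\<close> can only come
  from the merge, which involves \<open>x\<close> precisely from level \<open>c\<close> on.\<close>

lemma colour: "i \<in> {1..l} \<Longrightarrow> (x, p) \<in> E' i \<longleftrightarrow> c \<le> i"
proof
  assume i: "i \<in> {1..l}"
  note E = equivD[OF eqE[OF i]]
  {
    assume "c \<le> i"
    then have "x \<in> G i" "Max F \<in> G i" "(Max F, p) \<in> E i" "(x, x) \<in> E i"
      using top_mono[OF i] maxY x stateD(2)[OF st] E(1)[of x] unfolding G_def by auto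
    then have "x \<in> E i `` G i" "p \<in> E i `` G i" by blast+
    then show "(x, p) \<in> E' i" unfolding E'_eq[OF i] merge_def by blast
  next
    assume xp: "(x, p) \<in> E' i"
    have n: "(u, x) \<notin> E i" if "Max F \<le> u" for u
      using respects_cutsD[OF stateD(5)[OF st i] stateD(7)[OF st] _ that] x by fastforce
    have "(x, p) \<notin> E i" using n[OF stateD(9)[OF st]] E(2) by blast
    then have "x \<in> E i `` G i" using xp unfolding E'_eq[OF i] merge_def by blast
    then obtain g where g: "g \<in> G i" "(g, x) \<in> E i" by blast
    show "c \<le> i"
    proof (rule ccontr)
      assume "\<not> c \<le> i"
      then have "g \<in> F" "x < g" using g unfolding G_def Y_def by auto
      then show False using respects_cutsD[OF stateD(5)[OF st i] _ g(2), of g] by simp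
    qed
  }
qed

lemma last_class: "E' (c - 1) `` {p} = E (c - 1) `` Y"
proof -
  have i: "c - 1 \<in> {1..l}" using c by auto
  have G: "G (c - 1) = Y" using c unfolding G_def by auto
  have "(Max F, p) \<in> E' (c - 1)" using top unfolding E'_eq[OF i] merge_def by blast
  then have "E' (c - 1) `` {p} = E' (c - 1) `` {Max F}"
    using equiv_class_eq[OF eqE'[OF i]] by blast
  then show ?thesis using img[OF i] G maxY by simp
qed

text \<open>At level \<open>c - 1\<close> the point \<open>p\<close> was attached to the old top, a
  member of the popped block. Its class there now consists of the old classes of the elements of
  \<open>Y\<close>, each of which starts at its element of \<open>Y\<close>.\<close>

lemma least_last_class: "Min (E' (c - 1) `` {p}) = Min Y"
  unfolding last_class
proof (rule Min_eqI)
  have i: "c - 1 \<in> {1..l}" using c by auto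
  note E = equivD[OF eqE[OF i]]
  have Yp: "Y \<subseteq> {..p}" using stateD(2)[OF st] unfolding Y_def by auto
  have "E (c - 1) `` Y \<subseteq> {..p}" using E(5) by blast
  then show "finite (E (c - 1) `` Y)" using finite_subset by blast
  show "Min Y \<in> E (c - 1) `` Y" using minY Yp E(1) by blast
  fix u assume "u \<in> E (c - 1) `` Y"
  then obtain g where "g \<in> Y" "(g, u) \<in> E (c - 1)" by blast
  then have "Min Y \<le> g" "g \<le> u"
    using minY respects_cutsD[OF stateD(5)[OF st i], of g g u] unfolding Y_def by auto
  then show "Min Y \<le> u" by simp
qed

lemma Y_recover: "Y = E' 1 `` {Min (E' (c - 1) `` {p})}"
  using E'1Y minY least_last_class by simp

lemma E_recover: "E = (\<lambda>i. cut (E' i) Y)"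
proof
  fix i show "E i = cut (E' i) Y"
  proof (cases "i \<in> {1..l}")
    case True
    show ?thesis unfolding E'_eq[OF True]
      by (rule cut_merge[OF eqE[OF True] rcG[OF True], symmetric])
        (auto simp: G_def Y_def split: if_splits)
  next
    case False
    then show ?thesis using nc_chainD(4)[OF stateD(1)[OF st]]
      by (auto simp: E'_def pop_rel_def cut_def)
  qed
qed

text \<open>Below its colour the popped block starts a class of its own; from the colour on it is
  part of the class of the stack element \<open>x\<close>. Hence a letter of colour \<open>c\<close>
  counts for the levels \<open>i < c\<close> only. Older heads survive because the merged class has
  its minimum on the stack before the pop.\<close>

lemma heads': "i \<in> {1..l} \<Longrightarrow> heads p F' (E' i) = (if c \<le> i then {} else {Min Y}) \<union> heads p F (E i)"
proof -
  assume i: "i \<in> {1..l}"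
  note E = equivD[OF eqE[OF i]] and E' = equivD[OF eqE'[OF i]]
  have rc: "g \<le> u" if "g \<in> G i" "(g, u) \<in> E i" for g u
    using respects_cutsD[OF rcG[OF i] that] by simp
  have GG: "(u, v) \<in> E' i" if "u \<in> G i" "v \<in> G i" for u v
  proof -
    have "u \<in> E i `` G i" "v \<in> E i `` G i" using that E(1) GF stateD(2)[OF st] by blast+
    then show ?thesis unfolding E'_eq[OF i] merge_def by blast
  qed
  have old: "y \<in> heads p F' (E' i)" if y: "y \<in> heads p F (E i)" for y
  proof -
    have y': "y \<le> p" "y \<notin> F" "v < y \<Longrightarrow> (v, y) \<notin> E i" for v
      using y unfolding heads_def by auto
    have "(v, y) \<notin> E' i" if vy: "v < y" for v
    proof
      assume "(v, y) \<in> E' i"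
      then obtain g where g: "g \<in> G i" "(g, y) \<in> E i"
        using y'(3)[OF vy] unfolding E'_eq[OF i] merge_def by blast
      then have "g < y" using rc[OF g] GF y'(2) by (metis le_neq_implies_less subsetD)
      then show False using y'(3) g by blast
    qed
    then show ?thesis using y' Fun unfolding heads_def by auto
  qed
  have new: "Min Y \<in> heads p F' (E' i)" if "\<not> c \<le> i"
  proof -
    have G: "G i = Y" using that unfolding G_def by simp
    have m: "Min Y \<in> F" "Min Y \<le> p" using minY stateD(2)[OF st] unfolding Y_def by auto
    have "(v, Min Y) \<notin> E' i" if "v < Min Y" for v
    proof
      note v_less = that
      assume v: "(v, Min Y) \<in> E' i"
      have "(v, Min Y) \<notin> E i"
        using respects_cutsD[OF stateD(5)[OF st i] m(1), of "Min Y" v] E(2) v_less by fastforce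
      then obtain g where "g \<in> G i" "(g, v) \<in> E i"
        using v unfolding E'_eq[OF i] merge_def by blast
      then show False using rc[of g v] minY(2)[of g] G v_less by simp
    qed
    then show ?thesis using m minY(1) Fun unfolding heads_def by auto
  qed
  have conv: "y \<in> heads p F (E i) \<or> y = Min Y \<and> \<not> c \<le> i" if y: "y \<in> heads p F' (E' i)" for y
  proof (cases "y \<in> F")
    case False
    have "E i \<subseteq> E' i" unfolding E'_eq[OF i] merge_def by blast
    then show ?thesis using y False unfolding heads_def by blast
  next
    case True
    then have yY: "y \<in> Y" using y Fun unfolding heads_def by auto
    have "\<not> Min Y < y"
      using GG[of "Min Y" y] minY(1) yY y unfolding heads_def G_def by auto
    then have "y = Min Y" using minY(2)[OF yY] by simp
    moreover have "\<not> c \<le> i"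
    proof
      assume "c \<le> i"
      then have "(x, y) \<in> E' i" "x < y" using GG[of x y] yY unfolding G_def Y_def by auto
      then show False using y unfolding heads_def by blast
    qed
    ultimately show ?thesis by blast
  qed
  show ?thesis using old new conv by (auto split: if_splits)
qed

lemma minY_not_head: "Min Y \<notin> heads p F R"
  using minY(1) unfolding heads_def Y_def by auto

lemma class': "y \<in> heads p F (E 1) \<Longrightarrow> E' 1 `` {y} = E 1 `` {y}"
proof -
  assume y: "y \<in> heads p F (E 1)"
  have "E 1 `` G 1 = Y" using c E1Y[of Y] unfolding G_def Y_def by auto
  moreover have "y \<notin> Y" using y unfolding heads_def Y_def by auto
  ultimately show ?thesis using l by (simp add: E'_eq merge_def) blast
qed

end

text \<open>The last letter is recovered from the state: its colour \<open>c\<close> is the least level that links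
  \<open>p\<close> to the top \<open>x\<close> of the stack, and the popped block is the level 1 class of the least
  element of the level \<open>c - 1\<close> class of \<open>p\<close>.\<close>
lemma unpop:
  assumes l: "0 < l" and c: "2 \<le> c" "c \<le> l + 1" and st: "state l p F E"
    and col: "\<And>i. i \<in> {1..l} \<Longrightarrow> (Max F, p) \<in> E i \<longleftrightarrow> c \<le> i"
  obtains F0 E0 x where "state l p F0 E0" "(Max F0, p) \<in> E0 (c - 1)" "x \<in> F0" "x < Max F0"
    "F = F0 \<inter> {..x}" "E = pop_rel l c x F0 E0"
proof -
  define x where "x = Max F"
  define C where "C = E (c - 1) `` {p}"
  define y where "y = Min C"
  define B where "B = E 1 `` {y}"
  have i: "c - 1 \<in> {1..l}" and one: "1 \<in> {1..l}" using c l by auto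
  note ch = nc_chainD[OF stateD(1)[OF st]]
  note E = equivD[OF ch(1)]
  have C: "finite C" "p \<in> C" "C \<subseteq> {..p}"
    unfolding C_def using E(1,5)[OF i] by (auto intro: finite_subset[of _ "{..p}"])
  have y: "y \<in> C" "\<And>u. u \<in> C \<Longrightarrow> y \<le> u"
  proof -
    show "y \<in> C" unfolding y_def by (rule Min_in) (use C in auto)
    show "\<And>u. u \<in> C \<Longrightarrow> y \<le> u" unfolding y_def using C by simp
  qed
  have xF: "x \<in> F" "x \<le> p" using stateD(7,9)[OF st] unfolding x_def by auto
  \<comment> \<open>The cut at \<open>x\<close> gives \<open>x \<le> u\<close>; equality would link
    \<open>x\<close> to \<open>p\<close> already at level \<open>c - 1\<close>, against
    \<open>col\<close>.\<close>
  have xC: "x < u" if "u \<in> C" for u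
  proof -
    have "x \<le> u"
      using respects_cutsD[OF stateD(5)[OF st i] xF(1), of p u] xF(2) that unfolding C_def by auto
    moreover have "x \<noteq> u" using col[OF i] c E(2)[OF i] that unfolding C_def x_def by auto
    ultimately show ?thesis by simp
  qed
  have Csub: "C \<times> C \<subseteq> E (c - 1)" unfolding C_def using E(2,3)[OF i] by blast
  have "E 1 \<subseteq> E (c - 1)" using ch(3)[of 1 "c - 1"] c by auto
  then have BC: "B \<subseteq> C" unfolding B_def using y(1) E(3)[OF i] unfolding C_def by blast
  have yB: "y \<in> B" unfolding B_def using y C E(1)[OF one] by blast
  have finB: "finite B" using BC C finite_subset by blast
  have Bsub: "B \<times> B \<subseteq> E 1" unfolding B_def using E(2,3)[OF one] by blast
  have pB: "B \<subseteq> {..p}" using BC C by blast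
  define F0 where "F0 = F \<union> B"
  define E0 where "E0 = (\<lambda>i. cut (E i) B)"
  have ylast: "y \<le> b" if "b \<in> B" for b using y(2) BC that by blast
  have maxF: "f \<le> x" if "f \<in> F" for f using stateD(8)[OF st that] x_def by simp
  have MB: "Max B \<in> B" using finB yB by (auto intro: Max_in)
  have maxB: "Max F0 = Max B"
  proof (rule Max_eqI)
    show "finite F0" "Max B \<in> F0" using finB stateD(3)[OF st] MB unfolding F0_def by auto
    fix f assume "f \<in> F0"
    then consider "f \<in> F" | "f \<in> B" unfolding F0_def by blast
    then show "f \<le> Max B"
    proof cases
      case 1
      then show ?thesis using maxF xC[of "Max B"] MB BC by fastforce
    qed (use finB in auto)
  qed
  have st0: "state l p F0 E0"
    unfolding state_def
  proof (intro conjI ballI)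
    show "nc_chain l p E0"
      unfolding nc_chain_def E0_def
    proof (intro conjI ballI allI impI)
      fix i j assume "(1::nat) \<le> i" "i \<le> j" "j \<le> l"
      then show "cut (E i) B \<subseteq> cut (E j) B" using ch(3)[of i j] unfolding cut_def by blast
    qed (use ch equiv_cut nc_cut in \<open>auto simp: cut_def\<close>)
    show "F0 \<subseteq> {..p}" "0 \<in> F0" using stateD(2,4)[OF st] pB unfolding F0_def by auto
    show "respects_cuts F0 (E0 i)" if "i \<in> {1..l}" for i
      unfolding F0_def E0_def by (rule respects_cuts_cut[OF stateD(5)[OF st that]])
    fix f assume f: "f \<in> F0"
    show "E0 1 `` {f} = {f}"
    proof (cases "f \<in> B")
      case True
      have "v = f" if "(f, v) \<in> E0 1" for v
      proof -
        have v: "(f, v) \<in> E 1" "\<And>b. b \<in> B \<Longrightarrow> b \<le> f \<longleftrightarrow> b \<le> v"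
          using that unfolding E0_def cut_def by auto
        then have "v \<in> B" using True E(3)[OF one] unfolding B_def by blast
        then show ?thesis using v(2)[OF True] v(2)[of v] by simp
      qed
      then show ?thesis using E(1)[OF one] True pB unfolding E0_def cut_def by auto
    next
      case False
      then have "f \<in> F" using f unfolding F0_def by simp
      then show ?thesis using stateD(6)[OF st] unfolding E0_def cut_def by auto
    qed
  qed
  have top0: "(Max F0, p) \<in> E0 (c - 1)"
  proof -
    have "(Max B, p) \<in> E (c - 1)" using MB BC C(2) Csub by blast
    moreover have "b \<le> Max B \<longleftrightarrow> b \<le> p" if "b \<in> B" for b
      using that finB pB by auto
    ultimately show ?thesis unfolding maxB E0_def cut_def by blast
  qed
  have x0: "x \<in> F0" "x < Max F0" using xF xC MB BC maxB unfolding F0_def by auto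
  have F: "F = F0 \<inter> {..x}" using maxF xC BC unfolding F0_def by fastforce
  have Y: "F0 \<inter> {x<..} = B" using maxF xC BC unfolding F0_def by fastforce
  have xB: "(x, b) \<in> E i" if "i \<in> {1..l}" "c \<le> i" "b \<in> B" for i b
  proof -
    have "(b, p) \<in> E (c - 1)" using that BC C(2) Csub by blast
    moreover have "E (c - 1) \<subseteq> E i" using ch(3)[of "c - 1" i] that c by auto
    ultimately have "(p, b) \<in> E i" using E(2)[OF that(1)] by blast
    moreover have "(x, p) \<in> E i" using col[OF that(1)] that(2) unfolding x_def by simp
    ultimately show ?thesis using E(3)[OF that(1)] by blast
  qed
  have "E i = pop_rel l c x F0 E0 i" for i
  proof (cases "i \<in> {1..l}")
    case False
    then show ?thesis using ch(4) unfolding pop_rel_def by auto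
  next
    case True
    let ?G = "B \<union> (if c \<le> i then {x} else {})"
    have B1: "B \<times> B \<subseteq> E i" using Bsub ch(3)[of 1 i] True by auto
    note Ei = E[OF True]
    have ui: "y \<le> u" if "(u, v) \<in> E i" "v \<in> C" "\<not> c \<le> i" for u v
    proof -
      have "E i \<subseteq> E (c - 1)" using ch(3)[of i "c - 1"] that True c by auto
      then have "(u, v) \<in> E (c - 1)" using that(1) by blast
      moreover have "(p, v) \<in> E (c - 1)" using that(2) unfolding C_def by blast
      ultimately have "(p, u) \<in> E (c - 1)" by (metis E(2,3)[OF i])
      then show ?thesis by (intro y(2)) (simp add: C_def)
    qed
    \<comment> \<open>At level \<open>i\<close> the class containing \<open>B\<close> has least
      element \<open>x\<close> if \<open>c \<le> i\<close> and \<open>y\<close> otherwise. This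
      element belongs to \<open>?G\<close>, and noncrossing is applied with it as the leftmost
      point.\<close>
    have "merge (cut (E i) B) ?G = E i"
    proof (rule merge_cut[OF ch(1)[OF True]])
      show "(g, g') \<in> E i" if "g \<in> ?G" "g' \<in> ?G" for g g'
        using that xB[OF True] B1 Ei(2) Ei(1)[of x] xF(2) by (auto split: if_splits)
      show "B \<subseteq> ?G" "finite B" using finB by auto
      show "(u, b) \<in> E i" if h: "b \<in> B" "u < b" "b < v" "(u, v) \<in> E i" for u b v
      proof (cases "c \<le> i")
        case True': True
        have "x \<le> u"
          using respects_cutsD[OF stateD(5)[OF st True] xF(1) Ei(2)[OF h(4)]] xC BC h(1,3) by fastforce
        then have "(x, u) \<in> E i"
          using nc_relD[OF ch(2)[OF True] _ h(2,3) xB[OF True True' h(1)] h(4)] Ei(1)[of x] xF(2)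
          by (cases "x = u") auto
        then show ?thesis using xB[OF True True' h(1)] by (metis Ei(2,3))
      next
        case False
        have "E i \<subseteq> E (c - 1)" using ch(3)[of i "c - 1"] True False c by auto
        then have uvc: "(u, v) \<in> E (c - 1)" using h(4) by blast
        \<comment> \<open>Otherwise \<open>(u, v)\<close> and \<open>(y, p)\<close> cross at level
          \<open>c - 1\<close>, or share the endpoint \<open>p\<close>; either way \<open>u\<close>
          would be an element of \<open>C\<close> below its minimum.\<close>
        have yu: "y \<le> u"
        proof (rule ccontr)
          assume "\<not> y \<le> u"
          then have uy: "u < y" "y < v" using ylast[OF h(1)] h(3) by auto
          have yp: "(y, p) \<in> E (c - 1)" using y(1) E(2)[OF i] unfolding C_def by blast
          have "v \<le> p" using E(5)[OF i uvc] by simp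
          have "(u, y) \<in> E (c - 1)"
            using nc_relD[OF ch(2)[OF i] uy(1) uy(2) _ uvc yp] E(3)[OF i uvc] E(2)[OF i yp] \<open>v \<le> p\<close>
            by (cases "v = p") auto
          then have "(p, u) \<in> E (c - 1)" using yp by (metis E(2,3)[OF i])
          then have "u \<in> C" unfolding C_def by blast
          then show False using y(2)[of u] uy by simp
        qed
        show ?thesis
        proof (cases "u \<in> B")
          case True
          then show ?thesis using B1 h by blast
        next
          case uB: False
          then have "y < u" using yu yB by (metis le_neq_implies_less)
          then have "(y, u) \<in> E i"
            using nc_relD[OF ch(2)[OF True] _ h(2,3) _ h(4), of y] B1 yB h(1) by blast
          moreover have "(y, b) \<in> E i" using B1 yB h(1) by blast
          ultimately show ?thesis by (metis Ei(2,3))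
        qed
      qed
      show "\<exists>g\<in>?G. g \<le> u \<and> (\<forall>b'\<in>B. g < b')"
        if h: "b \<in> B" "(u, b) \<in> E i" "\<forall>b'\<in>B. u < b'" for u b
      proof (cases "c \<le> i")
        case True': True
        have "x \<le> u"
          using respects_cutsD[OF stateD(5)[OF st True] xF(1) Ei(2)[OF h(2)]] xC BC h(1) by fastforce
        then show ?thesis using True' xC BC by auto
      next
        case False
        then show ?thesis using ui[OF h(2) _ False] BC h(1,3) yB by fastforce
      qed
    qed
    then show ?thesis using True Y unfolding pop_rel_def E0_def by simp
  qed
  then show thesis using that[OF st0 top0 x0 F] by blast
qed

section \<open>Words\<close>

text \<open>The number of elements above \<open>x\<close> decreases strictly along \<open>F\<close>,
  so it takes each value below \<open>card F\<close> exactly once.\<close>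

lemma top_segment_ex1:
  fixes F :: "nat set"
  assumes "finite F" "a < card F"
  shows "\<exists>!x. x \<in> F \<and> card (F \<inter> {x<..}) = a"
proof -
  let ?h = "\<lambda>x. card (F \<inter> {x<..})"
  have lt: "?h y < ?h x" if "x \<in> F" "y \<in> F" "x < y" for x y
    by (rule psubset_card_mono) (use that assms in auto)
  have inj: "inj_on ?h F"
    by (rule inj_onI) (metis lt less_irrefl linorder_neqE_nat)
  have "?h x < card F" if "x \<in> F" for x
    by (rule psubset_card_mono) (use that assms in auto)
  then have "?h ` F \<subseteq> {..<card F}" by auto
  then have "?h ` F = {..<card F}"
    by (rule card_subset_eq[rotated]) (use card_image[OF inj] in auto)
  then have "a \<in> ?h ` F" using assms by simp
  then show ?thesis using inj unfolding inj_on_def by auto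
qed

definition pop_at :: "nat set \<Rightarrow> nat \<Rightarrow> nat" where
  "pop_at F a = (THE x. x \<in> F \<and> card (F \<inter> {x<..}) = a)"

definition pop :: "nat \<Rightarrow> nat \<Rightarrow> (nat set \<times> (nat \<Rightarrow> nat rel)) \<times> nat \<Rightarrow> nat set \<times> (nat \<Rightarrow> nat rel)" where
  "pop l c = (\<lambda>((F, E), a). (F \<inter> {..pop_at F a}, pop_rel l c (pop_at F a) F E))"

lemma pop_at:
  assumes "finite F" "a < card F"
  shows "pop_at F a \<in> F" "card (F \<inter> {pop_at F a<..}) = a"
  using theI'[OF top_segment_ex1[OF assms]] unfolding pop_at_def by auto

lemma pop_at_eqI:
  assumes "finite F" "x \<in> F"
  shows "pop_at F (card (F \<inter> {x<..})) = x"
proof -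
  have "card (F \<inter> {x<..}) < card F" by (rule psubset_card_mono) (use assms in auto)
  then show ?thesis unfolding pop_at_def
    by (intro the1_equality[OF top_segment_ex1]) (use assms in auto)
qed

lemma pop_at_less_Max:
  assumes "finite F" "a < card F" "0 < a"
  shows "pop_at F a < Max F"
proof -
  have "F \<inter> {pop_at F a<..} \<noteq> {}" using pop_at(2)[OF assms(1,2)] assms(3) by force
  then obtain y where "y \<in> F" "pop_at F a < y" by auto
  then show ?thesis using assms(1) by (meson Max_ge less_le_trans)
qed

lemma poppedI:
  assumes "0 < l" "2 \<le> c" "c \<le> l + 1" "(F, E) \<in> states l p c" "0 < a" "a < card F"
  shows "popped l p c (pop_at F a) F E"
proof
  show "state l p F E" "(Max F, p) \<in> E (c - 1)" using assms unfolding states_def by auto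
  then show "pop_at F a \<in> F" "pop_at F a < Max F"
    using pop_at(1) pop_at_less_Max stateD(3) assms by auto
qed (use assms in auto)

text \<open>A state that satisfies the condition for \<open>c + 1\<close> but not the one for
  \<open>c\<close> has \<open>c\<close> as least level linking \<open>p\<close> to the top (none if
  \<open>c = l + 1\<close>), hence comes from exactly one pop of colour \<open>c\<close>. The bound
  \<open>a < card (fst S)\<close> leaves an element to become the new top.\<close>

lemma bij_betw_pop:
  assumes l: "0 < l" and c: "2 \<le> c" "c \<le> l + 1"
  shows "bij_betw (pop l c) {(S, a). S \<in> states l p c \<and> 0 < a \<and> a < card (fst S)} (states l p (c + 1) - states l p c)"
    (is "bij_betw _ ?D ?R")
proof (rule bij_betw_imageI)
  let ?Y = "\<lambda>S. snd S 1 `` {Min (snd S (c - 1) `` {p})}"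
  let ?u = "\<lambda>S. ((fst S \<union> ?Y S, \<lambda>i. cut (snd S i) (?Y S)), card (?Y S))"
  have rec: "?u (pop l c z) = z \<and> pop l c z \<in> ?R" if "z \<in> ?D" for z
  proof -
    obtain F E a where z: "z = ((F, E), a)" by (metis surj_pair)
    interpret popped l p c "pop_at F a" F "F \<inter> {..pop_at F a}" "F \<inter> {pop_at F a<..}" E
      "pop_rel l c (pop_at F a) F E"
      by (rule poppedI[OF l c]) (use that z in auto)
    have a: "card (F \<inter> {pop_at F a<..}) = a"
      using that z pop_at(2)[OF stateD(3)[OF st]] by auto
    note Y = Y_recover[symmetric]
    have 1: "?u (pop l c z) = z"
      using Y a E_recover[symmetric] Fun(1) unfolding z pop_def by simp
    have "c - 1 \<in> {1..l}" using c by auto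
    then have "(pop_at F a, p) \<notin> pop_rel l c (pop_at F a) F E (c - 1)"
      using colour[of "c - 1"] c by auto
    moreover have "(pop_at F a, p) \<in> pop_rel l c (pop_at F a) F E c" if "c \<le> l"
      using colour[of c] that c by auto
    ultimately show ?thesis
      using state' maxF' 1 c unfolding z pop_def states_def by auto
  qed
  show "inj_on (pop l c) ?D" by (rule inj_on_inverseI[of _ ?u]) (use rec in blast)
  show "pop l c ` ?D = ?R"
  proof
    show "pop l c ` ?D \<subseteq> ?R" using rec by blast
    show "?R \<subseteq> pop l c ` ?D"
    proof
      fix S assume S: "S \<in> ?R"
      obtain F E where FE: "S = (F, E)" by (metis surj_pair)
      have st: "state l p F E" and n: "(Max F, p) \<notin> E (c - 1)" and y: "c \<le> l \<Longrightarrow> (Max F, p) \<in> E c"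
        using S c unfolding FE states_def by auto
      note ch = nc_chainD(3)[OF stateD(1)[OF st]]
      have col: "(Max F, p) \<in> E i \<longleftrightarrow> c \<le> i" if "i \<in> {1..l}" for i
      proof
        show "c \<le> i" if "(Max F, p) \<in> E i"
        proof (rule ccontr)
          assume "\<not> c \<le> i"
          then have "E i \<subseteq> E (c - 1)" using ch[of i "c - 1"] \<open>i \<in> {1..l}\<close> c by auto
          then show False using that n by blast
        qed
        show "(Max F, p) \<in> E i" if "c \<le> i"
        proof -
          have "E c \<subseteq> E i" using ch[of c i] that \<open>i \<in> {1..l}\<close> c by auto
          then show ?thesis using y that \<open>i \<in> {1..l}\<close> by auto
        qed
      qed
      obtain F0 E0 x where *: "state l p F0 E0" "(Max F0, p) \<in> E0 (c - 1)" "x \<in> F0" "x < Max F0"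
        "F = F0 \<inter> {..x}" "E = pop_rel l c x F0 E0"
        by (rule unpop[OF l c st col])
      let ?a = "card (F0 \<inter> {x<..})"
      have "Max F0 \<in> F0 \<inter> {x<..}" using * stateD(7)[OF *(1)] by auto
      then have "0 < ?a" using stateD(3)[OF *(1)] by (auto simp: card_gt_0_iff)
      moreover have "?a < card F0" by (rule psubset_card_mono) (use * stateD(3)[OF *(1)] in auto)
      ultimately have "((F0, E0), ?a) \<in> ?D" using * c unfolding states_def by auto
      moreover have "pop l c ((F0, E0), ?a) = S"
        by (simp add: FE pop_def pop_at_eqI[OF stateD(3)[OF *(1)] *(3)] *(5,6))
      ultimately show "S \<in> pop l c ` ?D" by (metis (no_types, lifting) image_eqI)
    qed
  qed
qed

section \<open>Ballot words and their correspondence with states\<close>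

definition total :: "nat \<Rightarrow> (nat \<Rightarrow> nat \<Rightarrow> nat) \<Rightarrow> nat \<Rightarrow> nat" where
  "total l g p = (\<Sum>e\<le>p. \<Sum>d\<in>{2..l+1}. g e d)"

text \<open>\<open>g e d\<close> is the size of the block popped at position \<open>e\<close> with colour \<open>d\<close>, and 0 if there
  is none. The bound on the totals keeps the element 0 on the stack for ever.\<close>
definition words :: "nat \<Rightarrow> nat \<Rightarrow> nat \<Rightarrow> (nat \<Rightarrow> nat \<Rightarrow> nat) set" where
  "words l p c = {g. (\<forall>e d. g e d \<noteq> 0 \<longrightarrow> 2 \<le> d \<and> d \<le> l + 1 \<and> (e < p \<or> e = p \<and> d < c)) \<and>
     (\<forall>e\<le>p. total l g e \<le> e)}"

abbreviation above :: "nat \<Rightarrow> (nat \<Rightarrow> nat \<Rightarrow> nat) \<Rightarrow> (nat \<times> nat) set" where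
  "above i g \<equiv> {(e, d). i < d \<and> g e d \<noteq> 0}"

abbreviation sized :: "nat \<Rightarrow> (nat \<Rightarrow> nat \<Rightarrow> nat) \<Rightarrow> (nat \<times> nat) set" where
  "sized j g \<equiv> {(e, d). g e d = j}"

text \<open>At level \<open>i\<close> exactly the blocks popped with a colour above \<open>i\<close> start a class.\<close>
definition fits :: "nat \<Rightarrow> nat \<Rightarrow> (nat \<Rightarrow> nat \<Rightarrow> nat) \<Rightarrow> nat set \<times> (nat \<Rightarrow> nat rel) \<Rightarrow> bool" where
  "fits l p g = (\<lambda>(F, E). card F + total l g p = p + 1 \<and>
     (\<forall>i\<in>{1..l}. card (heads p F (E i)) = card (above i g)) \<and>
     (\<forall>j>0. card {y\<in>heads p F (E 1). card (E 1 `` {y}) = j} = card (sized j g)))"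

lemma finite_words_support:
  assumes "g \<in> words l p c" "\<And>e d. P e d \<Longrightarrow> g e d \<noteq> 0"
  shows "finite {(e, d). P e d}"
proof (rule finite_subset)
  have "e \<le> p \<and> d \<le> l + 1" if "g e d \<noteq> 0" for e d
    using assms(1) that unfolding words_def by fastforce
  then show "{(e, d). P e d} \<subseteq> {..p} \<times> {..l+1}" using assms(2) by blast
qed simp

abbreviation upd :: "(nat \<Rightarrow> nat \<Rightarrow> nat) \<Rightarrow> nat \<Rightarrow> nat \<Rightarrow> nat \<Rightarrow> nat \<Rightarrow> nat \<Rightarrow> nat" where
  "upd g p c a \<equiv> g(p := (g p)(c := a))"

lemma total_upd:
  assumes "g p c = 0" "2 \<le> c" "c \<le> l + 1"
  shows "e < p \<Longrightarrow> total l (upd g p c a) e = total l g e"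
    "total l (upd g p c a) p = total l g p + a"
proof -
  show "e < p \<Longrightarrow> total l (upd g p c a) e = total l g e"
    unfolding total_def by (intro sum.cong refl) auto
  have c: "c \<in> {2..l+1}" using assms by simp
  have "(\<Sum>d\<in>{2..l+1}. upd g p c a p d) = (\<Sum>d\<in>{2..l+1}. g p d) + a"
  proof -
    have "(\<Sum>d\<in>{2..l+1}. upd g p c a p d) = a + (\<Sum>d\<in>{2..l+1}-{c}. upd g p c a p d)"
      by (subst sum.remove[OF _ c]) auto
    also have "(\<Sum>d\<in>{2..l+1}-{c}. upd g p c a p d) = (\<Sum>d\<in>{2..l+1}-{c}. g p d)"
      by (intro sum.cong refl) auto
    also have "\<dots> = (\<Sum>d\<in>{2..l+1}. g p d)"
      using assms(1) by (subst sum.remove[OF _ c, of "g p"]) auto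
    finally show ?thesis by simp
  qed
  moreover have "(\<Sum>e\<in>{..p}-{p}. \<Sum>d\<in>{2..l+1}. upd g p c a e d) = (\<Sum>e\<in>{..p}-{p}. \<Sum>d\<in>{2..l+1}. g e d)"
    by (intro sum.cong refl) auto
  moreover have "total l h p = (\<Sum>d\<in>{2..l+1}. h p d) + (\<Sum>e\<in>{..p}-{p}. \<Sum>d\<in>{2..l+1}. h e d)" for h
    unfolding total_def by (rule sum.remove) auto
  ultimately show "total l (upd g p c a) p = total l g p + a"
    by (simp only: ac_simps)
qed

text \<open>The split by whether the entry at \<open>(p, c)\<close> vanishes mirrors the split of
  \<open>states l p (c + 1)\<close> into \<open>states l p c\<close> and the results of a pop of
  colour \<open>c\<close>.\<close>

lemma words_Suc_colour:
  assumes "2 \<le> c" "c \<le> l + 1"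
  shows "words l p (c + 1) = words l p c \<union>
    (\<lambda>(g, a). upd g p c a) ` {(g, a). g \<in> words l p c \<and> 0 < a \<and> a + total l g p \<le> p}"
    (is "_ = _ \<union> ?up ` ?D")
proof
  show "words l p (c + 1) \<subseteq> words l p c \<union> ?up ` ?D"
  proof
    fix g assume g: "g \<in> words l p (c + 1)"
    show "g \<in> words l p c \<union> ?up ` ?D"
    proof (cases "g p c = 0")
      case True
      have "e < p \<or> e = p \<and> d < c" if "g e d \<noteq> 0" for e d
      proof -
        have "2 \<le> d \<and> d \<le> l + 1 \<and> (e < p \<or> e = p \<and> d < c + 1)"
          using g that unfolding words_def by blast
        moreover have "\<not> (e = p \<and> d = c)" using that True by auto
        ultimately show ?thesis by auto
      qed
      then show ?thesis using g unfolding words_def by blast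
    next
      case False
      let ?g = "upd g p c 0"
      have eq: "upd ?g p c (g p c) = g" by auto
      have T: "e < p \<Longrightarrow> total l g e = total l ?g e" "total l g p = total l ?g p + g p c" for e
        using total_upd[where g="?g" and p=p and c=c and l=l and a="g p c", OF _ assms] unfolding eq by auto
      have "?g \<in> words l p c"
        unfolding words_def
      proof (intro CollectI conjI allI impI)
        fix e d assume "?g e d \<noteq> 0"
        then have "g e d \<noteq> 0 \<and> \<not> (e = p \<and> d = c)" by (auto split: if_splits)
        moreover have "g e d \<noteq> 0 \<longrightarrow> 2 \<le> d \<and> d \<le> l + 1 \<and> (e < p \<or> e = p \<and> d < c + 1)"
          using g unfolding words_def by blast
        ultimately show "2 \<le> d" "d \<le> l + 1" "e < p \<or> e = p \<and> d < c" by auto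
      next
        fix e assume "e \<le> p"
        then have "total l g e \<le> e" using g unfolding words_def by blast
        then show "total l ?g e \<le> e" using T \<open>e \<le> p\<close> by (cases "e = p") auto
      qed
      moreover have "total l g p \<le> p" using g unfolding words_def by blast
      ultimately have "(?g, g p c) \<in> ?D" using T(2) False by auto
      then show ?thesis using eq by (metis (no_types, lifting) UnI2 case_prod_conv image_eqI)
    qed
  qed
  show "words l p c \<union> ?up ` ?D \<subseteq> words l p (c + 1)"
  proof
    fix h assume "h \<in> words l p c \<union> ?up ` ?D"
    then consider "h \<in> words l p c"
      | g a where "g \<in> words l p c" "0 < a" "a + total l g p \<le> p" "h = upd g p c a" by auto
    then show "h \<in> words l p (c + 1)"
    proof cases
      case 1
      then show ?thesis unfolding words_def by fastforce
    next
      case (2 g a)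
      have z: "g p c = 0" using 2(1) unfolding words_def by fastforce
      show ?thesis unfolding words_def
      proof (intro CollectI conjI allI impI)
        fix e d assume "h e d \<noteq> 0"
        then have "g e d \<noteq> 0 \<or> (e = p \<and> d = c)" unfolding 2(4) by (auto split: if_splits)
        moreover have "g e d \<noteq> 0 \<longrightarrow> 2 \<le> d \<and> d \<le> l + 1 \<and> (e < p \<or> e = p \<and> d < c)"
          using 2(1) unfolding words_def by blast
        ultimately show "2 \<le> d" "d \<le> l + 1" "e < p \<or> e = p \<and> d < c + 1" using assms by auto
      next
        fix e assume e: "e \<le> p"
        then have "total l g e \<le> e" using 2(1) unfolding words_def by blast
        then show "total l h e \<le> e"
          using total_upd[where g=g and p=p and c=c and a=a, OF z assms] e 2(3) unfolding 2(4) by (cases "e = p") auto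
      qed
    qed
  qed
qed

text \<open>The statistics move in step: the stack loses the \<open>a\<close> elements by which the
  total grows, and the new letter matches one new head at the levels below \<open>c\<close>, whose
  class at level 1 has size \<open>a\<close>.\<close>

lemma fits_upd:
  assumes l: "0 < l" and c: "2 \<le> c" "c \<le> l + 1" and S: "S \<in> states l p c" and g: "g \<in> words l p c"
    and fit: "fits l p g S" and a: "0 < a" "a + total l g p \<le> p"
  shows "fits l p (upd g p c a) (pop l c (S, a))"
proof -
  obtain F E where FE: "S = (F, E)" by (metis surj_pair)
  have cF: "card F + total l g p = p + 1" using fit unfolding fits_def FE by simp
  interpret popped l p c "pop_at F a" F "F \<inter> {..pop_at F a}" "F \<inter> {pop_at F a<..}" E
    "pop_rel l c (pop_at F a) F E"
    by (rule poppedI[OF l c]) (use S FE a cF in auto)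
  let ?F' = "F \<inter> {..pop_at F a}" and ?Y = "F \<inter> {pop_at F a<..}" and ?E' = "pop_rel l c (pop_at F a) F E"
  have z: "g p c = 0" using g unfolding words_def by fastforce
  have cY: "card ?Y = a" using pop_at(2)[OF stateD(3)[OF st]] cF a by simp
  have "card F = card ?F' + card ?Y"
    by (subst Fun(1), subst card_Un_disjoint) (use stateD(3)[OF st] in auto)
  then have 1: "card ?F' + total l (upd g p c a) p = p + 1"
    using cF cY total_upd(2)[where g=g and p=p and c=c, OF z c] by simp
  have fin: "finite (heads p H R)" for H R by (rule finite_subset[of _ "{..p}"]) (auto simp: heads_def)
  have supp: "finite (above i g)" "j > 0 \<Longrightarrow> finite (sized j g)" for i j
    by (rule finite_words_support[OF g]; simp)+
  have 2: "card (heads p ?F' (?E' i)) = card (above i (upd g p c a))" if i: "i \<in> {1..l}" for i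
  proof -
    have "above i (upd g p c a) =
        (if c \<le> i then {} else {(p, c)}) \<union> above i g"
      using z a by (auto split: if_splits)
    moreover have "card (heads p F (E i)) = card (above i g)"
      using fit i unfolding fits_def FE by simp
    ultimately show ?thesis unfolding heads'[OF i] using minY_not_head[of "E i"] fin supp(1)[of i] z
      by (simp add: card_insert_if)
  qed
  have 3: "card {y\<in>heads p ?F' (?E' 1). card (?E' 1 `` {y}) = j} = card (sized j (upd g p c a))"
    if j: "j > 0" for j
  proof -
    have "1 \<in> {1..l}" "\<not> c \<le> 1" using l c by auto
    then have "{y\<in>heads p ?F' (?E' 1). card (?E' 1 `` {y}) = j} =
        (if a = j then {Min ?Y} else {}) \<union> {y\<in>heads p F (E 1). card (E 1 `` {y}) = j}"
      using heads'[of 1] E'1Y[OF minY(1)] class' cY by auto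
    moreover have "sized j (upd g p c a) = (if a = j then {(p, c)} else {}) \<union> sized j g"
      using z a j by (auto split: if_splits)
    moreover have "card {y\<in>heads p F (E 1). card (E 1 `` {y}) = j} = card (sized j g)"
      using fit j unfolding fits_def FE by simp
    ultimately show ?thesis using minY_not_head[of "E 1"] fin[of F "E 1"] supp(2)[OF j] z j
      by (cases "a = j") (simp_all add: card_insert_if)
  qed
  show ?thesis using 1 2 3 unfolding fits_def FE pop_def by simp
qed

text \<open>Only the statistics in \<open>fits\<close> enter the count, so the bijection itself
  stays hidden and can be extended one possible letter at a time.\<close>

definition encodes :: "nat \<Rightarrow> nat \<Rightarrow> nat \<Rightarrow> bool" where
  "encodes l p c \<longleftrightarrow> (\<exists>\<phi>. bij_betw \<phi> (words l p c) (states l p c) \<and> (\<forall>g\<in>words l p c. fits l p g (\<phi> g)))"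

text \<open>A word without a letter at \<open>(p, c)\<close> keeps its state; any other goes to the
  pop of the state of the word with that letter removed. By \<open>bij_betw_pop\<close> the two
  kinds of words have disjoint images.\<close>

lemma encodes_pop:
  assumes l: "0 < l" and c: "2 \<le> c" "c \<le> l + 1" and en: "encodes l p c"
  shows "encodes l p (c + 1)"
proof -
  obtain \<phi> where bij: "bij_betw \<phi> (words l p c) (states l p c)" and fit: "\<And>g. g \<in> words l p c \<Longrightarrow> fits l p g (\<phi> g)"
    using en unfolding encodes_def by blast
  let ?W = "words l p c" and ?S = "states l p c"
  let ?D = "{(g, a). g \<in> ?W \<and> 0 < a \<and> a + total l g p \<le> p}"
  let ?D' = "{(S, a). S \<in> ?S \<and> 0 < a \<and> a < card (fst S)}"
  let ?up = "\<lambda>(g, a). upd g p c a"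
  define \<psi> where "\<psi> g = (if g p c = 0 then \<phi> g else pop l c (\<phi> (upd g p c 0), g p c))" for g
  have z: "g p c = 0" if "g \<in> ?W" for g using that unfolding words_def by fastforce
  have up0: "upd (upd g p c a) p c 0 = g" if "g \<in> ?W" for g a using z[OF that] by (auto simp: fun_eq_iff)
  have inS: "\<phi> g \<in> ?S" if "g \<in> ?W" for g using bij that unfolding bij_betw_def by blast
  have cF: "card (fst (\<phi> g)) + total l g p = p + 1" if "g \<in> ?W" for g
    using fit[OF that] unfolding fits_def by (auto split: prod.splits)
  have "bij_betw (\<lambda>(g, a). (\<phi> g, a)) ?D ?D'"
  proof (rule bij_betw_imageI)
    show "inj_on (\<lambda>(g, a). (\<phi> g, a)) ?D" using bij unfolding bij_betw_def inj_on_def by auto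
    show "(\<lambda>(g, a). (\<phi> g, a)) ` ?D = ?D'"
    proof
      show "(\<lambda>(g, a). (\<phi> g, a)) ` ?D \<subseteq> ?D'" using inS cF by fastforce
      show "?D' \<subseteq> (\<lambda>(g, a). (\<phi> g, a)) ` ?D"
      proof
        fix y assume y: "y \<in> ?D'"
        then obtain S a where S: "y = (S, a)" "S \<in> ?S" "0 < a" "a < card (fst S)" by auto
        then have "S \<in> \<phi> ` ?W" using bij unfolding bij_betw_def by simp
        then obtain g where g: "S = \<phi> g" "g \<in> ?W" by blast
        have "a + total l g p \<le> p" using S(4) cF[OF g(2)] g(1) by simp
        then have "(g, a) \<in> ?D" using g S by simp
        moreover have "y = (\<lambda>(g, a). (\<phi> g, a)) (g, a)" using g S by simp
        ultimately show "y \<in> (\<lambda>(g, a). (\<phi> g, a)) ` ?D" by (rule rev_image_eqI)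
      qed
    qed
  qed
  then have "bij_betw (pop l c \<circ> (\<lambda>(g, a). (\<phi> g, a))) ?D (states l p (c + 1) - ?S)"
    by (rule bij_betw_trans) (rule bij_betw_pop[OF l c])
  moreover have up: "bij_betw (\<lambda>h. (upd h p c 0, h p c)) (?up ` ?D) ?D"
    by (rule bij_betw_byWitness[of _ ?up]) (use up0 z in auto)
  ultimately have "bij_betw ((pop l c \<circ> (\<lambda>(g, a). (\<phi> g, a))) \<circ> (\<lambda>h. (upd h p c 0, h p c))) (?up ` ?D) (states l p (c + 1) - ?S)"
    by (rule bij_betw_trans[rotated])
  then have "bij_betw \<psi> (?up ` ?D) (states l p (c + 1) - ?S)"
    by (rule bij_betw_cong[THEN iffD1, rotated]) (auto simp: \<psi>_def)
  moreover have "bij_betw \<psi> ?W ?S"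
    by (rule bij_betw_cong[THEN iffD1, OF _ bij]) (simp add: \<psi>_def z)
  ultimately have "bij_betw \<psi> (?W \<union> ?up ` ?D) (?S \<union> (states l p (c + 1) - ?S))"
    by (intro bij_betw_combine) auto
  \<comment> \<open>A link at level \<open>c - 1\<close> persists at level \<open>c\<close>; for
    \<open>c = l + 1\<close> the condition disappears.\<close>
  moreover have "?S \<subseteq> states l p (c + 1)"
  proof
    fix S assume S: "S \<in> ?S"
    obtain F E where FE: "S = (F, E)" by (metis surj_pair)
    have "E (c - 1) \<subseteq> E c" if "c \<le> l"
      by (rule nc_chainD(3)[OF stateD(1)]) (use S FE that c in \<open>auto simp: states_def\<close>)
    then show "S \<in> states l p (c + 1)" using S c unfolding FE states_def by auto
  qed
  ultimately have B: "bij_betw \<psi> (words l p (c + 1)) (states l p (c + 1))"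
    unfolding words_Suc_colour[OF c] by (simp add: Un_absorb1)
  moreover have "fits l p g (\<psi> g)" if "g \<in> words l p (c + 1)" for g
  proof -
    from that consider "g \<in> ?W" | h a where "h \<in> ?W" "0 < a" "a + total l h p \<le> p" "g = upd h p c a"
      unfolding words_Suc_colour[OF c] by auto
    then show ?thesis
    proof cases
      case 1
      then show ?thesis using fit z unfolding \<psi>_def by simp
    next
      case (2 h a)
      have "\<psi> g = pop l c (\<phi> h, a)" using 2 up0 unfolding \<psi>_def by auto
      then show ?thesis using fits_upd[OF l c inS[OF 2(1)] 2(1) fit[OF 2(1)] 2(2,3)] 2(4) by simp
    qed
  qed
  ultimately show ?thesis unfolding encodes_def by blast
qed

lemma state_init: "state l 0 F E \<longleftrightarrow> F = {0} \<and> E = (\<lambda>i. if i \<in> {1..l} then {(0, 0)} else {})"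
  if "0 < l"
proof
  assume st: "state l 0 F E"
  have "E i = {(0, 0)}" if "i \<in> {1..l}" for i
  proof -
    have "equiv {0} (E i)" using nc_chainD(1)[OF stateD(1)[OF st] that] by simp
    then have "E i \<subseteq> {0} \<times> {0}" "(0, 0) \<in> E i" unfolding equiv_def refl_on_def by auto
    then show ?thesis by blast
  qed
  moreover have "E i = {}" if "i \<notin> {1..l}" for i using nc_chainD(4)[OF stateD(1)[OF st] that] .
  moreover have "F = {0}" using stateD(2,4)[OF st] by auto
  ultimately show "F = {0} \<and> E = (\<lambda>i. if i \<in> {1..l} then {(0, 0)} else {})"
    by (simp add: fun_eq_iff)
next
  assume "F = {0} \<and> E = (\<lambda>i. if i \<in> {1..l} then {(0, 0)} else {})"
  then show "state l 0 F E"
    using that unfolding state_def nc_chain_def nc_rel_def respects_cuts_def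
    by (auto simp: equiv_def refl_on_def sym_def trans_def)
qed

lemma encodes_init:
  assumes "0 < l"
  shows "encodes l 0 2"
proof -
  let ?E = "\<lambda>i. if i \<in> {1..l} then {(0::nat, 0::nat)} else {}"
  have S: "states l 0 2 = {({0}, ?E)}"
    unfolding states_def state_init[OF assms] using assms by auto
  have W: "words l 0 2 = {\<lambda>_ _. 0}"
  proof
    show "words l 0 2 \<subseteq> {\<lambda>_ _. 0}"
    proof
      fix g assume "g \<in> words l 0 2"
      then have "g e d = 0" for e d unfolding words_def by (cases "g e d = 0") fastforce+
      then show "g \<in> {\<lambda>_ _. 0}" by blast
    qed
    show "{\<lambda>_ _. 0} \<subseteq> words l 0 2" unfolding words_def total_def by simp
  qed
  have H: "heads 0 {0} R = {}" for R unfolding heads_def by auto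
  have "fits l 0 (\<lambda>_ _. 0) ({0}, ?E)" unfolding fits_def total_def by (simp add: H)
  then show ?thesis
    unfolding encodes_def W S
    by (intro exI[of _ "\<lambda>_. ({0}, ?E)"]) (auto simp: bij_betw_def)
qed

text \<open>When all colours at \<open>p\<close> have been treated, the next point enters the stack
  as a singleton at every level and no letter is read. Conversely, the condition in
  \<open>states l (p + 1) 2\<close> relates the top to \<open>p + 1\<close> at level 1, where stack
  elements are singletons, so \<open>p + 1\<close> is the top.\<close>

lemma encodes_push:
  assumes l: "0 < l" and en: "encodes l p (l + 2)"
  shows "encodes l (p + 1) 2"
proof -
  let ?q = "p + 1"
  let ?W = "words l p (l + 2)" and ?S = "states l p (l + 2)"
  obtain \<phi> where bij: "bij_betw \<phi> ?W ?S" and fit: "\<And>g. g \<in> ?W \<Longrightarrow> fits l p g (\<phi> g)"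
    using en unfolding encodes_def by blast
  define push :: "nat set \<times> (nat \<Rightarrow> nat rel) \<Rightarrow> nat set \<times> (nat \<Rightarrow> nat rel)" where
    "push = (\<lambda>(F, E). (insert ?q F, \<lambda>i. if i \<in> {1..l} then insert (?q, ?q) (E i) else {}))"
  define undo :: "nat set \<times> (nat \<Rightarrow> nat rel) \<Rightarrow> nat set \<times> (nat \<Rightarrow> nat rel)" where
    "undo = (\<lambda>(F, E). (F - {?q}, \<lambda>i. E i - {(?q, ?q)}))"
  have total_q: "total l g ?q = total l g p" if "\<And>d. g ?q d = 0" for g
    unfolding total_def using that by simp
  have z: "g ?q d = 0" if "g \<in> ?W" for g d using that unfolding words_def by fastforce
  have W: "words l ?q 2 = ?W"
  proof
    show "words l ?q 2 \<subseteq> ?W" unfolding words_def by fastforce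
    show "?W \<subseteq> words l ?q 2"
    proof
      fix g assume g: "g \<in> ?W"
      have "total l g e \<le> e" if "e \<le> ?q" for e
      proof (cases "e = ?q")
        case True
        have "total l g p \<le> p" using g unfolding words_def by blast
        then show ?thesis using total_q[of g] z[OF g] True by simp
      next
        case False
        then show ?thesis using g that unfolding words_def by simp
      qed
      moreover have "2 \<le> d \<and> d \<le> l + 1 \<and> (e < ?q \<or> e = ?q \<and> d < 2)" if "g e d \<noteq> 0" for e d
      proof -
        have "2 \<le> d \<and> d \<le> l + 1 \<and> (e < p \<or> e = p \<and> d < l + 2)"
          using g that unfolding words_def by blast
        then show ?thesis by auto
      qed
      ultimately show "g \<in> words l ?q 2" unfolding words_def by blast
    qed
  qed
  have qE: "(u, v) \<notin> E i" if "nc_chain l p E" "u = ?q \<or> v = ?q" for u v E i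
  proof (cases "i \<in> {1..l}")
    case True
    then show ?thesis using equivD(4,5)[OF nc_chainD(1)[OF that(1)], of i u v] that(2) by auto
  next
    case False
    then show ?thesis using nc_chainD(4)[OF that(1)] by auto
  qed
  have push: "push S \<in> states l ?q 2 \<and> undo (push S) = S" if S: "S \<in> ?S" for S
  proof -
    obtain F E where FE: "S = (F, E)" by (metis surj_pair)
    have st: "state l p F E" using S unfolding FE states_def by simp
    note ch = nc_chainD[OF stateD(1)[OF st]]
    have qF: "?q \<notin> F" using stateD(2)[OF st] by auto
    have eq: "equiv {..?q} (insert (?q, ?q) (E i))" if "i \<in> {1..l}" for i
    proof (rule equivI)
      note E = equivD[OF ch(1)[OF that]]
      show "insert (?q, ?q) (E i) \<subseteq> {..?q} \<times> {..?q}" using E(4,5) by fastforce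
      show "refl_on {..?q} (insert (?q, ?q) (E i))" using E(1) by (auto simp: refl_on_def le_Suc_eq)
      show "sym (insert (?q, ?q) (E i))" using E(2) by (auto simp: sym_def)
      show "trans (insert (?q, ?q) (E i))"
        using E(3) qE[OF stateD(1)[OF st]] by (auto simp: trans_def)
    qed
    have nc: "nc_rel (insert (?q, ?q) (E i))" if "i \<in> {1..l}" for i
      using ch(2)[OF that] unfolding nc_rel_def by auto
    have chain: "nc_chain l ?q (snd (push S))"
      unfolding nc_chain_def FE push_def
    proof (simp, intro conjI allI impI ballI)
      fix i assume "i \<in> {Suc 0..l}"
      then show "equiv {..Suc p} (insert (Suc p, Suc p) (E i))" "nc_rel (insert (Suc p, Suc p) (E i))"
        using eq[of i] nc[of i] by simp_all
    next
      fix i j assume "Suc 0 \<le> i" "i \<le> j" "j \<le> l"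
      then show "E i \<subseteq> insert (Suc p, Suc p) (E j)" using ch(3)[of i j] by auto
    qed
    have rc: "respects_cuts (insert ?q F) (insert (?q, ?q) (E i))" if i: "i \<in> {1..l}" for i
      unfolding respects_cuts_def
    proof (intro ballI allI impI)
      fix f u v assume *: "f \<in> insert ?q F" "(u, v) \<in> insert (?q, ?q) (E i)" "f \<le> u"
      show "f \<le> v"
      proof (cases "(u, v) = (?q, ?q)")
        case True
        then show ?thesis using * by simp
      next
        case False
        then have uv: "(u, v) \<in> E i" using *(2) by blast
        then have "u \<le> p" using equivD(4)[OF ch(1)[OF i]] by blast
        then have "f \<in> F" using * by auto
        then show ?thesis using respects_cutsD[OF stateD(5)[OF st i] _ uv *(3)] by blast
      qed
    qed
    have single: "insert (?q, ?q) (E 1) `` {f} = {f}" if "f \<in> insert ?q F" for f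
    proof (cases "f = ?q")
      case True
      then show ?thesis using qE[OF stateD(1)[OF st], of ?q _ 1] by auto
    next
      case False
      then have "E 1 `` {f} = {f}" using stateD(6)[OF st] that by simp
      then show ?thesis using False by auto
    qed
    have M: "Max (insert ?q F) = ?q"
      by (rule Max_eqI) (use stateD(2,3)[OF st] in auto)
    have "state l ?q (insert ?q F) (snd (push S))"
      using chain rc single stateD(2,4)[OF st] l unfolding state_def FE push_def by auto
    then have "push S \<in> states l ?q 2" using M l unfolding states_def FE push_def by simp
    moreover have "undo (push S) = S"
      using qF qE[OF stateD(1)[OF st]] ch(4) unfolding FE push_def undo_def by (auto simp: fun_eq_iff)
    ultimately show ?thesis by blast
  qed
  have undo: "undo S \<in> ?S \<and> push (undo S) = S" if S: "S \<in> states l ?q 2" for S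
  proof -
    obtain F E where FE: "S = (F, E)" by (metis surj_pair)
    have st: "state l ?q F E" and top: "(Max F, ?q) \<in> E 1" using S l unfolding FE states_def by simp_all
    have "?q \<in> E 1 `` {Max F}" using top by blast
    then have M: "Max F = ?q" unfolding stateD(6)[OF st stateD(7)[OF st]] by simp
    then have qF: "?q \<in> F" using stateD(7)[OF st] by simp
    note ch = nc_chainD[OF stateD(1)[OF st]]
    have le: "u \<le> ?q \<and> v \<le> ?q" if "i \<in> {1..l}" "(u, v) \<in> E i" for i u v
      using equivD(4,5)[OF ch(1)[OF that(1)] that(2)] by simp
    have qq: "(?q, ?q) \<in> E i" if "i \<in> {1..l}" for i
      using equivD(1)[OF ch(1)[OF that], of ?q] by simp
    \<comment> \<open>As a cut and the last point, \<open>?q\<close> is isolated at every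
      level.\<close>
    have isol: "u = ?q \<longleftrightarrow> v = ?q" if "i \<in> {1..l}" "(u, v) \<in> E i" for i u v
    proof -
      have "?q \<le> u \<Longrightarrow> ?q \<le> v" "?q \<le> v \<Longrightarrow> ?q \<le> u"
        using respects_cutsD[OF stateD(5)[OF st that(1)] qF] that(2) equivD(2)[OF ch(1)[OF that(1)]] by blast+
      then show ?thesis using le[OF that] by auto
    qed
    have eq: "equiv {..p} (E i - {(?q, ?q)})" if "i \<in> {1..l}" for i
    proof (rule equivI)
      note E = equivD[OF ch(1)[OF that]]
      show "E i - {(?q, ?q)} \<subseteq> {..p} \<times> {..p}"
      proof (rule subrelI)
        fix u v assume "(u, v) \<in> E i - {(?q, ?q)}"
        then have "(u, v) \<in> E i" "u \<noteq> ?q \<or> v \<noteq> ?q" by auto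
        then have "u \<noteq> ?q" "v \<noteq> ?q" "u \<le> ?q" "v \<le> ?q" using isol[OF that] le[OF that] by blast+
        then show "(u, v) \<in> {..p} \<times> {..p}" by auto
      qed
      show "refl_on {..p} (E i - {(?q, ?q)})" using E(1) by (auto simp: refl_on_def)
      show "sym (E i - {(?q, ?q)})" using E(2) by (auto simp: sym_def)
      show "trans (E i - {(?q, ?q)})"
      proof (rule transI)
        fix u v w assume *: "(u, v) \<in> E i - {(?q, ?q)}" "(v, w) \<in> E i - {(?q, ?q)}"
        then have "(u, w) \<in> E i" using E(3) by blast
        moreover have "u \<noteq> ?q" using * isol[OF that, of u v] by auto
        ultimately show "(u, w) \<in> E i - {(?q, ?q)}" by simp
      qed
    qed
    have "nc_chain l p (\<lambda>i. E i - {(?q, ?q)})"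
      unfolding nc_chain_def
    proof (intro conjI allI impI ballI)
      fix i assume "i \<in> {1..l}"
      then show "equiv {..p} (E i - {(?q, ?q)})" by (rule eq)
      show "nc_rel (E i - {(?q, ?q)})" using ch(2)[OF \<open>i \<in> {1..l}\<close>] unfolding nc_rel_def by auto
    next
      fix i j :: nat assume "1 \<le> i" "i \<le> j" "j \<le> l"
      then show "E i - {(?q, ?q)} \<subseteq> E j - {(?q, ?q)}" using ch(3)[of i j] by auto
    qed (use ch(4) in auto)
    moreover have "F - {?q} \<subseteq> {..p}" "0 \<in> F - {?q}" using stateD(2,4)[OF st] by (auto simp: le_Suc_eq)
    moreover have "respects_cuts (F - {?q}) (E i - {(?q, ?q)})" if "i \<in> {1..l}" for i
      using stateD(5)[OF st that] unfolding respects_cuts_def by blast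
    moreover have "(E 1 - {(?q, ?q)}) `` {f} = {f}" if "f \<in> F - {?q}" for f
    proof -
      have "E 1 `` {f} = {f}" "f \<noteq> ?q" using stateD(6)[OF st] that by auto
      then show ?thesis by auto
    qed
    ultimately have "state l p (F - {?q}) (\<lambda>i. E i - {(?q, ?q)})"
      unfolding state_def by blast
    moreover have "push (undo S) = S"
      using qF qq ch(4) unfolding FE push_def undo_def by (auto simp: fun_eq_iff insert_absorb)
    ultimately show ?thesis unfolding FE undo_def states_def by simp
  qed
  have "bij_betw push ?S (states l ?q 2)"
    by (rule bij_betw_byWitness[of _ undo]) (use push undo in auto)
  then have "bij_betw (push \<circ> \<phi>) (words l ?q 2) (states l ?q 2)"
    unfolding W by (rule bij_betw_trans[OF bij])
  moreover have "fits l ?q g ((push \<circ> \<phi>) g)" if g: "g \<in> words l ?q 2" for g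
  proof -
    have gW: "g \<in> ?W" using g W by simp
    obtain F E where FE: "\<phi> g = (F, E)" by (metis surj_pair)
    have "(F, E) \<in> ?S" using bij gW FE unfolding bij_betw_def by force
    then have st: "state l p F E" unfolding states_def by simp
    have qF: "?q \<notin> F" using stateD(2)[OF st] by auto
    have H: "heads ?q (insert ?q F) (insert (?q, ?q) (E i)) = heads p F (E i)" for i
      unfolding heads_def by (auto simp: le_Suc_eq)
    have C: "insert (?q, ?q) (E 1) `` {y} = E 1 `` {y}" if "y \<in> heads p F (E 1)" for y
      using that unfolding heads_def by auto
    have C': "{y\<in>heads p F (E 1). card (insert (?q, ?q) (E 1) `` {y}) = j} =
      {y\<in>heads p F (E 1). card (E 1 `` {y}) = j}" for j
      using C by (intro Collect_cong conj_cong refl) simp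
    have F: "card F + total l g p = p + 1"
      "\<And>i. i \<in> {1..l} \<Longrightarrow> card (heads p F (E i)) = card (above i g)"
      "\<And>j. j > 0 \<Longrightarrow> card {y\<in>heads p F (E 1). card (E 1 `` {y}) = j} = card (sized j g)"
      using fit[OF gW] unfolding fits_def FE by auto
    have "1 \<in> {1..l}" using l by simp
    then have "fits l ?q g (insert ?q F, \<lambda>i. if i \<in> {1..l} then insert (?q, ?q) (E i) else {})"
      unfolding fits_def prod.case using F(2,3) H C' F(1) qF total_q[of g] z[OF gW] stateD(3)[OF st] by simp
    then show ?thesis unfolding push_def comp_def FE by simp
  qed
  ultimately show ?thesis unfolding encodes_def by blast
qed

lemma encodes_colours:
  assumes "0 < l" "encodes l p 2" "c \<le> l"
  shows "encodes l p (c + 2)"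
  using assms(3)
proof (induction c)
  case 0
  then show ?case using assms(2) by (simp add: numeral_2_eq_2)
next
  case (Suc c)
  then have "encodes l p (c + 2 + 1)" by (intro encodes_pop assms(1)) auto
  then show ?case by simp
qed

lemma encodes_all: "0 < l \<Longrightarrow> encodes l p (l + 2)"
proof (induction p)
  case 0
  then show ?case using encodes_colours[OF _ encodes_init, of l l] by simp
next
  case (Suc p)
  then show ?case using encodes_colours[OF _ encodes_push, of l p l] by simp
qed

text \<open>The statistics of \<open>fits\<close> once the whole stack has been joined to
  \<open>0\<close>, which is why \<open>{0}\<close> takes the place of \<open>F\<close>.\<close>

definition chain_fits :: "nat \<Rightarrow> nat \<Rightarrow> (nat \<Rightarrow> nat \<Rightarrow> nat) \<Rightarrow> (nat \<Rightarrow> nat rel) \<Rightarrow> bool" where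
  "chain_fits l p g E \<longleftrightarrow>
     (\<forall>i\<in>{1..l}. card (heads p {0} (E i)) = card (above i g)) \<and>
     (\<forall>j>0. card {y\<in>heads p {0} (E 1). card (E 1 `` {y}) = j} = card (sized j g))"

text \<open>What remains on the stack after the last position becomes the level 1 class of
  \<open>0\<close>, and its elements are joined at every level. Conversely, cutting every level at
  the level 1 class of \<open>0\<close> recovers the stack: noncrossing with \<open>0\<close> as
  leftmost point gives the straddling condition of \<open>merge_cut\<close>, and nothing lies below
  the cut at \<open>0\<close>.\<close>

lemma nc_chain_words:
  assumes l: "0 < l"
  obtains \<phi> where "bij_betw \<phi> (words l p (l + 2)) {E. nc_chain l p E}"
    "\<And>g. g \<in> words l p (l + 2) \<Longrightarrow> chain_fits l p g (\<phi> g)"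
proof -
  let ?W = "words l p (l + 2)" and ?S = "states l p (l + 2)"
  obtain \<phi> where bij: "bij_betw \<phi> ?W ?S" and fit: "\<And>g. g \<in> ?W \<Longrightarrow> fits l p g (\<phi> g)"
    using encodes_all[OF l] unfolding encodes_def by blast
  define fuse :: "nat set \<times> (nat \<Rightarrow> nat rel) \<Rightarrow> nat \<Rightarrow> nat rel" where
    "fuse = (\<lambda>(F, E) i. if i \<in> {1..l} then merge (E i) F else {})"
  define undo :: "(nat \<Rightarrow> nat rel) \<Rightarrow> nat set \<times> (nat \<Rightarrow> nat rel)" where
    "undo E = (E 1 `` {0}, \<lambda>i. cut (E i) (E 1 `` {0}))" for E
  have one: "1 \<in> {1..l}" using l by simp
  have F1: "fuse (F, E) 1 = E 1 \<union> F \<times> F" if "state l p F E" for F E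
    using one state_image[OF that] unfolding fuse_def merge_def by simp
  have fuse: "nc_chain l p (fuse S) \<and> undo (fuse S) = S" if S: "S \<in> ?S" for S
  proof -
    obtain F E where FE: "S = (F, E)" by (metis surj_pair)
    have st: "state l p F E" using S unfolding FE states_def by simp
    note ch = nc_chainD[OF stateD(1)[OF st]]
    have "nc_chain l p (fuse S)"
      unfolding nc_chain_def
    proof (intro conjI allI impI ballI)
      fix i assume i: "i \<in> {1..l}"
      then show "equiv {..p} (fuse S i)" "nc_rel (fuse S i)"
        unfolding FE fuse_def using equiv_merge[OF ch(1)[OF i]] nc_merge[OF ch(1,2)[OF i] stateD(5)[OF st i]]
        by simp_all
    next
      fix i j :: nat assume ij: "1 \<le> i" "i \<le> j" "j \<le> l"
      then have "E i \<subseteq> E j" by (rule ch(3))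
      then have "merge (E i) F \<subseteq> merge (E j) F" unfolding merge_def by blast
      then show "fuse S i \<subseteq> fuse S j" using ij unfolding FE fuse_def by simp
    qed (auto simp: FE fuse_def)
    moreover have F: "fuse S 1 `` {0} = F"
    proof -
      have 0: "0 \<in> F" by (rule stateD(4)[OF st])
      then have "(F \<times> F) `` {0} = F" by blast
      then show ?thesis unfolding FE F1[OF st] Un_Image stateD(6)[OF st 0] using 0 by blast
    qed
    moreover have "cut (fuse S i) F = E i" for i
    proof (cases "i \<in> {1..l}")
      case True
      then show ?thesis
        unfolding FE fuse_def using cut_merge[OF ch(1)[OF True] stateD(5)[OF st True] subset_refl] by simp
    next
      case False
      then have "E i = {}" by (rule ch(4))
      moreover have "fuse S i = {}" using False unfolding FE fuse_def by auto
      ultimately show ?thesis by (simp add: cut_def)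
    qed
    ultimately show ?thesis unfolding undo_def FE by simp
  qed
  have undo: "undo E \<in> ?S \<and> fuse (undo E) = E" if E: "nc_chain l p E" for E
  proof -
    note ch = nc_chainD[OF E]
    let ?F = "E 1 `` {0}"
    note E1 = equivD[OF ch(1)[OF one]]
    have F: "?F \<subseteq> {..p}" "0 \<in> ?F" using E1(5) E1(1)[of 0] by auto
    have Fi: "(f, f') \<in> E i" if "i \<in> {1..l}" "f \<in> ?F" "f' \<in> ?F" for i f f'
    proof -
      have "(f, f') \<in> E 1" using that E1(2)[of 0 f] E1(3)[of f 0 f'] by auto
      then show ?thesis using ch(3)[of 1 i] that(1) by auto
    qed
    have fus: "merge (cut (E i) ?F) ?F = E i" if i: "i \<in> {1..l}" for i
    proof (rule merge_cut[OF ch(1)[OF i]])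
      note Ei = equivD[OF ch(1)[OF i]]
      show "(u, b) \<in> E i" if h: "b \<in> ?F" "u < b" "b < v" "(u, v) \<in> E i" for u b v
      proof -
        have "(0, b) \<in> E i" using Fi[OF i F(2) h(1)] .
        moreover from this have "(0, u) \<in> E i"
          using nc_relD[OF ch(2)[OF i] _ h(2,3) _ h(4), of 0] Ei(1)[of 0] by (cases "u = 0") auto
        ultimately show ?thesis by (metis Ei(2,3))
      qed
    qed (use F Fi[OF i] finite_subset[OF F(1)] in auto)
    have "state l p ?F (\<lambda>i. cut (E i) ?F)"
      unfolding state_def
    proof (intro conjI ballI)
      show "nc_chain l p (\<lambda>i. cut (E i) ?F)"
        unfolding nc_chain_def
      proof (intro conjI ballI allI impI)
        fix i j :: nat assume "1 \<le> i" "i \<le> j" "j \<le> l"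
        then have "E i \<subseteq> E j" by (rule ch(3))
        then show "cut (E i) ?F \<subseteq> cut (E j) ?F" unfolding cut_def by blast
      qed (use ch equiv_cut nc_cut in \<open>auto simp: cut_def\<close>)
      show "?F \<subseteq> {..p}" "0 \<in> ?F" using F .
      show "respects_cuts ?F (cut (E i) ?F)" for i unfolding respects_cuts_def cut_def by blast
      fix f assume f: "f \<in> ?F"
      have "v = f" if "(f, v) \<in> cut (E 1) ?F" for v
      proof -
        have v: "(f, v) \<in> E 1" "\<And>b. b \<in> ?F \<Longrightarrow> b \<le> f \<longleftrightarrow> b \<le> v"
          using that unfolding cut_def by auto
        then have "v \<in> ?F" using f E1(3) by blast
        then show ?thesis using v(2)[OF f] v(2)[of v] by simp
      qed
      moreover have "(f, f) \<in> cut (E 1) ?F" using Fi[OF one f f] unfolding cut_def by blast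
      ultimately show "cut (E 1) ?F `` {f} = {f}" by blast
    qed
    moreover have "fuse (undo E) = E"
      using fus ch(4) unfolding fuse_def undo_def by (auto simp: fun_eq_iff)
    ultimately show ?thesis unfolding undo_def states_def by simp
  qed
  have "bij_betw fuse ?S {E. nc_chain l p E}"
    by (rule bij_betw_byWitness[of _ undo]) (use fuse undo in auto)
  then have "bij_betw (fuse \<circ> \<phi>) ?W {E. nc_chain l p E}" by (rule bij_betw_trans[OF bij])
  moreover have "chain_fits l p g ((fuse \<circ> \<phi>) g)" if g: "g \<in> ?W" for g
  proof -
    obtain F E where FE: "\<phi> g = (F, E)" by (metis surj_pair)
    have "(F, E) \<in> ?S" using bij g FE unfolding bij_betw_def by force
    then have st: "state l p F E" unfolding states_def by simp
    note ch = nc_chainD[OF stateD(1)[OF st]]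
    have H: "heads p {0} (fuse (F, E) i) = heads p F (E i)" if i: "i \<in> {1..l}" for i
    proof -
      have m: "fuse (F, E) i = merge (E i) F" using i unfolding fuse_def by simp
      have FF: "F \<times> F \<subseteq> merge (E i) F"
      proof -
        have "F \<subseteq> E i `` F" using equivD(1)[OF ch(1)[OF i]] stateD(2)[OF st] by blast
        then show ?thesis unfolding merge_def by blast
      qed
      show ?thesis
      proof (intro equalityI subsetI)
        fix y assume y: "y \<in> heads p {0} (fuse (F, E) i)"
        have "y \<notin> F"
        proof
          assume "y \<in> F"
          then have "(0, y) \<in> merge (E i) F" using FF stateD(4)[OF st] by blast
          then show False using y unfolding heads_def m by auto
        qed
        then show "y \<in> heads p F (E i)" using y unfolding heads_def m merge_def by blast
      next
        fix y assume y: "y \<in> heads p F (E i)"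
        then have y': "y \<le> p" "y \<notin> F" "\<And>v. v < y \<Longrightarrow> (v, y) \<notin> E i" unfolding heads_def by auto
        have "y \<notin> E i `` F"
        proof
          assume "y \<in> E i `` F"
          then obtain f where f: "f \<in> F" "(f, y) \<in> E i" by blast
          then have "f \<le> y" using respects_cutsD[OF stateD(5)[OF st i] f, of] by simp
          then show False using f y' by (metis le_neq_implies_less)
        qed
        moreover have "y \<noteq> 0" using y'(2) stateD(4)[OF st] by metis
        ultimately show "y \<in> heads p {0} (fuse (F, E) i)"
          using y' unfolding heads_def m merge_def by auto
      qed
    qed
    have C: "fuse (F, E) 1 `` {y} = E 1 `` {y}" if "y \<in> heads p F (E 1)" for y
      using that unfolding F1[OF st] heads_def by auto
    have C': "{y\<in>heads p F (E 1). card (fuse (F, E) 1 `` {y}) = j} =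
      {y\<in>heads p F (E 1). card (E 1 `` {y}) = j}" for j
      using C by (intro Collect_cong conj_cong refl) simp
    show ?thesis
      using fit[OF g] H one unfolding chain_fits_def fits_def FE comp_def prod.case by (simp add: H C' del: One_nat_def)
  qed
  ultimately show thesis by (rule that)
qed

section \<open>Counting words\<close>

text \<open>Among the \<open>M\<close> rotations of a sequence, the rotations satisfying the ballot condition are the
  strict future minima in one period of a walk that rises by at most 1 per step and by
  \<open>M - (\<Sum>e<M. x e)\<close> per period; they have distinct heights, which fill one period of
  heights.\<close>
lemma cycle_lemma:
  fixes x :: "nat \<Rightarrow> nat"
  assumes A: "(\<Sum>e<M. x e) < M"
  shows "card {r. r < M \<and> (\<forall>p<M. (\<Sum>e\<le>p. x ((e + r) mod M)) \<le> p)} = M - (\<Sum>e<M. x e)"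
proof -
  let ?ballot = "\<lambda>r. \<forall>p<M. (\<Sum>e\<le>p. x ((e + r) mod M)) \<le> p"
  define y where "y e = x (e mod M)" for e
  define S :: "nat \<Rightarrow> int" where "S r = int r - (\<Sum>e<r. int (y e))" for r
  define j where "j = int M - int (\<Sum>e<M. x e)"
  have j: "0 < j" using A unfolding j_def by linarith
  have S_add: "S (r + q) - S r = int q - (\<Sum>e<q. int (y (e + r)))" for r q
  proof -
    have "(\<Sum>e<r + q. int (y e)) = (\<Sum>e<r. int (y e)) + (\<Sum>e<q. int (y (e + r)))"
      by (induction q) (simp_all add: add.commute)
    then show ?thesis unfolding S_def by simp
  qed
  have step: "S (Suc r) \<le> S r + 1" for r unfolding S_def by simp
  have S_M: "S (r + M) = S r + j" for r
  proof (induction r)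
    case 0
    have "(\<Sum>e<M. int (y e)) = int (\<Sum>e<M. x e)"
      unfolding y_def by (simp add: int_sum)
    then show ?case unfolding S_def j_def by simp
  next
    case (Suc r)
    have "y (r + M) = y r" unfolding y_def by simp
    then have "S (Suc r + M) - S (r + M) = S (Suc r) - S r" unfolding S_def by simp
    then show ?case using Suc by simp
  qed
  define G where "G = {r. \<forall>q>r. S r < S q}"
  \<comment> \<open>The walk gains \<open>j > 0\<close> per period, so looking one period ahead
    decides about the whole future.\<close>
  have GI: "r \<in> G" if h: "\<And>q. r < q \<Longrightarrow> q \<le> r + M \<Longrightarrow> S r < S q" for r
  proof -
    have "S r < S q" if "r < q" for q
      using that
    proof (induction q rule: less_induct)
      case (less q)
      show ?case
      proof (cases "q \<le> r + M")
        case True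
        then show ?thesis using h less.prems by simp
      next
        case False
        then have "S r < S (q - M)" using A by (intro less.IH) auto
        moreover have "S q = S (q - M) + j" using S_M[of "q - M"] False by simp
        ultimately show ?thesis using j by simp
      qed
    qed
    then show ?thesis unfolding G_def by blast
  qed
  have G_M: "r + M \<in> G \<longleftrightarrow> r \<in> G" for r
  proof
    assume *: "r + M \<in> G"
    show "r \<in> G"
    proof (rule GI)
      fix q assume "r < q"
      then have "S (r + M) < S (q + M)" using * unfolding G_def by simp
      then show "S r < S q" using S_M by simp
    qed
  next
    assume *: "r \<in> G"
    show "r + M \<in> G"
    proof (rule GI)
      fix q assume q: "r + M < q"
      then have "S r < S (q - M)" using * unfolding G_def by simp
      then show "S (r + M) < S q" using S_M[of r] S_M[of "q - M"] q by simp
    qed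
  qed
  have goodG: "?ballot r \<longleftrightarrow> r \<in> G" for r
  proof -
    have eq: "(\<Sum>e\<le>p. x ((e + r) mod M)) \<le> p \<longleftrightarrow> S r < S (r + Suc p)" for p
    proof -
      have "(\<Sum>e<Suc p. int (y (e + r))) = int (\<Sum>e\<le>p. x ((e + r) mod M))"
        unfolding y_def lessThan_Suc_atMost by (simp add: int_sum)
      then show ?thesis using S_add[of r "Suc p"] by linarith
    qed
    show ?thesis
    proof
      assume *: "?ballot r"
      show "r \<in> G"
      proof (rule GI)
        fix q assume q: "r < q" "q \<le> r + M"
        then have "S r < S (r + Suc (q - r - 1))" using * eq[of "q - r - 1"] by auto
        then show "S r < S q" using q by simp
      qed
    next
      assume "r \<in> G"
      then have "S r < S (r + Suc p)" for p unfolding G_def by simp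
      then show "?ballot r" using eq by blast
    qed
  qed
  have "\<exists>r<M. r \<in> G"
  proof -
    have ne: "S ` {..<M} \<noteq> {}" using A by auto
    define v where "v = Min (S ` {..<M})"
    have v: "\<And>q. q < M \<Longrightarrow> v \<le> S q" unfolding v_def by simp
    have "v \<in> S ` {..<M}" unfolding v_def using ne by (intro Min_in) auto
    then have ne2: "{q. q < M \<and> S q = v} \<noteq> {}" by auto
    \<comment> \<open>The last position of minimal height in the first period; the following period
      lies higher by \<open>j\<close>.\<close>
    define r where "r = Max {q. q < M \<and> S q = v}"
    have "r \<in> {q. q < M \<and> S q = v}" unfolding r_def using ne2 by (intro Max_in) auto
    then have r: "r < M" "S r = v" by auto
    have last: "q \<le> r" if "q < M" "S q = v" for q
      unfolding r_def using that by (intro Max_ge) auto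
    have "r \<in> G"
    proof (rule GI)
      fix q assume q: "r < q" "q \<le> r + M"
      show "S r < S q"
      proof (cases "q < M")
        case True
        then show ?thesis using v[OF True] last[OF True] q r by force
      next
        case False
        then have "v \<le> S (q - M)" using q r by (intro v) auto
        moreover have "S q = S (q - M) + j" using S_M[of "q - M"] False by simp
        ultimately show ?thesis using j r by simp
      qed
    qed
    then show ?thesis using r by blast
  qed
  then obtain r0 where r0: "r0 < M" "r0 \<in> G" by blast
  let ?I = "G \<inter> {r0..<r0 + M}"
  have smono: "S a < S b" if "a \<in> G" "a < b" for a b using that unfolding G_def by blast
  have "bij_betw S ?I {S r0..<S r0 + j}"
  proof (rule bij_betw_imageI)
    show "inj_on S ?I"
      by (rule inj_onI) (metis IntD1 smono less_irrefl linorder_neqE_nat)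
    show "S ` ?I = {S r0..<S r0 + j}"
    proof (intro equalityI subsetI)
      fix w assume "w \<in> S ` ?I"
      then obtain r where r: "r \<in> G" "r0 \<le> r" "r < r0 + M" "w = S r" by auto
      have "S r0 \<le> S r" using smono[OF r0(2), of r] r by (cases "r = r0") auto
      moreover have "S r < S r0 + j" using smono[OF r(1,3)] S_M[of r0] by simp
      ultimately show "w \<in> {S r0..<S r0 + j}" using r by simp
    next
      fix w assume w: "w \<in> {S r0..<S r0 + j}"
      \<comment> \<open>After the last visit to a height at most \<open>w\<close> the walk stays
        above \<open>w\<close>; rising by at most 1 per step, it must have been at \<open>w\<close>
        exactly.\<close>
      let ?L = "{r. r0 \<le> r \<and> r < r0 + M \<and> S r \<le> w}"
      define r where "r = Max ?L"
      have fin: "finite ?L" by (rule finite_subset[of _ "{..r0+M}"]) auto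
      have "r0 \<in> ?L" using w r0 by simp
      then have "?L \<noteq> {}" by blast
      then have "r \<in> ?L" unfolding r_def by (rule Max_in[OF fin])
      then have r: "r0 \<le> r" "r < r0 + M" "S r \<le> w" by auto
      have later: "w < S q" if "r < q" for q
      proof (cases "q < r0 + M")
        case True
        show ?thesis
        proof (rule ccontr)
          assume "\<not> w < S q"
          then have "q \<in> ?L" using True that r by auto
          then have "q \<le> r" unfolding r_def using fin by (intro Max_ge) auto
          then show False using that by simp
        qed
      next
        case False
        have "r0 + M \<in> G" using G_M r0 by simp
        then have "S (r0 + M) \<le> S q" using smono[of "r0 + M" q] False by (cases "q = r0 + M") auto
        then show ?thesis using w S_M[of r0] by simp
      qed
      have "S r = w" using step[of r] later[of "Suc r"] r by simp
      moreover from this have "r \<in> G" unfolding G_def using later by blast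
      ultimately show "w \<in> S ` ?I" using r by auto
    qed
  qed
  then have "card ?I = card {S r0..<S r0 + j}" by (rule bij_betw_same_card)
  then have cI: "card ?I = nat j" by simp
  \<comment> \<open>Membership in \<open>G\<close> is periodic, so the window starting at
    \<open>r0\<close> contains as many elements as \<open>{..<M}\<close>.\<close>
  have "?I = (G \<inter> {r0..<M}) \<union> (\<lambda>r. r + M) ` (G \<inter> {..<r0})"
  proof (intro equalityI subsetI)
    fix r assume r: "r \<in> ?I"
    show "r \<in> (G \<inter> {r0..<M}) \<union> (\<lambda>r. r + M) ` (G \<inter> {..<r0})"
    proof (cases "r < M")
      case False
      then have "r - M \<in> G \<inter> {..<r0}" using r G_M[of "r - M"] by auto
      moreover have "r = r - M + M" using False by simp
      ultimately show ?thesis by blast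
    qed (use r in auto)
  qed (use G_M r0 in auto)
  moreover have "card ((G \<inter> {r0..<M}) \<union> (\<lambda>r. r + M) ` (G \<inter> {..<r0})) =
      card (G \<inter> {r0..<M}) + card (G \<inter> {..<r0})"
    by (subst card_Un_disjoint) (auto simp: card_image)
  moreover have "card (G \<inter> {..<M}) = card (G \<inter> {r0..<M}) + card (G \<inter> {..<r0})"
  proof -
    have "G \<inter> {..<M} = (G \<inter> {r0..<M}) \<union> (G \<inter> {..<r0})" using r0 by auto
    moreover have "card ((G \<inter> {r0..<M}) \<union> (G \<inter> {..<r0})) = card (G \<inter> {r0..<M}) + card (G \<inter> {..<r0})"
      by (rule card_Un_disjoint) auto
    ultimately show ?thesis by presburger
  qed
  moreover have "{r. r < M \<and> ?ballot r} = G \<inter> {..<M}"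
    using goodG by auto
  ultimately have "card {r. r < M \<and> ?ballot r} = nat j"
    using cI by presburger
  then show ?thesis unfolding j_def by linarith
qed

section \<open>Words with prescribed content, without the ballot condition\<close>

lemma card_functions_with_fibres:
  fixes bs :: "nat \<Rightarrow> nat"
  assumes X: "finite X" "card X = (\<Sum>i=1..n. bs i)"
  shows "card {f \<in> X \<rightarrow>\<^sub>E {1..n}. \<forall>i\<in>{1..n}. card {x\<in>X. f x = i} = bs i} = multinomial (card X) n bs"
proof -
  let ?F = "{f \<in> X \<rightarrow>\<^sub>E {1..n}. \<forall>i\<in>{1..n}. card {x\<in>X. f x = i} = bs i}"
  \<comment> \<open>Listing the values along an enumeration of \<open>X\<close> turns the functions
    into the arrangements of this multiset, whose number is the quotient of factorials.\<close>
  define A where "A = (\<Sum>i\<in>{1..n}. replicate_mset (bs i) i)"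
  have cA: "count A i = (if i \<in> {1..n} then bs i else 0)" for i
    unfolding A_def by (simp add: count_sum if_distrib cong: if_cong)
  have sA: "size A = card X" unfolding A_def X(2) by (simp add: size_multiset_sum)
  obtain h where h: "bij_betw h {0..<card X} X" using ex_bij_betw_nat_finite[OF X(1)] by blast
  let ?b = "card X"
  have hX: "h j \<in> X" if "j < ?b" for j using h that unfolding bij_betw_def by auto
  define g where "g = inv_into {0..<?b} h"
  have g: "g x < ?b" "h (g x) = x" if "x \<in> X" for x
  proof -
    show "h (g x) = x" unfolding g_def by (rule bij_betw_inv_into_right[OF h that])
    have "g x \<in> {0..<?b}" using bij_betwE[OF bij_betw_inv_into[OF h]] that unfolding g_def by blast
    then show "g x < ?b" by simp
  qed
  have gh: "g (h j) = j" if "j < ?b" for j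
    using bij_betw_inv_into_left[OF h] that unfolding g_def by simp
  let ?to = "\<lambda>f. map (\<lambda>j. f (h j)) [0..<?b]"
  let ?from = "\<lambda>ys. \<lambda>x\<in>X. ys ! g x"
  have cnt: "count (mset (?to f)) i = card {x\<in>X. f x = i}" for f i
  proof -
    have "count (mset (?to f)) i = card {j. j < ?b \<and> f (h j) = i}"
      unfolding count_mset count_list_eq_length_filter length_filter_conv_card
      by (intro arg_cong[where f=card]) auto
    also have "\<dots> = card {x\<in>X. f x = i}"
    proof (rule bij_betw_same_card)
      show "bij_betw h {j. j < ?b \<and> f (h j) = i} {x\<in>X. f x = i}"
        by (rule bij_betw_byWitness[of _ g]) (use hX g gh in auto)
    qed
    finally show ?thesis .
  qed
  have "bij_betw ?to ?F (permutations_of_multiset A)"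
  proof (rule bij_betw_byWitness[of _ ?from])
    show "\<forall>f\<in>?F. ?from (?to f) = f"
      using g by (auto simp: fun_eq_iff PiE_def extensional_def)
    show "\<forall>ys\<in>permutations_of_multiset A. ?to (?from ys) = ys"
    proof
      fix ys assume "ys \<in> permutations_of_multiset A"
      then have "length ys = ?b" using sA by (metis permutations_of_multisetD size_mset)
      then show "?to (?from ys) = ys" using gh hX by (intro nth_equalityI) auto
    qed
    show "?to ` ?F \<subseteq> permutations_of_multiset A"
    proof
      fix ys assume "ys \<in> ?to ` ?F"
      then obtain f where f: "f \<in> ?F" "ys = ?to f" by blast
      have "card {x\<in>X. f x = i} = count A i" for i
        using f(1) unfolding cA by (auto simp: card_eq_0_iff PiE_def Pi_def)
      then have "mset ys = A" unfolding f(2) by (intro multiset_eqI) (simp only: cnt)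
      then show "ys \<in> permutations_of_multiset A" by (rule permutations_of_multisetI)
    qed
    show "?from ` permutations_of_multiset A \<subseteq> ?F"
    proof
      fix f assume "f \<in> ?from ` permutations_of_multiset A"
      then obtain ys where ys: "mset ys = A" "f = ?from ys" by (auto simp: permutations_of_multiset_def)
      have len: "length ys = ?b" using ys sA by (metis size_mset)
      have to: "?to f = ys" unfolding ys(2) using gh hX len by (intro nth_equalityI) auto
      have "card {x\<in>X. f x = i} = count A i" for i using cnt[of f i] unfolding to ys(1) by simp
      then have "\<forall>i\<in>{1..n}. card {x\<in>X. f x = i} = bs i" using cA by simp
      moreover have "f x \<in> {1..n}" if "x \<in> X" for x
      proof -
        have "f x \<in># A" unfolding ys(1)[symmetric] using that g(1)[OF that] len ys(2) by simp
        then show ?thesis using cA[of "f x"] by (metis count_eq_zero_iff)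
      qed
      ultimately show "f \<in> ?F" using ys(2) by auto
    qed
  qed
  then have "card ?F = card (permutations_of_multiset A)" by (rule bij_betw_same_card)
  also have "\<dots> = fact (card X) div (\<Prod>i\<in>set_mset A. fact (count A i))"
    unfolding card_permutations_of_multiset sA by simp
  also have "(\<Prod>i\<in>set_mset A. fact (count A i)) = (\<Prod>i\<in>{1..n}. fact (count A i) :: nat)"
  proof (rule prod.mono_neutral_left)
    show "set_mset A \<subseteq> {1..n}" using cA by (metis count_eq_zero_iff subsetI)
    show "\<forall>i\<in>{1..n} - set_mset A. fact (count A i) = (1::nat)" by (auto simp: not_in_iff)
  qed simp
  also have "\<dots> = (\<Prod>i=1..n. fact (bs i))" by (intro prod.cong refl) (simp add: cA)
  finally show ?thesis unfolding multinomial_def .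
qed

text \<open>Here \<open>m\<close> stands for \<open>2 * k\<close>. That every letter has one of the
  sizes \<open>m * i\<close> is implied once the two ways of counting letters agree, which is the
  assumption \<open>sum_s\<close> of the locale below.\<close>

definition content :: "nat \<Rightarrow> nat \<Rightarrow> nat \<Rightarrow> nat \<Rightarrow> (nat \<Rightarrow> nat) \<Rightarrow> (nat \<Rightarrow> nat) \<Rightarrow> (nat \<Rightarrow> nat \<Rightarrow> nat) set" where
  "content M l m n bs s = {g. (\<forall>e d. g e d \<noteq> 0 \<longrightarrow> e < M \<and> d \<in> {2..l+1}) \<and>
     (\<forall>i\<in>{1..n}. card (sized (m * i) g) = bs i) \<and>
     (\<forall>d\<in>{2..l+1}. card {e. g e d \<noteq> 0} = s d)}"

lemma card_vimage_bij: "bij f \<Longrightarrow> card (f -` X) = card X"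
  by (simp add: card_vimage_inj bij_def)

locale word_content =
  fixes M l m n :: nat and bs s :: "nat \<Rightarrow> nat"
  assumes m: "0 < m" and sum_s: "(\<Sum>d\<in>{2..l+1}. s d) = (\<Sum>i=1..n. bs i)"
begin

abbreviation "W \<equiv> content M l m n bs s"

lemma support:
  assumes "g \<in> W"
  shows "{(e, d). g e d \<noteq> 0} \<subseteq> {..<M} \<times> {2..l+1}" "finite {(e, d). g e d \<noteq> 0}"
proof -
  show *: "{(e, d). g e d \<noteq> 0} \<subseteq> {..<M} \<times> {2..l+1}"
    using assms unfolding content_def by blast
  show "finite {(e, d). g e d \<noteq> 0}" by (rule finite_subset[OF *]) simp
qed

lemma card_support_columns:
  assumes "\<And>e d. g e d \<noteq> 0 \<Longrightarrow> e < M \<and> d \<in> {2..l+1}"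
  shows "card {(e, d). g e d \<noteq> (0::nat)} = (\<Sum>d\<in>{2..l+1}. card {e. g e d \<noteq> 0})"
proof -
  have fin: "finite {e. g e d \<noteq> 0}" for d
    by (rule finite_subset[of _ "{..<M}"]) (use assms in blast, simp)
  have "{(e, d). g e d \<noteq> 0} = prod.swap ` (SIGMA d:{2..l+1}. {e. g e d \<noteq> 0})"
    using assms by force
  then have "card {(e, d). g e d \<noteq> 0} = card (SIGMA d:{2..l+1}. {e. g e d \<noteq> 0})"
    by (simp add: card_image)
  also have "\<dots> = (\<Sum>d\<in>{2..l+1}. card {e. g e d \<noteq> 0})"
    using fin by (intro card_SigmaI) auto
  finally show ?thesis .
qed

lemma card_support:
  assumes "g \<in> W"
  shows "card {(e, d). g e d \<noteq> 0} = (\<Sum>i=1..n. bs i)"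
proof -
  have "card {(e, d). g e d \<noteq> 0} = (\<Sum>d\<in>{2..l+1}. card {e. g e d \<noteq> 0})"
    by (rule card_support_columns) (use assms in \<open>auto simp: content_def\<close>)
  also have "\<dots> = (\<Sum>d\<in>{2..l+1}. s d)"
    by (intro sum.cong refl) (use assms in \<open>simp add: content_def\<close>)
  finally show ?thesis using sum_s by simp
qed

text \<open>The letters of sizes \<open>m * i\<close> number \<open>\<Sum>i=1..n. bs i\<close>, and
  by \<open>sum_s\<close> this is the number of all letters; an inclusion of finite sets of equal
  cardinality is an equality.\<close>

lemma support_by_value:
  assumes g: "g \<in> W"
  shows "{(e, d). g e d \<noteq> 0} = (\<Union>i\<in>{1..n}. sized (m * i) g)"
proof (rule card_subset_eq[OF support(2)[OF g], symmetric])
  show sub: "(\<Union>i\<in>{1..n}. sized (m * i) g) \<subseteq> {(e, d). g e d \<noteq> 0}"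
    using m by auto
  have "card (\<Union>i\<in>{1..n}. sized (m * i) g) = (\<Sum>i\<in>{1..n}. card (sized (m * i) g))"
  proof (rule card_UN_disjoint)
    show "\<forall>i\<in>{1..n}. finite (sized (m * i) g)"
      using finite_subset[OF sub support(2)[OF g]] by (auto intro: finite_subset[rotated])
    show "\<forall>i\<in>{1..n}. \<forall>j\<in>{1..n}. i \<noteq> j \<longrightarrow> sized (m * i) g \<inter> sized (m * j) g = {}"
      using m by auto
  qed simp
  also have "\<dots> = (\<Sum>i=1..n. bs i)"
    by (intro sum.cong refl) (use g in \<open>simp add: content_def\<close>)
  finally show "card (\<Union>i\<in>{1..n}. sized (m * i) g) = card {(e, d). g e d \<noteq> 0}"
    using card_support[OF g] by simp
qed

lemma total_content:
  assumes g: "g \<in> W"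
  shows "(\<Sum>e<M. \<Sum>d\<in>{2..l+1}. g e d) = m * (\<Sum>i=1..n. i * bs i)"
proof -
  have "(\<Sum>e<M. \<Sum>d\<in>{2..l+1}. g e d) = (\<Sum>(e, d)\<in>{..<M} \<times> {2..l+1}. g e d)"
    by (rule sum.cartesian_product)
  also have "\<dots> = (\<Sum>(e, d)\<in>{(e, d). g e d \<noteq> 0}. g e d)"
    by (rule sum.mono_neutral_right) (use support[OF g] in auto)
  also have "\<dots> = (\<Sum>i\<in>{1..n}. \<Sum>(e, d)\<in>sized (m * i) g. g e d)"
    unfolding support_by_value[OF g]
  proof (rule sum.UNION_disjoint)
    show "\<forall>i\<in>{1..n}. finite (sized (m * i) g)"
      using support(2)[OF g] unfolding support_by_value[OF g] by simp
    show "\<forall>i\<in>{1..n}. \<forall>j\<in>{1..n}. i \<noteq> j \<longrightarrow> sized (m * i) g \<inter> sized (m * j) g = {}"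
      using m by auto
  qed simp
  also have "\<dots> = (\<Sum>i\<in>{1..n}. m * (i * bs i))"
  proof (rule sum.cong[OF refl])
    fix i assume i: "i \<in> {1..n}"
    have "(\<Sum>(e, d)\<in>sized (m * i) g. g e d) = (\<Sum>_\<in>sized (m * i) g. m * i)"
      by (intro sum.cong refl) auto
    then show "(\<Sum>(e, d)\<in>sized (m * i) g. g e d) = m * (i * bs i)"
      using g i unfolding content_def by simp
  qed
  finally show ?thesis by (simp add: sum_distrib_left)
qed

text \<open>One set of positions per colour, chosen independently: the source of the product of
  binomials. Extensionality makes such a choice determined by its values on
  \<open>{2..l+1}\<close>.\<close>

definition supports :: "(nat \<Rightarrow> nat set) set" where
  "supports = ({2..l+1} \<rightarrow>\<^sub>E Pow {..<M}) \<inter> {R. \<forall>d\<in>{2..l+1}. card (R d) = s d}"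

lemma supports_PiE: "supports = (\<Pi>\<^sub>E d\<in>{2..l+1}. {A. A \<subseteq> {..<M} \<and> card A = s d})"
  unfolding supports_def by (auto simp: PiE_def Pi_def)

lemma card_supports: "card supports = (\<Prod>d\<in>{2..l+1}. M choose s d)" "finite supports"
  unfolding supports_PiE by (simp_all add: card_PiE n_subsets finite_PiE)

abbreviation "supp g \<equiv> \<lambda>d\<in>{2..l+1}. {e. g e d \<noteq> (0::nat)}"

lemma supp_in: "g \<in> W \<Longrightarrow> supp g \<in> supports"
  unfolding supports_def content_def by auto

text \<open>With the positions fixed, a word amounts to an index in \<open>{1..n}\<close> for each
  letter, index \<open>i\<close> being used \<open>bs i\<close> times; division by \<open>m\<close>
  leads from sizes to indices.\<close>

lemma card_fixed_support:
  assumes R: "R \<in> supports"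
  shows "card {g \<in> W. supp g = R} = multinomial (\<Sum>i=1..n. bs i) n bs" "finite {g \<in> W. supp g = R}"
proof -
  let ?X = "{(e, d). d \<in> {2..l+1} \<and> e \<in> R d}"
  have RM: "R d \<subseteq> {..<M}" "card (R d) = s d" if "d \<in> {2..l+1}" for d
    using R that unfolding supports_PiE by auto
  \<comment> \<open>The 0-1 word on the given positions, so that \<open>card_support_columns\<close>
    also counts \<open>?X\<close>.\<close>
  define r :: "nat \<Rightarrow> nat \<Rightarrow> nat" where "r = (\<lambda>e d. if (e, d) \<in> ?X then 1 else 0)"
  have rX: "{(e, d). r e d \<noteq> 0} = ?X" unfolding r_def by auto
  have "card {(e, d). r e d \<noteq> 0} = (\<Sum>d\<in>{2..l+1}. card {e. r e d \<noteq> 0})"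
    by (rule card_support_columns) (use RM in \<open>auto simp: r_def split: if_splits\<close>)
  also have "\<dots> = (\<Sum>d\<in>{2..l+1}. s d)"
    by (intro sum.cong refl) (use RM in \<open>simp add: r_def\<close>)
  finally have cX: "card ?X = (\<Sum>i=1..n. bs i)" unfolding rX sum_s .
  have finX: "finite ?X" by (rule finite_subset[of _ "{..<M} \<times> {2..l+1}"]) (use RM in auto)
  let ?F = "{f \<in> ?X \<rightarrow>\<^sub>E {1..n}. \<forall>i\<in>{1..n}. card {x\<in>?X. f x = i} = bs i}"
  let ?to = "\<lambda>g. \<lambda>x\<in>?X. g (fst x) (snd x) div m"
  let ?from = "\<lambda>f e d. if (e, d) \<in> ?X then m * f (e, d) else 0"
  have X: "{(e, d). g e d \<noteq> 0} = ?X" if "g \<in> W" "supp g = R" for g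
  proof -
    have "R d = {e. g e d \<noteq> 0}" if "d \<in> {2..l+1}" for d
      using fun_cong[OF \<open>supp g = R\<close>, of d] that by simp
    moreover have "d \<in> {2..l+1}" if "g e d \<noteq> 0" for e d
      using support(1)[OF \<open>g \<in> W\<close>] that by blast
    ultimately show ?thesis by blast
  qed
  have val: "\<exists>i\<in>{1..n}. g e d = m * i" if "g \<in> W" "supp g = R" "(e, d) \<in> ?X" for g e d
  proof -
    have "(e, d) \<in> {(e, d). g e d \<noteq> 0}" using that(3) unfolding X[OF that(1,2)] .
    then show ?thesis unfolding support_by_value[OF that(1)] by simp
  qed
  have B: "bij_betw ?to {g \<in> W. supp g = R} ?F"
  proof (rule bij_betw_byWitness[of _ ?from])
    show "\<forall>g\<in>{g \<in> W. supp g = R}. ?from (?to g) = g"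
    proof
      fix g assume g: "g \<in> {g \<in> W. supp g = R}"
      have "?from (?to g) e d = g e d" for e d
      proof (cases "(e, d) \<in> ?X")
        case True
        then obtain i where "g e d = m * i" using val[of g e d] g by blast
        then show ?thesis using True m by simp
      next
        case False
        then have "g e d = 0" using X[of g] g by blast
        then show ?thesis using False by simp
      qed
      then show "?from (?to g) = g" by blast
    qed
    show "\<forall>f\<in>?F. ?to (?from f) = f"
      using m by (auto simp: fun_eq_iff PiE_def extensional_def)
    show "?to ` {g \<in> W. supp g = R} \<subseteq> ?F"
    proof
      fix f assume "f \<in> ?to ` {g \<in> W. supp g = R}"
      then obtain g where g: "g \<in> W" "supp g = R" "f = ?to g" by blast
      have f: "f (e, d) \<in> {1..n} \<and> g e d = m * f (e, d)" if ed: "(e, d) \<in> ?X" for e d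
      proof -
        obtain i where "i \<in> {1..n}" "g e d = m * i" using val[OF g(1,2) ed] by blast
        then show ?thesis using ed m unfolding g(3) by simp
      qed
      have "{x\<in>?X. f x = i} = sized (m * i) g" if "i \<in> {1..n}" for i
      proof -
        have "(e, d) \<in> ?X \<and> f (e, d) = i \<longleftrightarrow> g e d = m * i" for e d
        proof (cases "(e, d) \<in> ?X")
          case True
          then show ?thesis using f[OF True] m by simp
        next
          case False
          then have "g e d = 0" using X[OF g(1,2)] by blast
          then show ?thesis using False that m by auto
        qed
        then show ?thesis by auto
      qed
      then have "\<forall>i\<in>{1..n}. card {x\<in>?X. f x = i} = bs i" using g(1) unfolding content_def by simp
      moreover have "f \<in> ?X \<rightarrow>\<^sub>E {1..n}" using f unfolding g(3) by (intro PiE_I) auto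
      ultimately show "f \<in> ?F" by blast
    qed
    show "?from ` ?F \<subseteq> {g \<in> W. supp g = R}"
    proof
      fix g assume "g \<in> ?from ` ?F"
      then obtain f where f: "f \<in> ?X \<rightarrow>\<^sub>E {1..n}" "\<And>i. i \<in> {1..n} \<Longrightarrow> card {x\<in>?X. f x = i} = bs i"
        and g: "g = ?from f" by blast
      have fp: "0 < f x" if "x \<in> ?X" for x
        using PiE_mem[OF f(1) that] by simp
      have nz: "g e d \<noteq> 0 \<longleftrightarrow> (e, d) \<in> ?X" for e d
        using m fp[of "(e, d)"] unfolding g by simp
      have lv: "sized (m * i) g = {x\<in>?X. f x = i}" if "i \<in> {1..n}" for i
        using m that unfolding g by (auto split: if_splits)
      have cols: "{e. g e d \<noteq> 0} = R d" if "d \<in> {2..l+1}" for d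
        using nz that by auto
      have "g e d \<noteq> 0 \<longrightarrow> e < M \<and> d \<in> {2..l+1}" for e d
        using nz[of e d] RM by auto
      then have "g \<in> W" unfolding content_def using lv f(2) cols RM(2) by simp
      moreover have "supp g = R"
      proof
        fix d show "supp g d = R d"
          using cols[of d] R unfolding supports_PiE by (cases "d \<in> {2..l+1}") (auto simp: PiE_def extensional_def)
      qed
      ultimately show "g \<in> {g \<in> W. supp g = R}" by blast
    qed
  qed
  have "card ?F = multinomial (card ?X) n bs"
    by (rule card_functions_with_fibres[OF finX cX])
  then show "card {g \<in> W. supp g = R} = multinomial (\<Sum>i=1..n. bs i) n bs"
    using bij_betw_same_card[OF B] cX by simp
  have "finite ?F" by (rule finite_subset[of _ "?X \<rightarrow>\<^sub>E {1..n}"]) (use finX in \<open>auto intro: finite_PiE\<close>)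
  then show "finite {g \<in> W. supp g = R}" using bij_betw_finite[OF B] by blast
qed

lemma card_content: "card W = multinomial (\<Sum>i=1..n. bs i) n bs * (\<Prod>d\<in>{2..l+1}. M choose s d)"
  and finite_content: "finite W"
proof -
  have W: "W = (\<Union>R\<in>supports. {g \<in> W. supp g = R})" using supp_in by blast
  show "finite W" by (subst W) (use card_supports card_fixed_support in blast)
  have "card W = (\<Sum>R\<in>supports. card {g \<in> W. supp g = R})"
    by (subst W, rule card_UN_disjoint) (use card_supports card_fixed_support in auto)
  also have "\<dots> = (\<Sum>R\<in>supports. multinomial (\<Sum>i=1..n. bs i) n bs)"
    by (intro sum.cong refl card_fixed_support)
  finally show "card W = multinomial (\<Sum>i=1..n. bs i) n bs * (\<Prod>d\<in>{2..l+1}. M choose s d)"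
    using card_supports by simp
qed

text \<open>Being the identity from \<open>M\<close> on, the shift is a bijection of all natural
  numbers, and preimages under it keep their cardinality.\<close>

definition shift :: "nat \<Rightarrow> nat \<Rightarrow> nat" where
  "shift r e = (if e < M then (e + r) mod M else e)"

definition rot :: "nat \<Rightarrow> (nat \<Rightarrow> nat \<Rightarrow> nat) \<Rightarrow> nat \<Rightarrow> nat \<Rightarrow> nat" where
  "rot r g = (\<lambda>e. g (shift r e))"

lemma bij_shift: "bij (shift r)"
proof -
  have le: "a = b" if "a \<le> b" "b < M" "(a + r) mod M = (b + r) mod M" for a b
  proof -
    have "M dvd (b + r) - (a + r)" using that by (subst mod_eq_dvd_iff_nat[symmetric]) auto
    then have "M dvd b - a" by simp
    then show ?thesis using that by (auto dest: dvd_imp_le)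
  qed
  have "inj_on (shift r) {..<M}"
  proof (rule inj_onI)
    fix a b assume "a \<in> {..<M}" "b \<in> {..<M}" "shift r a = shift r b"
    then show "a = b" using le[of a b] le[of b a] unfolding shift_def by (cases "a \<le> b") auto
  qed
  moreover have "shift r ` {..<M} \<subseteq> {..<M}" unfolding shift_def by auto
  ultimately have "bij_betw (shift r) {..<M} {..<M}"
    unfolding bij_betw_def by (simp add: endo_inj_surj)
  moreover have "bij_betw (shift r) {M..} {M..}"
    by (rule bij_betw_cong[THEN iffD1, OF _ bij_betw_id]) (simp add: shift_def)
  ultimately have "bij_betw (shift r) ({..<M} \<union> {M..}) ({..<M} \<union> {M..})"
    by (rule bij_betw_combine) auto
  moreover have "{..<M} \<union> {M..} = UNIV" by auto
  ultimately show ?thesis by simp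
qed

lemma bij_rot: "bij_betw (rot r) W W"
proof -
  have "rot r g \<in> W" if g: "g \<in> W" for g
  proof -
    have "bij (map_prod (shift r) (id :: nat \<Rightarrow> nat))"
      by (intro bijI prod.inj_map map_prod_surj) (use bij_shift[of r] in \<open>auto simp: bij_def\<close>)
    from card_vimage_bij[OF this, of "sized v g" for v]
    have "card (sized v (rot r g)) = card (sized v g)" for v
      by (simp add: rot_def vimage_def case_prod_unfold)
    moreover have "card {e. rot r g e d \<noteq> 0} = card {e. g e d \<noteq> 0}" for d
      using card_vimage_bij[OF bij_shift[of r], of "{e. g e d \<noteq> 0}"] by (simp add: rot_def vimage_def)
    moreover have "rot r g e d \<noteq> 0 \<longrightarrow> e < M \<and> d \<in> {2..l+1}" for e d
      using g unfolding content_def rot_def shift_def by auto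
    ultimately show ?thesis using g unfolding content_def by simp
  qed
  moreover have "inj_on (rot r) W"
  proof (rule inj_onI, rule ext)
    fix g h e assume "rot r g = rot r h"
    then have "g (shift r e') = h (shift r e')" for e' unfolding rot_def by meson
    moreover obtain e' where "e = shift r e'" using bij_shift[of r] by (metis bij_pointE)
    ultimately show "g e = h e" by simp
  qed
  ultimately show ?thesis
    unfolding bij_betw_def by (intro conjI endo_inj_surj finite_content image_subsetI)
qed

text \<open>Double counting of pairs of a word and a rotation that makes it satisfy the ballot
  condition: \<open>cycle_lemma\<close> counts the rotations for each word, and since rotations
  permute \<open>W\<close>, each rotation has the same number of words.\<close>

lemma card_ballot_content:
  assumes less: "m * (\<Sum>i=1..n. i * bs i) < M"
  shows "M * card {g \<in> W. \<forall>p<M. total l g p \<le> p} = (M - m * (\<Sum>i=1..n. i * bs i)) * card W"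
proof -
  let ?G = "\<lambda>g. \<forall>p<M. total l g p \<le> p"
  have 1: "card {r\<in>{..<M}. ?G (rot r g)} = M - m * (\<Sum>i=1..n. i * bs i)" if g: "g \<in> W" for g
  proof -
    have "total l (rot r g) p = (\<Sum>e\<le>p. \<Sum>d\<in>{2..l+1}. g ((e + r) mod M) d)" if "p < M" for r p
      unfolding total_def rot_def shift_def using that by (intro sum.cong refl) auto
    then show ?thesis
      using cycle_lemma[of "\<lambda>e. \<Sum>d\<in>{2..l+1}. g e d" M] total_content[OF g] less
      by (simp cong: conj_cong)
  qed
  have 2: "card {g \<in> W. ?G (rot r g)} = card {g \<in> W. ?G g}" for r
  proof (rule bij_betw_same_card[of "rot r"])
    show "bij_betw (rot r) {g \<in> W. ?G (rot r g)} {g \<in> W. ?G g}"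
      using bij_rot[of r] unfolding bij_betw_def inj_on_def by (auto; blast)
  qed
  have "(\<Sum>g\<in>W. card {r\<in>{..<M}. ?G (rot r g)}) = (\<Sum>r<M. card {g \<in> W. ?G (rot r g)})"
    by (rule sum_multicount_gen) (simp_all add: finite_content)
  moreover have "(\<Sum>g\<in>W. card {r\<in>{..<M}. ?G (rot r g)}) = (\<Sum>g\<in>W. M - m * (\<Sum>i=1..n. i * bs i))"
    by (rule sum.cong[OF refl 1])
  ultimately show ?thesis by (simp add: 2 mult.commute)
qed

end

section \<open>Partitions invariant under the half turn\<close>

definition rel_of :: "nat set set \<Rightarrow> nat rel" where
  "rel_of P = {(x, y). \<exists>B\<in>P. x \<in> B \<and> y \<in> B}"

lemma equiv_rel_of: "partition_on A P \<Longrightarrow> equiv A (rel_of P)"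
  unfolding rel_of_def by (rule equiv_partition_on)

lemma quotient_rel_of: "partition_on A P \<Longrightarrow> A // rel_of P = P"
  unfolding rel_of_def by (rule partition_on_eq_quotient)

lemma rel_of_quotient:
  assumes "equiv A S"
  shows "rel_of (A // S) = S"
proof (intro equalityI subrelI)
  note E = equivD[OF assms]
  fix u v assume "(u, v) \<in> rel_of (A // S)"
  then obtain w where "(w, u) \<in> S" "(w, v) \<in> S" unfolding rel_of_def quotient_def by blast
  then show "(u, v) \<in> S" by (metis E(2,3))
next
  note E = equivD[OF assms]
  fix u v assume uv: "(u, v) \<in> S"
  have "u \<in> A" "(u, u) \<in> S" using E(1,4) uv by blast+
  then show "(u, v) \<in> rel_of (A // S)" using uv unfolding rel_of_def quotient_def by blast
qed

lemma rel_of_class: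
  assumes "partition_on A P" "B \<in> P" "u \<in> B"
  shows "rel_of P `` {u} = B"
proof
  show "B \<subseteq> rel_of P `` {u}" using assms(2,3) unfolding rel_of_def by blast
  show "rel_of P `` {u} \<subseteq> B"
  proof
    fix v assume "v \<in> rel_of P `` {u}"
    then obtain C where "C \<in> P" "u \<in> C" "v \<in> C" unfolding rel_of_def by blast
    moreover from this have "C = B"
      using partition_onD2[OF assms(1)] assms(2,3) unfolding disjoint_def by blast
    ultimately show "v \<in> B" by simp
  qed
qed

lemma class_in_partition:
  assumes "partition_on A P" "u \<in> A"
  shows "rel_of P `` {u} \<in> P"
proof -
  obtain B where "B \<in> P" "u \<in> B" using partition_onD1[OF assms(1)] assms(2) by blast
  then show ?thesis using rel_of_class[OF assms(1)] by simp
qed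

lemma noncrossing_iff_nc_rel:
  assumes P: "partition_on A P"
  shows "noncrossing P \<longleftrightarrow> nc_rel (rel_of P)"
proof
  assume nc: "noncrossing P"
  show "nc_rel (rel_of P)"
    unfolding nc_rel_def
  proof (intro allI impI)
    fix a b c d :: nat assume o: "a < b" "b < c" "c < d" "(a, c) \<in> rel_of P" "(b, d) \<in> rel_of P"
    then obtain B C where BC: "B \<in> P" "C \<in> P" "a \<in> B" "c \<in> B" "b \<in> C" "d \<in> C"
      unfolding rel_of_def by blast
    then have "B = C" using nc o(1,2,3) unfolding noncrossing_def by metis
    then show "(a, b) \<in> rel_of P" using BC unfolding rel_of_def by blast
  qed
next
  assume nc: "nc_rel (rel_of P)"
  show "noncrossing P"
    unfolding noncrossing_def
  proof (intro ballI impI notI)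
    fix B C assume BC: "B \<in> P" "C \<in> P" "B \<noteq> C"
    assume "\<exists>a b c d. a < b \<and> b < c \<and> c < d \<and> a \<in> B \<and> c \<in> B \<and> b \<in> C \<and> d \<in> C"
    then obtain a b c d where o: "a < b" "b < c" "c < d" and m: "a \<in> B" "c \<in> B" "b \<in> C" "d \<in> C"
      by blast
    have "(a, c) \<in> rel_of P" "(b, d) \<in> rel_of P" using BC m unfolding rel_of_def by blast+
    then have "(a, b) \<in> rel_of P" by (rule nc_relD[OF nc o])
    then have "b \<in> B" using rel_of_class[OF P BC(1) m(1)] by blast
    then show False using rel_of_class[OF P BC(1)] rel_of_class[OF P BC(2) m(3)] BC(3) by simp
  qed
qed

lemma refines_iff:
  assumes P: "partition_on A P" and Q: "partition_on A Q"
  shows "Defs.refines P Q \<longleftrightarrow> rel_of P \<subseteq> rel_of Q"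
proof
  assume r: "Defs.refines P Q"
  show "rel_of P \<subseteq> rel_of Q"
  proof (rule subrelI)
    fix u v assume "(u, v) \<in> rel_of P"
    then obtain B where B: "B \<in> P" "u \<in> B" "v \<in> B" unfolding rel_of_def by blast
    then obtain C where "C \<in> Q" "B \<subseteq> C" using r unfolding Defs.refines_def by blast
    then show "(u, v) \<in> rel_of Q" using B unfolding rel_of_def by blast
  qed
next
  assume sub: "rel_of P \<subseteq> rel_of Q"
  show "Defs.refines P Q"
    unfolding Defs.refines_def
  proof
    fix B assume B: "B \<in> P"
    then obtain u where u: "u \<in> B" using partition_onD3[OF P] by fastforce
    then have "u \<in> A" using partition_onD1[OF P] B by blast
    then have "rel_of Q `` {u} \<in> Q" by (rule class_in_partition[OF Q])
    moreover have "B \<subseteq> rel_of Q `` {u}" using rel_of_class[OF P B u] sub by blast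
    ultimately show "\<exists>C\<in>Q. B \<subseteq> C" by blast
  qed
qed

locale antipodal =
  fixes k n M :: nat
  assumes k: "0 < k" and M: "M = k * (2 * n + 1)"
begin

abbreviation "\<rho> \<equiv> rho k n"

abbreviation "pts \<equiv> {1..2 * M}"

lemma M_pos: "0 < M" using k M by simp

lemma rho_eq: "\<rho> u = (if u \<le> M then u + M else u - M)"
  unfolding rho_def M Let_def by simp

lemma rho_in: "u \<in> pts \<Longrightarrow> \<rho> u \<in> pts"
  unfolding rho_eq by auto

lemma rho_rho: "u \<in> pts \<Longrightarrow> \<rho> (\<rho> u) = u"
  unfolding rho_eq by auto

lemma rho_half: "u \<in> pts \<Longrightarrow> \<rho> u \<le> M \<longleftrightarrow> \<not> u \<le> M"
  unfolding rho_eq by auto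

lemma inj_rho: "inj_on \<rho> pts"
  by (rule inj_on_inverseI[of _ \<rho>]) (rule rho_rho)

definition sym_rel :: "nat rel \<Rightarrow> bool" where
  "sym_rel S \<longleftrightarrow> equiv pts S \<and> nc_rel S \<and> (\<forall>u v. (u, v) \<in> S \<longrightarrow> (\<rho> u, \<rho> v) \<in> S)"

lemma sym_relD:
  assumes "sym_rel S"
  shows "equiv pts S" "nc_rel S" "(u, v) \<in> S \<Longrightarrow> (\<rho> u, \<rho> v) \<in> S"
  using assms unfolding sym_rel_def by blast+

definition sym_nc :: "nat set set \<Rightarrow> bool" where
  "sym_nc P \<longleftrightarrow> partition_on pts P \<and> noncrossing P \<and> rho_block k n ` P = P"

lemma NCt_iff: "P \<in> NCt k n \<longleftrightarrow> sym_nc P \<and> (\<forall>B\<in>P. 2 * k dvd card B)"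
proof -
  have "2 * k * (2 * n + 1) = 2 * M" unfolding M by (simp only: mult.assoc)
  then show ?thesis unfolding NCt_def sym_nc_def by auto
qed

lemma rho_block_class:
  assumes S: "sym_rel S" and u: "u \<in> pts"
  shows "\<rho> ` (S `` {u}) = S `` {\<rho> u}"
proof
  show "\<rho> ` (S `` {u}) \<subseteq> S `` {\<rho> u}" using sym_relD(3)[OF S] by blast
  show "S `` {\<rho> u} \<subseteq> \<rho> ` (S `` {u})"
  proof
    fix v assume v: "v \<in> S `` {\<rho> u}"
    then have "(\<rho> (\<rho> u), \<rho> v) \<in> S" using sym_relD(3)[OF S] by blast
    then have "\<rho> v \<in> S `` {u}" using rho_rho[OF u] by simp
    moreover have "v \<in> pts" using v equivD(5)[OF sym_relD(1)[OF S]] by blast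
    then have "\<rho> (\<rho> v) = v" by (rule rho_rho)
    ultimately show "v \<in> \<rho> ` (S `` {u})" by (metis imageI)
  qed
qed

text \<open>Since \<open>\<rho>\<close> is an involution, the one-sided invariance of the relation
  already makes \<open>\<rho>\<close> permute the blocks.\<close>

lemma sym_nc_iff:
  assumes P: "partition_on pts P"
  shows "sym_nc P \<longleftrightarrow> sym_rel (rel_of P)"
proof -
  have "rho_block k n ` P = P \<longleftrightarrow> (\<forall>u v. (u, v) \<in> rel_of P \<longrightarrow> (\<rho> u, \<rho> v) \<in> rel_of P)"
    (is "?L \<longleftrightarrow> ?R")
  proof
    assume L: ?L
    show ?R
    proof (intro allI impI)
      fix u v assume "(u, v) \<in> rel_of P"
      then obtain B where B: "B \<in> P" "u \<in> B" "v \<in> B" unfolding rel_of_def by blast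
      then have "\<rho> ` B \<in> P" using L unfolding rho_block_def by blast
      then show "(\<rho> u, \<rho> v) \<in> rel_of P" using B unfolding rel_of_def by blast
    qed
  next
    assume R: ?R
    have img: "\<rho> ` B \<in> P \<and> \<rho> ` (\<rho> ` B) = B" if B: "B \<in> P" for B
    proof -
      obtain u where u: "u \<in> B" using partition_onD3[OF P] B by fastforce
      have BA: "B \<subseteq> pts" using partition_onD1[OF P] B by blast
      have uA: "u \<in> pts" using BA u by blast
      have "\<rho> ` (\<rho> ` B) = (\<lambda>v. \<rho> (\<rho> v)) ` B" by (rule image_image)
      also have "\<dots> = (\<lambda>v. v) ` B" by (rule image_cong[OF refl]) (use BA rho_rho in blast)
      finally have bb: "\<rho> ` (\<rho> ` B) = B" by simp
      have sub: "\<rho> ` (rel_of P `` {w}) \<subseteq> rel_of P `` {\<rho> w}" for w using R by blast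
      have "\<rho> ` B \<subseteq> rel_of P `` {\<rho> u}" using sub[of u] rel_of_class[OF P B u] by simp
      moreover have "rel_of P `` {\<rho> u} \<subseteq> \<rho> ` B"
      proof
        fix v assume v: "v \<in> rel_of P `` {\<rho> u}"
        then have "\<rho> v \<in> rel_of P `` {\<rho> (\<rho> u)}" using sub[of "\<rho> u"] by blast
        then have "\<rho> v \<in> B" using rho_rho[OF uA] rel_of_class[OF P B u] by simp
        moreover have "\<rho> (\<rho> v) = v"
          using v equivD(5)[OF equiv_rel_of[OF P]] by (intro rho_rho) blast
        ultimately show "v \<in> \<rho> ` B" by (metis imageI)
      qed
      ultimately have "\<rho> ` B = rel_of P `` {\<rho> u}" by blast
      then show ?thesis using class_in_partition[OF P rho_in[OF uA]] bb by simp
    qed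
    show ?L
    proof (intro equalityI subsetI)
      fix B assume "B \<in> rho_block k n ` P"
      then show "B \<in> P" using img unfolding rho_block_def by blast
    next
      fix B assume "B \<in> P"
      then show "B \<in> rho_block k n ` P" using img[of B] unfolding rho_block_def by (metis imageI)
    qed
  qed
  then show ?thesis
    unfolding sym_nc_def sym_rel_def noncrossing_iff_nc_rel[OF P] using P equiv_rel_of[OF P] by blast
qed

text \<open>If \<open>1\<close> and \<open>M + 1\<close> lie in one block, that block separates the two halves, so the partition
  is determined by its restriction to \<open>{1..M}\<close>, shifted here to \<open>{..<M}\<close>. The class of \<open>0\<close> is the
  only one whose two copies are joined.\<close>
definition res :: "nat \<Rightarrow> nat" where "res u = (if u \<le> M then u - 1 else u - M - 1)"

definition down :: "nat rel \<Rightarrow> nat rel" where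
  "down S = {(a, b). a < M \<and> b < M \<and> (Suc a, Suc b) \<in> S}"

definition up :: "nat rel \<Rightarrow> nat rel" where
  "up R = {(u, v). u \<in> pts \<and> v \<in> pts \<and> (res u, res v) \<in> R \<and>
     ((u \<le> M \<longleftrightarrow> v \<le> M) \<or> (0, res u) \<in> R)}"

lemma res_lt: "u \<in> pts \<Longrightarrow> res u < M"
  unfolding res_def using M_pos by auto

lemma res_rho: "u \<in> pts \<Longrightarrow> res (\<rho> u) = res u"
  unfolding res_def rho_eq by auto

lemma res_Suc: "a < M \<Longrightarrow> res (Suc a) = a" unfolding res_def by simp

lemma ground: "{..M - 1} = {..<M}" using M_pos by auto

lemma Suc_res: "u \<in> pts \<Longrightarrow> Suc (res u) = (if u \<le> M then u else \<rho> u)"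
  unfolding res_def rho_eq by auto

lemma nc_rel_down:
  assumes "nc_rel S"
  shows "nc_rel (down S)"
  unfolding nc_rel_def
proof (intro allI impI)
  fix a b c d :: nat
  assume *: "a < b" "b < c" "c < d" "(a, c) \<in> down S" "(b, d) \<in> down S"
  then have "(Suc a, Suc c) \<in> S" "(Suc b, Suc d) \<in> S" unfolding down_def by blast+
  then have "(Suc a, Suc b) \<in> S" using nc_relD[OF assms] *(1-3) by blast
  then show "(a, b) \<in> down S" using *(4,5) unfolding down_def by blast
qed

lemma equiv_down:
  assumes "equiv pts S"
  shows "equiv {..<M} (down S)"
proof (rule equivI)
  note E = equivD[OF assms]
  show "down S \<subseteq> {..<M} \<times> {..<M}" unfolding down_def by auto
  show "refl_on {..<M} (down S)"
  proof (rule refl_onI)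
    fix a assume "a \<in> {..<M}"
    then show "(a, a) \<in> down S" unfolding down_def using E(1)[of "Suc a"] by simp
  qed
  show "sym (down S)"
  proof (rule symI)
    fix a b assume "(a, b) \<in> down S"
    then show "(b, a) \<in> down S" unfolding down_def using E(2)[of "Suc a" "Suc b"] by simp
  qed
  show "trans (down S)"
  proof (rule transI)
    fix a b c assume "(a, b) \<in> down S" "(b, c) \<in> down S"
    then show "(a, c) \<in> down S" unfolding down_def using E(3)[of "Suc a" "Suc b" "Suc c"] by simp
  qed
qed

lemma sym_up:
  assumes R: "equiv {..<M} R" "nc_rel R"
  shows "sym_rel (up R)" "(1, M + 1) \<in> up R"
proof -
  note E = equivD[OF R(1)]
  have z: "(0, 0) \<in> R" using E(1) M_pos by simp
  show "(1, M + 1) \<in> up R" unfolding up_def res_def using z M_pos by simp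
  have eq: "equiv pts (up R)"
  proof (rule equivI)
    show "up R \<subseteq> pts \<times> pts" unfolding up_def by blast
    show "refl_on pts (up R)" unfolding up_def refl_on_def using E(1) res_lt by auto
    show "sym (up R)"
    proof (rule symI)
      fix u v assume *: "(u, v) \<in> up R"
      then have "(res u, res v) \<in> R" unfolding up_def by blast
      then have "(res v, res u) \<in> R" "(0, res u) \<in> R \<Longrightarrow> (0, res v) \<in> R"
        using E(2) E(3)[of 0 "res u" "res v"] by blast+
      then show "(v, u) \<in> up R" using * unfolding up_def by auto
    qed
    show "trans (up R)"
    proof (rule transI)
      fix u v w assume *: "(u, v) \<in> up R" "(v, w) \<in> up R"
      have r: "(res u, res v) \<in> R" "(res v, res w) \<in> R" using * unfolding up_def by blast+
      have "(0, res v) \<in> R \<Longrightarrow> (0, res u) \<in> R" using E(3)[OF _ E(2)[OF r(1)]] by blast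
      moreover have "(res u, res w) \<in> R" by (rule E(3)[OF r])
      ultimately show "(u, w) \<in> up R" using * unfolding up_def by auto
    qed
  qed
  have inv: "(\<rho> u, \<rho> v) \<in> up R" if "(u, v) \<in> up R" for u v
  proof -
    have uv: "u \<in> pts" "v \<in> pts" using that unfolding up_def by blast+
    then show ?thesis
      using that rho_in[OF uv(1)] rho_in[OF uv(2)] res_rho[OF uv(1)] res_rho[OF uv(2)] rho_half[OF uv(1)] rho_half[OF uv(2)]
      unfolding up_def by auto
  qed
  have nc: "nc_rel (up R)"
    unfolding nc_rel_def
  proof (intro allI impI)
    fix a b c d :: nat assume o: "a < b" "b < c" "c < d" and ac: "(a, c) \<in> up R" and bd: "(b, d) \<in> up R"
    have ran: "a \<in> pts" "b \<in> pts" "c \<in> pts" "d \<in> pts"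
      using ac bd unfolding up_def by blast+
    have rs: "(res a, res c) \<in> R" "(res b, res d) \<in> R" using ac bd unfolding up_def by blast+
    have mono: "res u < res v" if "u \<in> pts" "v \<in> pts" "u < v" "u \<le> M \<longleftrightarrow> v \<le> M" for u v
      using that unfolding res_def by auto
    \<comment> \<open>If \<open>a\<close> is in the class of \<open>0\<close> and \<open>b\<close>
      is not, then \<open>b\<close>, \<open>c\<close>, \<open>d\<close> share a half, and
      \<open>0\<close> crosses there together with them. If \<open>a\<close> is not in that class,
      then neither is \<open>b\<close>, and all four points share a half, where noncrossing of
      \<open>R\<close> applies.\<close>
    show "(a, b) \<in> up R"
    proof (cases "(0, res a) \<in> R")
      case True
      then have c0: "(0, res c) \<in> R" using rs E(3) by blast
      have "(0, res b) \<in> R"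
      proof (rule ccontr)
        assume b0: "(0, res b) \<notin> R"
        then have h: "b \<le> M \<longleftrightarrow> d \<le> M" using bd unfolding up_def by blast
        then have "b \<le> M \<longleftrightarrow> c \<le> M" "c \<le> M \<longleftrightarrow> d \<le> M" using o by auto
        then have "res b < res c" "res c < res d" using mono ran o by blast+
        moreover have "0 < res b" using b0 z by (cases "res b = 0") auto
        ultimately show False using nc_relD[OF R(2) _ _ _ c0 rs(2)] b0 by blast
      qed
      then have "(res a, res b) \<in> R" using True E(2)[OF True] E(3)[of "res a" 0 "res b"] by blast
      then show ?thesis using True ran unfolding up_def by blast
    next
      case a0: False
      then have "a \<le> M \<longleftrightarrow> c \<le> M" using ac unfolding up_def by blast
      then have hab: "a \<le> M \<longleftrightarrow> b \<le> M" "b \<le> M \<longleftrightarrow> c \<le> M" using o by auto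
      have lt: "res a < res b" "res b < res c" using mono ran o hab by blast+
      have b0: "(0, res b) \<notin> R"
      proof
        assume b0: "(0, res b) \<in> R"
        have "0 < res a" using a0 z by (cases "res a = 0") auto
        then show False using nc_relD[OF R(2) _ lt b0 rs(1)] a0 by blast
      qed
      then have "b \<le> M \<longleftrightarrow> d \<le> M" using bd unfolding up_def by blast
      then have "res c < res d" using mono[OF ran(3,4) o(3)] hab by blast
      then have "(res a, res b) \<in> R" using nc_relD[OF R(2) lt _ rs] by blast
      then show ?thesis using ran hab unfolding up_def by blast
    qed
  qed
  show "sym_rel (up R)" unfolding sym_rel_def using eq inv nc by blast
qed

lemma down_up:
  assumes "equiv {..<M} R"
  shows "down (up R) = R"
proof (intro equalityI subrelI)
  fix a b assume "(a, b) \<in> down (up R)"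
  then have "a < M" "b < M" "(res (Suc a), res (Suc b)) \<in> R" unfolding down_def up_def by blast+
  then show "(a, b) \<in> R" by (simp add: res_Suc)
next
  fix a b assume ab: "(a, b) \<in> R"
  then have "a < M" "b < M" using equivD(4,5)[OF assms] by blast+
  then show "(a, b) \<in> down (up R)" unfolding down_def up_def using ab res_Suc by auto
qed

text \<open>A pair joining the two halves crosses \<open>(1, M + 1)\<close> or shares an endpoint
  with it, so it lies in the block of \<open>1\<close>. All other blocks stay within one half, and
  the upper half is the image of the lower one.\<close>

lemma up_down:
  assumes S: "sym_rel S" and c: "(1, M + 1) \<in> S"
  shows "up (down S) = S"
proof -
  note E = equivD[OF sym_relD(1)[OF S]] and inv = sym_relD(3)[OF S]
  \<comment> \<open>The representative of \<open>u\<close> in the lower half, equal to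
    \<open>Suc (res u)\<close> on \<open>pts\<close>.\<close>
  define r where "r u = (if u \<le> M then u else \<rho> u)" for u
  have r: "r u \<le> M" "1 \<le> r u" if "u \<in> pts" for u using that unfolding r_def rho_eq by auto
  have rr: "(res u, res v) \<in> down S \<longleftrightarrow> (r u, r v) \<in> S" if "u \<in> pts" "v \<in> pts" for u v
    using that res_lt Suc_res unfolding down_def r_def by auto
  have same: "(r u, r v) \<in> S \<longleftrightarrow> (u, v) \<in> S" if "u \<in> pts" "v \<in> pts" "u \<le> M \<longleftrightarrow> v \<le> M" for u v
    using that inv[of u v] inv[of "\<rho> u" "\<rho> v"] rho_rho[of u] rho_rho[of v] unfolding r_def by auto
  have r1: "r 1 = 1" using M_pos unfolding r_def by auto
  have one: "1 \<in> pts" using M_pos by auto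
  have res1: "res 1 = 0" unfolding res_def by simp
  have \<rho>1: "\<rho> 1 = M + 1" "\<rho> (M + 1) = 1" using M_pos unfolding rho_eq by auto
  have central: "(1, u) \<in> S" if "(1, r u) \<in> S" "u \<in> pts" for u
  proof (cases "u \<le> M")
    case False
    then have "(\<rho> 1, \<rho> (\<rho> u)) \<in> S" using that inv[of 1 "\<rho> u"] unfolding r_def by simp
    then have "(M + 1, u) \<in> S" using \<rho>1 rho_rho[OF that(2)] by simp
    then show ?thesis using c E(3) by blast
  qed (use that in \<open>simp add: r_def\<close>)
  have across: "(1, r u) \<in> S \<and> (1, r v) \<in> S" if uv: "(u, v) \<in> S" "u \<le> M" "\<not> v \<le> M" for u v
  proof -
    have ran: "u \<in> pts" "v \<in> pts" using E(4,5) uv(1) by blast+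
    have u1: "(1, u) \<in> S"
    proof -
      consider "u = 1" | "v = M + 1" | "1 < u" "u < M + 1" "M + 1 < v" using uv(2,3) ran by fastforce
      then show ?thesis
      proof cases
        case 1
        then show ?thesis using E(1)[OF one] by simp
      next
        case 2
        then show ?thesis using c E(2)[OF uv(1)] E(3)[of 1 "M + 1" u] by simp
      next
        case 3
        then show ?thesis using nc_relD[OF sym_relD(2)[OF S] 3 c uv(1)] by blast
      qed
    qed
    then have "(1, v) \<in> S" using uv(1) E(3) by blast
    then have "(\<rho> 1, \<rho> v) \<in> S" by (rule inv)
    then have "(1, \<rho> v) \<in> S" using \<rho>1 c E(3)[of 1 "M + 1"] by simp
    then show ?thesis using u1 uv(2,3) unfolding r_def by simp
  qed
  have up_iff: "(u, v) \<in> up (down S) \<longleftrightarrow> u \<in> pts \<and> v \<in> pts \<and> (r u, r v) \<in> S \<and> ((u \<le> M \<longleftrightarrow> v \<le> M) \<or> (1, r u) \<in> S)" for u v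
    unfolding up_def using rr[of u v] rr[OF one, of u] r1 res1 by auto
  show ?thesis
  proof (intro equalityI subrelI)
    fix u v assume "(u, v) \<in> up (down S)"
    then have *: "u \<in> pts" "v \<in> pts" "(r u, r v) \<in> S" "(u \<le> M \<longleftrightarrow> v \<le> M) \<or> (1, r u) \<in> S"
      unfolding up_iff by blast+
    show "(u, v) \<in> S"
    proof (cases "u \<le> M \<longleftrightarrow> v \<le> M")
      case True
      then show ?thesis using same[OF *(1,2)] *(3) by blast
    next
      case False
      then have "(1, r u) \<in> S" using *(4) by blast
      moreover from this have "(1, r v) \<in> S" using *(3) E(3) by blast
      ultimately have "(1, u) \<in> S" "(1, v) \<in> S" using central *(1,2) by blast+
      then show ?thesis using E(2)[of 1 u] E(3)[of u 1 v] by blast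
    qed
  next
    fix u v assume uv: "(u, v) \<in> S"
    have ran: "u \<in> pts" "v \<in> pts" using E(4,5) uv by blast+
    show "(u, v) \<in> up (down S)"
    proof (cases "u \<le> M \<longleftrightarrow> v \<le> M")
      case True
      then show ?thesis unfolding up_iff using same[OF ran True] uv ran by blast
    next
      case False
      then have "(1, r u) \<in> S \<and> (1, r v) \<in> S"
        using across[OF uv] across[OF E(2)[OF uv]] by blast
      then show ?thesis unfolding up_iff using ran E(2)[of 1 "r u"] E(3)[of "r u" 1 "r v"] by blast
    qed
  qed
qed

lemma up_mono: "R \<subseteq> R' \<Longrightarrow> up R \<subseteq> up R'" and down_mono: "S \<subseteq> S' \<Longrightarrow> down S \<subseteq> down S'"
  unfolding up_def down_def by blast+

end

section \<open>Pairs of antipodal blocks and the size of the fixed block\<close>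

context antipodal
begin

lemma sym_ncD:
  assumes "sym_nc P"
  shows "partition_on pts P" "sym_rel (rel_of P)" "B \<in> P \<Longrightarrow> B \<subseteq> pts"
    "B \<in> P \<Longrightarrow> finite B" "B \<in> P \<Longrightarrow> \<rho> ` B \<in> P" "B \<in> P \<Longrightarrow> \<rho> ` \<rho> ` B = B"
    "B \<in> P \<Longrightarrow> card (\<rho> ` B) = card B" "finite P"
proof -
  show P: "partition_on pts P" using assms unfolding sym_nc_def by blast
  show "sym_rel (rel_of P)" using assms sym_nc_iff[OF P] by blast
  show sub: "B \<in> P \<Longrightarrow> B \<subseteq> pts" for B using partition_onD1[OF P] by blast
  then show "B \<in> P \<Longrightarrow> finite B" using finite_subset by blast
  show "B \<in> P \<Longrightarrow> \<rho> ` B \<in> P" using assms unfolding sym_nc_def rho_block_def by blast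
  show "B \<in> P \<Longrightarrow> \<rho> ` \<rho> ` B = B"
  proof -
    assume B: "B \<in> P"
    have "\<rho> ` \<rho> ` B = (\<lambda>v. \<rho> (\<rho> v)) ` B" by (rule image_image)
    also have "\<dots> = (\<lambda>v. v) ` B" by (rule image_cong[OF refl]) (use sub[OF B] rho_rho in blast)
    finally show ?thesis by simp
  qed
  show "B \<in> P \<Longrightarrow> card (\<rho> ` B) = card B" using card_image inj_on_subset[OF inj_rho sub] by blast
  show "finite P" by (rule finite_elements[OF _ P]) simp
qed

text \<open>The predicate covers \<open>pair_count\<close> and \<open>pair_count_size\<close> by a
  single bijection with heads.\<close>

definition pairs :: "(nat \<Rightarrow> bool) \<Rightarrow> nat set set \<Rightarrow> nat set set set" where
  "pairs Q P = {{B, rho_block k n B} | B. B \<in> P \<and> rho_block k n B \<noteq> B \<and> Q (card B)}"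

lemma pair_count_pairs: "pair_count k n P = card (pairs (\<lambda>_. True) P)"
  unfolding pair_count_def pairs_def by simp

lemma pair_count_size_pairs: "pair_count_size k n P i = card (pairs (\<lambda>j. j = 2 * k * i) P)"
  unfolding pair_count_size_def pairs_def by simp

text \<open>Only the block of \<open>1\<close> meets both halves, so every pair has exactly one
  member in the lower half, represented by its minimum. The class of \<open>0\<close> is the trace
  of the fixed block and contributes no head.\<close>

lemma card_pairs:
  assumes P: "sym_nc P" and c: "(1, M + 1) \<in> rel_of P"
  shows "card (pairs Q P) = card {y\<in>heads (M - 1) {0} (down (rel_of P)). Q (card (down (rel_of P) `` {y}))}"
proof -
  note P' = sym_ncD[OF P]
  define S where "S = rel_of P"
  define R where "R = down S"
  have S: "sym_rel S" "(1, M + 1) \<in> S" using P'(2) c unfolding S_def by auto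
  have eqR: "equiv {..<M} R" unfolding R_def by (rule equiv_down[OF sym_relD(1)[OF S(1)]])
  note E = equivD[OF eqR]
  have upR: "S = up R" unfolding R_def by (rule up_down[OF S, symmetric])
  have zero: "(0, y) \<in> R \<Longrightarrow> y \<noteq> 0 \<Longrightarrow> \<exists>v<y. (v, y) \<in> R" for y by auto
  let ?H = "{y\<in>heads (M - 1) {0} R. Q (card (R `` {y}))}"
  let ?B = "\<lambda>y. S `` {Suc y}"
  have H: "y < M" "(0, y) \<notin> R" "v < y \<Longrightarrow> (v, y) \<notin> R" if "y \<in> heads (M - 1) {0} R" for y v
    using that M_pos zero unfolding heads_def by auto
  have B: "?B y = Suc ` (R `` {y})" if y: "y < M" "(0, y) \<notin> R" for y
  proof (intro equalityI subsetI)
    fix v assume "v \<in> ?B y"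
    then have "v \<in> pts" "(y, res v) \<in> R" "v \<le> M"
      using y res_Suc[OF y(1)] unfolding upR up_def by auto
    moreover from this have "v = Suc (res v)" using Suc_res by simp
    ultimately show "v \<in> Suc ` (R `` {y})" by blast
  next
    fix v assume "v \<in> Suc ` (R `` {y})"
    then obtain a where a: "v = Suc a" "(y, a) \<in> R" by blast
    then have "a < M" using E(5) by blast
    then show "v \<in> ?B y" using a y res_Suc unfolding upR up_def by auto
  qed
  have low: "?B y \<subseteq> {1..M}" "Suc y \<in> ?B y" if y: "y < M" "(0, y) \<notin> R" for y
  proof -
    show "?B y \<subseteq> {1..M}" unfolding B[OF y] using E(5) by (auto simp: Suc_le_eq)
    show "Suc y \<in> ?B y" unfolding B[OF y] using E(1) y(1) by auto
  qed
  have high: "\<rho> ` X \<subseteq> {M<..}" if "X \<subseteq> {1..M}" for X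
    using that unfolding rho_eq by auto
  have Bin: "?B y \<in> P" if "y < M" for y
    unfolding S_def by (rule class_in_partition[OF P'(1)]) (use that in auto)
  have cB: "card (?B y) = card (R `` {y})" if y: "y < M" "(0, y) \<notin> R" for y
    unfolding B[OF y] by (rule card_image) simp
  have "bij_betw (\<lambda>y. {?B y, \<rho> ` ?B y}) ?H (pairs Q P)"
  proof (rule bij_betw_imageI)
    show "inj_on (\<lambda>y. {?B y, \<rho> ` ?B y}) ?H"
    proof (rule inj_onI)
      fix y z assume y: "y \<in> ?H" and z: "z \<in> ?H" and eq: "{?B y, \<rho> ` ?B y} = {?B z, \<rho> ` ?B z}"
      have hy: "y \<in> heads (M - 1) {0} R" and hz: "z \<in> heads (M - 1) {0} R" using y z by auto
      note ly = low[OF H(1,2)[OF hy]] and lz = low[OF H(1,2)[OF hz]]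
      have "?B y \<noteq> \<rho> ` ?B z" using ly high[OF lz(1)] by fastforce
      then have "?B y = ?B z" using eq by (metis doubleton_eq_iff)
      then have "Suc y \<in> Suc ` (R `` {z})" using ly(2) B[OF H(1,2)[OF hz]] by simp
      then have "(z, y) \<in> R" by auto
      then show "y = z" using H(3)[OF hy, of z] H(3)[OF hz, of y] E(2)[of z y] by (metis linorder_neqE_nat)
    qed
    show "(\<lambda>y. {?B y, \<rho> ` ?B y}) ` ?H = pairs Q P"
    proof (intro equalityI subsetI)
      fix q assume "q \<in> (\<lambda>y. {?B y, \<rho> ` ?B y}) ` ?H"
      then obtain y where y: "y \<in> ?H" "q = {?B y, \<rho> ` ?B y}" by blast
      have hy: "y \<in> heads (M - 1) {0} R" "Q (card (R `` {y}))" using y by auto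
      note ly = low[OF H(1,2)[OF hy(1)]]
      have "\<rho> ` ?B y \<noteq> ?B y" using ly high[OF ly(1)] by fastforce
      moreover have "Q (card (?B y))" using hy(2) cB[OF H(1,2)[OF hy(1)]] by simp
      ultimately show "q \<in> pairs Q P"
        using Bin[OF H(1)[OF hy(1)]] y(2) unfolding pairs_def rho_block_def by blast
    next
      fix q assume "q \<in> pairs Q P"
      then obtain C where C: "q = {C, \<rho> ` C}" "C \<in> P" "\<rho> ` C \<noteq> C" "Q (card C)"
        unfolding pairs_def rho_block_def by blast
      \<comment> \<open>Pass to the member of the pair that has a point in the lower half.\<close>
      have "\<exists>D u. q = {D, \<rho> ` D} \<and> D \<in> P \<and> \<rho> ` D \<noteq> D \<and> Q (card D) \<and> u \<in> D \<and> u \<le> M"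
      proof -
        obtain w where w: "w \<in> C" using partition_onD3[OF P'(1)] C(2) by fastforce
        show ?thesis
        proof (cases "w \<le> M")
          case True
          then show ?thesis using C w by blast
        next
          case False
          have "\<rho> w \<le> M" using False rho_half[of w] P'(3)[OF C(2)] w by blast
          moreover have "q = {\<rho> ` C, \<rho> ` \<rho> ` C}" "\<rho> ` \<rho> ` C \<noteq> \<rho> ` C"
            unfolding P'(6)[OF C(2)] using C(1,3) by auto
          moreover have "Q (card (\<rho> ` C))" using P'(7)[OF C(2)] C(4) by simp
          ultimately show ?thesis using P'(5)[OF C(2)] w by blast
        qed
      qed
      then obtain D u where D: "q = {D, \<rho> ` D}" "D \<in> P" "\<rho> ` D \<noteq> D" "Q (card D)" "u \<in> D" "u \<le> M"
        by blast
      have u: "u \<in> pts" using P'(3)[OF D(2)] D(5) by blast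
      have DS: "D = S `` {u}" unfolding S_def using rel_of_class[OF P'(1) D(2,5)] by simp
      define a where "a = u - 1"
      have a: "u = Suc a" "a < M" using u D(6) unfolding a_def by auto
      have na: "(0, a) \<notin> R"
      proof
        assume "(0, a) \<in> R"
        moreover have "res u = a" using res_Suc a by simp
        moreover have "(a, a) \<in> R" using E(1) a by simp
        ultimately have "(u, \<rho> u) \<in> S"
          unfolding upR up_def using u rho_in[OF u] res_rho[OF u] by simp
        then have "S `` {u} = S `` {\<rho> u}" by (rule equiv_class_eq[OF sym_relD(1)[OF S(1)]])
        then show False using D(3) rho_block_class[OF S(1) u] unfolding DS by simp
      qed
      have fin: "finite (R `` {a})" by (rule finite_subset[of _ "{..<M}"]) (use E(5) in blast, simp)
      define y where "y = Min (R `` {a})"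
      have "a \<in> R `` {a}" using E(1) a by simp
      then have ya: "(a, y) \<in> R" using Min_in[OF fin] unfolding y_def by blast
      have ymin: "y \<le> v" if "(a, v) \<in> R" for v unfolding y_def using fin that by simp
      have yM: "y < M" using E(5)[OF ya] by simp
      have ny: "(0, y) \<notin> R" using na E(3)[OF _ E(2)[OF ya]] by blast
      have "y \<noteq> 0" using ny E(1) M_pos by (metis lessThan_iff)
      moreover have "(v, y) \<notin> R" if "v < y" for v
        using ymin[of v] that E(3)[OF ya E(2)[of v y]] by fastforce
      ultimately have hy: "y \<in> heads (M - 1) {0} R" using yM unfolding heads_def by auto
      have "Suc y \<in> D" unfolding DS a(1) B[OF a(2) na] using ya by blast
      then have "?B y = D" unfolding S_def by (rule rel_of_class[OF P'(1) D(2)])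
      moreover from this have "Q (card (R `` {y}))" using D(4) cB[OF yM ny] by simp
      ultimately show "q \<in> (\<lambda>y. {?B y, \<rho> ` ?B y}) ` ?H" using hy D(1) by blast
    qed
  qed
  then show ?thesis unfolding R_def S_def by (rule bij_betw_same_card[symmetric])
qed

definition typed :: "(nat \<Rightarrow> nat) \<Rightarrow> nat set set \<Rightarrow> bool" where
  "typed bs P \<longleftrightarrow> pair_count k n P = (\<Sum>i=1..n. bs i) \<and> (\<forall>i\<in>{1..n}. pair_count_size k n P i = bs i)"

lemma finite_pairs: "sym_nc P \<Longrightarrow> finite (pairs Q P)"
  unfolding pairs_def using sym_ncD(8)[of P] by simp

lemma pair_card:
  assumes "sym_nc P" "q \<in> pairs (\<lambda>j. j = c) P"
  shows "B \<in> q \<Longrightarrow> card B = c" "card q = 2"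
proof -
  from assms(2) obtain B where B: "q = {B, \<rho> ` B}" "B \<in> P" "\<rho> ` B \<noteq> B" "card B = c"
    unfolding pairs_def rho_block_def by blast
  show "card B = c" if "B \<in> q" for B using that B sym_ncD(7)[OF assms(1) B(2)] by auto
  show "card q = 2" using B by simp
qed

lemma pairs_disjoint:
  assumes "sym_nc P"
  shows "\<forall>i\<in>{1..n}. \<forall>j\<in>{1..n}. i \<noteq> j \<longrightarrow>
    pairs (\<lambda>c. c = 2 * k * i) P \<inter> pairs (\<lambda>c. c = 2 * k * j) P = {}"
proof (intro ballI impI, rule ccontr)
  fix i j assume ij: "i \<noteq> j" and "pairs (\<lambda>c. c = 2 * k * i) P \<inter> pairs (\<lambda>c. c = 2 * k * j) P \<noteq> {}"
  then obtain q where q: "q \<in> pairs (\<lambda>c. c = 2 * k * i) P" "q \<in> pairs (\<lambda>c. c = 2 * k * j) P" by blast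
  from q(1) obtain B where "B \<in> q" unfolding pairs_def by blast
  then have "2 * k * i = 2 * k * j" using pair_card(1)[OF assms q(1)] pair_card(1)[OF assms q(2)] by metis
  then show False using ij k by simp
qed

text \<open>The pairs with block size \<open>2 * k * i\<close> already add up to the total number of
  pairs, so no paired block has another size.\<close>

lemma pairs_by_size:
  assumes P: "sym_nc P" and t: "typed bs P"
  shows "pairs (\<lambda>_. True) P = (\<Union>i\<in>{1..n}. pairs (\<lambda>j. j = 2 * k * i) P)"
proof (rule card_subset_eq[OF finite_pairs[OF P], symmetric])
  show "(\<Union>i\<in>{1..n}. pairs (\<lambda>j. j = 2 * k * i) P) \<subseteq> pairs (\<lambda>_. True) P"
    unfolding pairs_def by blast
  have "card (\<Union>i\<in>{1..n}. pairs (\<lambda>j. j = 2 * k * i) P) = (\<Sum>i\<in>{1..n}. card (pairs (\<lambda>j. j = 2 * k * i) P))"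
    by (rule card_UN_disjoint) (simp_all add: finite_pairs[OF P] pairs_disjoint[OF P])
  also have "\<dots> = (\<Sum>i=1..n. bs i)"
    by (intro sum.cong refl) (use t in \<open>simp add: typed_def pair_count_size_pairs\<close>)
  finally show "card (\<Union>i\<in>{1..n}. pairs (\<lambda>j. j = 2 * k * i) P) = card (pairs (\<lambda>_. True) P)"
    using t by (simp add: typed_def pair_count_pairs)
qed

lemma typed_block_card:
  assumes P: "sym_nc P" and t: "typed bs P" and B: "B \<in> P" "\<rho> ` B \<noteq> B"
  obtains i where "i \<in> {1..n}" "card B = 2 * k * i"
proof -
  have "{B, \<rho> ` B} \<in> pairs (\<lambda>_. True) P" using B unfolding pairs_def rho_block_def by blast
  then obtain i where i: "i \<in> {1..n}" "{B, \<rho> ` B} \<in> pairs (\<lambda>j. j = 2 * k * i) P"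
    unfolding pairs_by_size[OF P t] by blast
  then show thesis using that pair_card(1)[OF P i(2), of B] by simp
qed

lemma sum_pairs:
  assumes P: "sym_nc P"
  shows "(\<Sum>B\<in>{B\<in>P. \<rho> ` B \<noteq> B}. card B) = (\<Sum>q\<in>pairs (\<lambda>_. True) P. \<Sum>B\<in>q. card B)"
proof -
  note P' = sym_ncD[OF P]
  have "{B\<in>P. \<rho> ` B \<noteq> B} = \<Union>(pairs (\<lambda>_. True) P)"
  proof (intro equalityI subsetI)
    fix B assume "B \<in> \<Union>(pairs (\<lambda>_. True) P)"
    then obtain C where C: "C \<in> P" "\<rho> ` C \<noteq> C" "B = C \<or> B = \<rho> ` C"
      unfolding pairs_def rho_block_def by blast
    then show "B \<in> {B\<in>P. \<rho> ` B \<noteq> B}" using P'(5,6)[OF C(1)] by auto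
  qed (auto simp: pairs_def rho_block_def)
  moreover have "sum card (\<Union>(pairs (\<lambda>_. True) P)) = (sum \<circ> sum) card (pairs (\<lambda>_. True) P)"
  proof (rule sum.Union_disjoint)
    show "\<forall>q\<in>pairs (\<lambda>_. True) P. finite q" unfolding pairs_def by auto
    show "\<forall>q\<in>pairs (\<lambda>_. True) P. \<forall>q'\<in>pairs (\<lambda>_. True) P. q \<noteq> q' \<longrightarrow> q \<inter> q' = {}"
    proof (intro ballI impI, rule ccontr)
      fix q q' assume q: "q \<in> pairs (\<lambda>_. True) P" and q': "q' \<in> pairs (\<lambda>_. True) P"
        and ne: "q \<noteq> q'" "q \<inter> q' \<noteq> {}"
      have form: "r = {B, \<rho> ` B}" if "r \<in> pairs (\<lambda>_. True) P" "B \<in> r" for r B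
      proof -
        obtain C where C: "r = {C, \<rho> ` C}" "C \<in> P" using \<open>r \<in> _\<close> unfolding pairs_def rho_block_def by blast
        then show ?thesis using \<open>B \<in> r\<close> P'(6)[OF C(2)] by auto
      qed
      obtain B where "B \<in> q" "B \<in> q'" using ne(2) by blast
      then show False using form[OF q] form[OF q'] ne(1) by metis
    qed
  qed
  ultimately show ?thesis by simp
qed

text \<open>A pair with block size \<open>2 * k * i\<close> covers \<open>4 * k * i\<close> points,
  and a point lies outside all pairs exactly if it is related to its antipode.\<close>

lemma card_centre:
  assumes P: "sym_nc P" and t: "typed bs P"
  shows "card {u\<in>pts. (u, \<rho> u) \<in> rel_of P} + 4 * k * (\<Sum>i=1..n. i * bs i) = 2 * M"
proof -
  note P' = sym_ncD[OF P]
  let ?N = "{B\<in>P. \<rho> ` B \<noteq> B}" and ?Z = "{u\<in>pts. (u, \<rho> u) \<in> rel_of P}"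
  have "(\<Sum>B\<in>?N. card B) = (\<Sum>q\<in>(\<Union>i\<in>{1..n}. pairs (\<lambda>j. j = 2 * k * i) P). \<Sum>B\<in>q. card B)"
    unfolding sum_pairs[OF P] pairs_by_size[OF P t] ..
  also have "\<dots> = (\<Sum>i\<in>{1..n}. \<Sum>q\<in>pairs (\<lambda>j. j = 2 * k * i) P. \<Sum>B\<in>q. card B)"
    by (rule sum.UNION_disjoint) (simp_all add: finite_pairs[OF P] pairs_disjoint[OF P])
  also have "\<dots> = (\<Sum>i\<in>{1..n}. 4 * k * (i * bs i))"
  proof (rule sum.cong[OF refl])
    fix i assume i: "i \<in> {1..n}"
    have "(\<Sum>q\<in>pairs (\<lambda>j. j = 2 * k * i) P. \<Sum>B\<in>q. card B) = (\<Sum>q\<in>pairs (\<lambda>j. j = 2 * k * i) P. 4 * k * i)"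
    proof (rule sum.cong[OF refl])
      fix q assume q: "q \<in> pairs (\<lambda>j. j = 2 * k * i) P"
      have "(\<Sum>B\<in>q. card B) = (\<Sum>B\<in>q. 2 * k * i)" by (rule sum.cong[OF refl pair_card(1)[OF P q]])
      then show "(\<Sum>B\<in>q. card B) = 4 * k * i" using pair_card(2)[OF P q] by simp
    qed
    also have "\<dots> = bs i * (4 * k * i)" using t i by (simp add: typed_def pair_count_size_pairs)
    finally show "(\<Sum>q\<in>pairs (\<lambda>j. j = 2 * k * i) P. \<Sum>B\<in>q. card B) = 4 * k * (i * bs i)"
      by (simp add: ac_simps)
  qed
  finally have N: "(\<Sum>B\<in>?N. card B) = 4 * k * (\<Sum>i=1..n. i * bs i)" by (simp add: sum_distrib_left)
  have cN: "card (\<Union>?N) = (\<Sum>B\<in>?N. card B)"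
    by (rule card_Union_disjoint) (use P'(4) partition_onD2[OF P'(1)] in \<open>auto simp: pairwise_def\<close>)
  have zN: "(u, \<rho> u) \<in> rel_of P \<longleftrightarrow> \<rho> ` B = B" if "B \<in> P" "u \<in> B" for u B
  proof -
    have u: "u \<in> pts" using P'(3) that by blast
    have B: "rel_of P `` {u} = B" by (rule rel_of_class[OF P'(1) that])
    have b: "\<rho> ` B = rel_of P `` {\<rho> u}" using rho_block_class[OF P'(2) u] B by simp
    have "(u, \<rho> u) \<in> rel_of P \<longleftrightarrow> rel_of P `` {u} = rel_of P `` {\<rho> u}"
      by (rule eq_equiv_class_iff[OF equiv_rel_of[OF P'(1)] u rho_in[OF u], symmetric])
    then show ?thesis unfolding B b by blast
  qed
  have U: "pts = ?Z \<union> \<Union>?N"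
  proof (intro equalityI subsetI)
    fix u assume u: "u \<in> pts"
    then obtain B where B: "B \<in> P" "u \<in> B" unfolding partition_onD1[OF P'(1)] by blast
    show "u \<in> ?Z \<union> \<Union>?N"
    proof (cases "\<rho> ` B = B")
      case True
      then show ?thesis using zN[OF B] u by simp
    next
      case False
      then show ?thesis using B by blast
    qed
  next
    fix u assume "u \<in> ?Z \<union> \<Union>?N"
    then show "u \<in> pts" using P'(3) by blast
  qed
  have D: "?Z \<inter> \<Union>?N = {}"
  proof (rule equals0I)
    fix u assume "u \<in> ?Z \<inter> \<Union>?N"
    then obtain B where "B \<in> P" "u \<in> B" "\<rho> ` B \<noteq> B" "(u, \<rho> u) \<in> rel_of P" by blast
    then show False using zN by simp
  qed
  have "card pts = card (?Z \<union> \<Union>?N)" by (rule arg_cong[OF U])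
  also have "\<dots> = card ?Z + card (\<Union>?N)"
    by (rule card_Un_disjoint[OF _ _ D]) (use P'(4,8) in auto)
  finally show ?thesis using N cN by simp
qed

lemma card_centre_half:
  assumes P: "sym_nc P" and t: "typed bs P"
  shows "card {z\<in>{1..M}. (z, z + M) \<in> rel_of P} + 2 * k * (\<Sum>i=1..n. i * bs i) = M"
proof -
  let ?h = "{z\<in>{1..M}. (z, z + M) \<in> rel_of P}"
  have sym: "(u, v) \<in> rel_of P \<Longrightarrow> (v, u) \<in> rel_of P" for u v unfolding rel_of_def by blast
  have "{u\<in>pts. (u, \<rho> u) \<in> rel_of P} = ?h \<union> (\<lambda>z. z + M) ` ?h"
  proof (intro equalityI subsetI)
    fix u assume u: "u \<in> {u\<in>pts. (u, \<rho> u) \<in> rel_of P}"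
    show "u \<in> ?h \<union> (\<lambda>z. z + M) ` ?h"
    proof (cases "u \<le> M")
      case True
      then show ?thesis using u unfolding rho_eq by simp
    next
      case False
      then have "u - M \<in> ?h" "u = u - M + M" using u sym unfolding rho_eq by auto
      then show ?thesis by blast
    qed
  qed (auto simp: rho_eq intro: sym)
  moreover have "card (?h \<union> (\<lambda>z. z + M) ` ?h) = card ?h + card ((\<lambda>z. z + M) ` ?h)"
    by (rule card_Un_disjoint) auto
  moreover have "card ((\<lambda>z. z + M) ` ?h) = card ?h" by (rule card_image) simp
  ultimately show ?thesis using card_centre[OF P t] by simp
qed

text \<open>For the paired blocks the type gives the divisibility. Since \<open>1\<close> and
  \<open>M + 1\<close> are related, there is only one fixed block; it consists of all points related
  to their antipode, so by \<open>card_centre\<close> its size is \<open>2 * k * (2 * n + 1)\<close>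
  minus a multiple of \<open>2 * k\<close>.\<close>

lemma typed_dvd:
  assumes P: "sym_nc P" and t: "typed bs P" and c: "(1, M + 1) \<in> rel_of P" and B: "B \<in> P"
  shows "2 * k dvd card B"
proof (cases "\<rho> ` B = B")
  case False
  then show ?thesis using typed_block_card[OF P t B] by (metis dvd_triv_left)
next
  case True
  note P' = sym_ncD[OF P]
  note up = up_down[OF P'(2) c]
  let ?R = "down (rel_of P)" and ?Z = "{u\<in>pts. (u, \<rho> u) \<in> rel_of P}"
  have eq: "equiv {..<M} ?R" by (rule equiv_down[OF sym_relD(1)[OF P'(2)]])
  have Z: "(0, res u) \<in> ?R \<longleftrightarrow> (u, \<rho> u) \<in> rel_of P" if u: "u \<in> pts" for u
    using u rho_in[OF u] rho_half[OF u] res_rho[OF u] equivD(1)[OF eq, of "res u"] res_lt[OF u]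
    by (subst (2) up[symmetric]) (auto simp: up_def)
  obtain u where u: "u \<in> B" using partition_onD3[OF P'(1)] B by fastforce
  have uM: "u \<in> pts" using u P'(3)[OF B] by blast
  have "\<rho> u \<in> B" using True u by blast
  then have "(u, \<rho> u) \<in> rel_of P" using u B unfolding rel_of_def by blast
  then have u0: "(0, res u) \<in> ?R" using Z[OF uM] by simp
  have "B = ?Z"
  proof (intro equalityI subsetI)
    fix v assume v: "v \<in> B"
    then have "\<rho> v \<in> B" using True by blast
    then show "v \<in> ?Z" using v B P'(3)[OF B] unfolding rel_of_def by blast
  next
    fix v assume v: "v \<in> ?Z"
    then have v0: "(0, res v) \<in> ?R" using Z by blast
    have "(res u, res v) \<in> ?R" using equivD(3)[OF eq equivD(2)[OF eq u0] v0] .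
    then have "(u, v) \<in> rel_of P" by (subst up[symmetric]) (use uM v u0 in \<open>auto simp: up_def\<close>)
    then show "v \<in> B" using rel_of_class[OF P'(1) B u] by blast
  qed
  then have "card B + 2 * k * (2 * (\<Sum>i=1..n. i * bs i)) = 2 * k * (2 * n + 1)"
    using card_centre[OF P t] unfolding M by (simp add: algebra_simps)
  then show ?thesis by (metis dvd_add_left_iff dvd_triv_left)
qed

text \<open>Each block of \<open>Q\<close> is a disjoint union of blocks of \<open>P\<close>; so
  along a multichain, divisibility has to be established for the first partition only.\<close>

lemma dvd_coarser:
  assumes P: "sym_nc P" and Q: "sym_nc Q" and ref: "rel_of P \<subseteq> rel_of Q"
    and d: "\<And>B. B \<in> P \<Longrightarrow> d dvd card B" and C: "C \<in> Q"
  shows "d dvd card C"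
proof -
  note P' = sym_ncD[OF P] and Q' = sym_ncD[OF Q]
  have "C = \<Union>{B\<in>P. B \<subseteq> C}"
  proof (intro equalityI subsetI)
    fix u assume u: "u \<in> C"
    then obtain B where B: "B \<in> P" "u \<in> B" using partition_onD1[OF P'(1)] Q'(3)[OF C] by blast
    have "B \<subseteq> C" using rel_of_class[OF P'(1) B] rel_of_class[OF Q'(1) C u] ref by blast
    then show "u \<in> \<Union>{B\<in>P. B \<subseteq> C}" using B by blast
  qed blast
  moreover have "d dvd card (\<Union>{B\<in>P. B \<subseteq> C})"
  proof (rule dvd_partition)
    show "finite (\<Union>{B\<in>P. B \<subseteq> C})" using P'(4,8) by auto
    show "\<forall>c\<in>{B\<in>P. B \<subseteq> C}. d dvd card c" using d by blast
    show "\<forall>c1\<in>{B\<in>P. B \<subseteq> C}. \<forall>c2\<in>{B\<in>P. B \<subseteq> C}. c1 \<noteq> c2 \<longrightarrow> c1 \<inter> c2 = {}"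
      using partition_onD2[OF P'(1)] unfolding disjoint_def by blast
  qed
  ultimately show ?thesis by simp
qed

end

section \<open>Multichains\<close>

locale chain_data = antipodal +
  fixes l :: nat and bs s :: "nat \<Rightarrow> nat"
  assumes l: "0 < l" and weight: "(\<Sum>i=1..n. i * bs i) \<le> n"
    and sum_s: "(\<Sum>i=1..l+1. s i) = n" and s1: "s 1 = n - (\<Sum>i=1..n. bs i)"
begin

text \<open>The pair count that the rank jumps prescribe for the \<open>i\<close>-th partition. In
  this cumulative form the jumps match the heads at level \<open>i\<close> and the letters of colour
  above \<open>i\<close>.\<close>

definition tail :: "nat \<Rightarrow> nat" where "tail i = (\<Sum>d\<in>{i+1..l+1}. s d)"

lemma tail_step: "i \<le> l \<Longrightarrow> tail i = s (i + 1) + tail (i + 1)"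
  unfolding tail_def by (subst sum.atLeast_Suc_atMost) auto

lemma tail_0: "tail 0 = n" using sum_s unfolding tail_def by simp

lemma tail_top: "tail (l + 1) = 0" unfolding tail_def by simp

lemma sum_bs_le: "(\<Sum>i=1..n. bs i) \<le> n"
proof -
  have "(\<Sum>i=1..n. bs i) \<le> (\<Sum>i=1..n. i * bs i)" by (rule sum_mono) simp
  then show ?thesis using weight by simp
qed

lemma tail_1: "tail 1 = (\<Sum>i=1..n. bs i)"
  using tail_step[of 0] tail_0 s1 sum_bs_le by simp

lemma has_rank_jumps_iff:
  "has_rank_jumps k n l cs s \<longleftrightarrow> (\<forall>i\<in>{1..l}. pair_count k n (cs ! (i - 1)) = tail i)"
proof
  assume h: "has_rank_jumps k n l cs s"
  have "pair_count k n (cs ! i) = tail (i + 1)" if "i < l" for i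
    using that
  proof (induction i)
    case 0
    have "int (s 1) = int n - int (pair_count k n (cs ! 0))"
      using h unfolding has_rank_jumps_def rank_NCt_def by simp
    then show ?case using tail_step[of 0] tail_0 by simp
  next
    case (Suc i)
    have "i + 2 \<in> {2..l}" using Suc.prems by simp
    then have "int (s (i + 2)) = rank_NCt k n (cs ! (i + 1)) - rank_NCt k n (cs ! i)"
      using h unfolding has_rank_jumps_def by fastforce
    then have "s (i + 2) + pair_count k n (cs ! (i + 1)) = pair_count k n (cs ! i)"
      unfolding rank_NCt_def by simp
    then show ?case using Suc tail_step[of "i + 1"] by simp
  qed
  then show "\<forall>i\<in>{1..l}. pair_count k n (cs ! (i - 1)) = tail i" by auto
next
  assume h: "\<forall>i\<in>{1..l}. pair_count k n (cs ! (i - 1)) = tail i"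
  have pc: "pair_count k n (cs ! i) = tail (i + 1)" if "i < l" for i
    using h[rule_format, of "i + 1"] that by simp
  show "has_rank_jumps k n l cs s"
    unfolding has_rank_jumps_def rank_NCt_def
  proof (intro conjI ballI)
    show "int (s 1) = int n - int (pair_count k n (cs ! 0))"
      using pc[of 0] l tail_step[of 0] tail_0 by simp
    show "int (s (l + 1)) = int n - (int n - int (pair_count k n (cs ! (l - 1))))"
      using pc[of "l - 1"] l tail_step[of l] tail_top by simp
    fix i assume i: "i \<in> {2..l}"
    obtain j where j: "i = j + 2" using i by (metis add.commute atLeastAtMost_iff le_Suc_ex)
    show "int (s i) = int n - int (pair_count k n (cs ! (i - 1))) - (int n - int (pair_count k n (cs ! (i - 2))))"
      using pc[of j] pc[of "j + 1"] i tail_step[of "j + 1"] unfolding j by simp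
  qed
qed

definition admissible :: "nat set set list set" where
  "admissible = {cs \<in> multichains k n l. has_rank_jumps k n l cs s \<and> has_type k n (cs ! 0) (\<Sum>i=1..n. bs i) bs}"

text \<open>Says that \<open>z\<close> lies in the block of the first partition which is fixed by \<open>\<rho>\<close>.\<close>
definition central :: "nat \<Rightarrow> nat set set list \<Rightarrow> bool" where
  "central z cs \<longleftrightarrow> (z, z + M) \<in> rel_of (cs ! 0)"

lemma admissible_iff:
  "cs \<in> admissible \<longleftrightarrow> length cs = l \<and> (\<forall>i<l. cs ! i \<in> NCt k n) \<and>
     (\<forall>i. i + 1 < l \<longrightarrow> Defs.refines (cs ! i) (cs ! (i + 1))) \<and>
     (\<forall>i<l. pair_count k n (cs ! i) = tail (i + 1)) \<and>
     (\<forall>i\<in>{1..n}. pair_count_size k n (cs ! 0) i = bs i)"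
proof -
  have "(\<forall>i\<in>{1..l}. pair_count k n (cs ! (i - 1)) = tail i) \<longleftrightarrow> (\<forall>i<l. pair_count k n (cs ! i) = tail (i + 1))"
  proof
    assume h: "\<forall>i\<in>{1..l}. pair_count k n (cs ! (i - 1)) = tail i"
    show "\<forall>i<l. pair_count k n (cs ! i) = tail (i + 1)"
    proof (intro allI impI)
      fix i assume "i < l"
      then show "pair_count k n (cs ! i) = tail (i + 1)" using h[rule_format, of "i + 1"] by simp
    qed
  next
    assume h: "\<forall>i<l. pair_count k n (cs ! i) = tail (i + 1)"
    show "\<forall>i\<in>{1..l}. pair_count k n (cs ! (i - 1)) = tail i"
    proof
      fix i assume "i \<in> {1..l}"
      then have "i - 1 < l" "i - 1 + 1 = i" by auto
      then show "pair_count k n (cs ! (i - 1)) = tail i" using h by metis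
    qed
  qed
  moreover have "pair_count k n (cs ! 0) = (\<Sum>i=1..n. bs i)" if "\<forall>i<l. pair_count k n (cs ! i) = tail (i + 1)"
    using that[rule_format, of 0] l tail_1 by simp
  moreover have "length cs = l \<Longrightarrow> set cs \<subseteq> NCt k n \<longleftrightarrow> (\<forall>i<l. cs ! i \<in> NCt k n)"
    by (auto simp: set_conv_nth)
  ultimately show ?thesis
    unfolding admissible_def multichains_def has_type_def has_rank_jumps_iff by auto
qed

lemma admissibleD:
  assumes "cs \<in> admissible"
  shows "length cs = l" "i < l \<Longrightarrow> sym_nc (cs ! i)" "typed bs (cs ! 0)"
    "i \<le> j \<Longrightarrow> j < l \<Longrightarrow> rel_of (cs ! i) \<subseteq> rel_of (cs ! j)"
proof -
  note * = assms[unfolded admissible_iff]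
  show "length cs = l" using * by blast
  show sym: "sym_nc (cs ! i)" if "i < l" for i using * NCt_iff that by blast
  have "pair_count k n (cs ! 0) = tail (0 + 1)" using * l by blast
  then show "typed bs (cs ! 0)" unfolding typed_def using * tail_1 by simp
  have link: "rel_of (cs ! i) \<subseteq> rel_of (cs ! (i + 1))" if "i + 1 < l" for i
    using * that refines_iff[OF sym_ncD(1)[OF sym[of i]] sym_ncD(1)[OF sym[of "i + 1"]]] by simp
  show "rel_of (cs ! i) \<subseteq> rel_of (cs ! j)" if "i \<le> j" "j < l"
    using that
  proof (induction j rule: dec_induct)
    case (step j)
    then show ?case using link[of j] by auto
  qed simp
qed

definition chains :: "(nat \<Rightarrow> nat rel) set" where
  "chains = {E. nc_chain l (M - 1) E \<and> (\<forall>i\<in>{1..l}. card (heads (M - 1) {0} (E i)) = tail i) \<and>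
     (\<forall>i\<in>{1..n}. card {y\<in>heads (M - 1) {0} (E 1). card (E 1 `` {y}) = 2 * k * i} = bs i)}"

text \<open>If \<open>1\<close> and \<open>M + 1\<close> are related in the first partition, they
  are so in every coarser one, hence \<open>down\<close> and \<open>up\<close> are inverse at all
  levels. For the way back, the divisibility demanded by \<open>NCt\<close> comes from
  \<open>typed_dvd\<close> and \<open>dvd_coarser\<close>.\<close>

lemma bij_betw_chains:
  "bij_betw (\<lambda>cs i. if i \<in> {1..l} then down (rel_of (cs ! (i - 1))) else {}) {cs \<in> admissible. central 1 cs} chains"
proof -
  let ?enc = "\<lambda>(cs :: nat set set list) i. if i \<in> {1..l} then down (rel_of (cs ! (i - 1))) else {}"
  let ?part = "\<lambda>R. pts // up R"
  let ?dec = "\<lambda>E. map (\<lambda>i. ?part (E (i + 1))) [0..<l]"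
  have enc: "?enc cs \<in> chains \<and> ?dec (?enc cs) = cs" if cs: "cs \<in> admissible" "central 1 cs" for cs
  proof -
    note a = admissibleD[OF cs(1)]
    have P: "sym_nc (cs ! (i - 1))" "(1, M + 1) \<in> rel_of (cs ! (i - 1))" if "i \<in> {1..l}" for i
    proof -
      have i: "i - 1 < l" using that by auto
      show "sym_nc (cs ! (i - 1))" by (rule a(2)[OF i])
      show "(1, M + 1) \<in> rel_of (cs ! (i - 1))" using a(4)[of 0 "i - 1"] i cs(2) unfolding central_def by (auto simp: add.commute)
    qed
    have "nc_chain l (M - 1) (?enc cs)"
      unfolding nc_chain_def ground
    proof (intro conjI ballI allI impI)
      fix i assume i: "i \<in> {1..l}"
      note S = sym_ncD(2)[OF P(1)[OF i]]
      show "equiv {..<M} (?enc cs i)" using equiv_down[OF sym_relD(1)[OF S]] i by simp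
      show "nc_rel (?enc cs i)" using nc_rel_down[OF sym_relD(2)[OF S]] i by simp
    next
      fix i j :: nat assume "1 \<le> i" "i \<le> j" "j \<le> l"
      moreover from this have "rel_of (cs ! (i - 1)) \<subseteq> rel_of (cs ! (j - 1))" by (intro a(4)) auto
      ultimately show "?enc cs i \<subseteq> ?enc cs j" using down_mono by simp
    qed auto
    moreover have "card (heads (M - 1) {0} (?enc cs i)) = tail i" if i: "i \<in> {1..l}" for i
    proof -
      have "card (heads (M - 1) {0} (?enc cs i)) = pair_count k n (cs ! (i - 1))"
        using card_pairs[OF P[OF i], of "\<lambda>_. True"] i unfolding pair_count_pairs by simp
      also have "\<dots> = tail i"
      proof -
        have "i - 1 < l" "i - 1 + 1 = i" using i by auto
        then show ?thesis using cs(1) unfolding admissible_iff by metis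
      qed
      finally show ?thesis .
    qed
    moreover have "card {y\<in>heads (M - 1) {0} (?enc cs 1). card (?enc cs 1 `` {y}) = 2 * k * i} = bs i"
      if i: "i \<in> {1..n}" for i
    proof -
      have one: "1 \<in> {1..l}" using l by simp
      have "pair_count_size k n (cs ! 0) i = bs i" using cs(1) i unfolding admissible_iff by blast
      then show ?thesis
        using card_pairs[OF P[OF one], of "\<lambda>j. j = 2 * k * i"] one unfolding pair_count_size_pairs by simp
    qed
    ultimately have "?enc cs \<in> chains" unfolding chains_def by blast
    moreover have "?dec (?enc cs) = cs"
    proof (rule nth_equalityI)
      fix i assume "i < length (?dec (?enc cs))"
      then have i: "i < l" by simp
      have i': "i + 1 \<in> {1..l}" using i by simp
      have "up (down (rel_of (cs ! i))) = rel_of (cs ! i)"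
        using up_down[OF sym_ncD(2)] P[OF i'] by simp
      then show "?dec (?enc cs) ! i = cs ! i"
        using i quotient_rel_of[OF sym_ncD(1)[OF a(2)[OF i]]] by simp
    qed (simp add: a(1))
    ultimately show ?thesis by blast
  qed
  have dec: "?dec E \<in> admissible \<and> central 1 (?dec E) \<and> ?enc (?dec E) = E" if E: "E \<in> chains" for E
  proof -
    have ch: "nc_chain l (M - 1) E" and hd: "\<And>i. i \<in> {1..l} \<Longrightarrow> card (heads (M - 1) {0} (E i)) = tail i"
      and ty: "\<And>i. i \<in> {1..n} \<Longrightarrow> card {y\<in>heads (M - 1) {0} (E 1). card (E 1 `` {y}) = 2 * k * i} = bs i"
      using E unfolding chains_def by blast+
    note c = nc_chainD[OF ch, unfolded ground]
    have U: "sym_rel (up (E i))" "(1, M + 1) \<in> up (E i)" if "i \<in> {1..l}" for i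
      using sym_up[OF c(1)[OF that] c(2)[OF that]] by blast+
    have r: "rel_of (?part (E i)) = up (E i)" and p: "partition_on pts (?part (E i))"
      and s: "sym_nc (?part (E i))" if "i \<in> {1..l}" for i
    proof -
      have eq: "equiv pts (up (E i))" by (rule sym_relD(1)[OF U(1)[OF that]])
      show r: "rel_of (?part (E i)) = up (E i)" by (rule rel_of_quotient[OF eq])
      show p: "partition_on pts (?part (E i))" by (rule partition_on_quotient[OF eq])
      show "sym_nc (?part (E i))" using sym_nc_iff[OF p] U(1)[OF that] unfolding r by blast
    qed
    have du: "down (up (E i)) = E i" if "i \<in> {1..l}" for i by (rule down_up[OF c(1)[OF that]])
    have pc: "card (pairs Q (?part (E i))) = card {y\<in>heads (M - 1) {0} (E i). Q (card (E i `` {y}))}"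
      if i: "i \<in> {1..l}" for i Q
      using card_pairs[OF s[OF i], of Q] U(2)[OF i] unfolding r[OF i] du[OF i] by simp
    have one: "1 \<in> {1..l}" using l by simp
    have pcn: "pair_count k n (?part (E i)) = tail i" if "i \<in> {1..l}" for i
      using pc[OF that, of "\<lambda>_. True"] hd[OF that] unfolding pair_count_pairs by simp
    have pcs: "pair_count_size k n (?part (E 1)) i = bs i" if "i \<in> {1..n}" for i
      using pc[OF one, of "\<lambda>j. j = 2 * k * i"] ty[OF that] unfolding pair_count_size_pairs by simp
    have ty1: "typed bs (?part (E 1))" unfolding typed_def using pcn[OF one] pcs tail_1 by simp
    have mono: "up (E i) \<subseteq> up (E j)" if "1 \<le> i" "i \<le> j" "j \<le> l" for i j by (rule up_mono[OF c(3)[OF that]])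
    have nct: "?part (E i) \<in> NCt k n" if i: "i \<in> {1..l}" for i
      unfolding NCt_iff
    proof (intro conjI ballI)
      show "sym_nc (?part (E i))" by (rule s[OF i])
      have d1: "2 * k dvd card B" if "B \<in> ?part (E 1)" for B
        by (rule typed_dvd[OF s[OF one] ty1 _ that]) (use U(2)[OF one] r[OF one] in simp)
      fix C assume C: "C \<in> ?part (E i)"
      show "2 * k dvd card C"
        by (rule dvd_coarser[OF s[OF one] s[OF i] _ d1 C]) (use mono[of 1 i] i r[OF i] r[OF one] in simp)
    qed
    have nth: "?dec E ! i = ?part (E (i + 1))" if "i < l" for i using that by simp
    have "?dec E \<in> admissible"
      unfolding admissible_iff
    proof (intro conjI allI impI ballI)
      show "length (?dec E) = l" by simp
      fix i assume i: "i < l"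
      then have i': "i + 1 \<in> {1..l}" by simp
      show "?dec E ! i \<in> NCt k n" unfolding nth[OF i] by (rule nct[OF i'])
      show "pair_count k n (?dec E ! i) = tail (i + 1)" unfolding nth[OF i] by (rule pcn[OF i'])
    next
      fix i assume i: "i + 1 < l"
      then have i': "i + 1 \<in> {1..l}" "i + 1 + 1 \<in> {1..l}" "i < l" by simp_all
      show "Defs.refines (?dec E ! i) (?dec E ! (i + 1))"
        unfolding nth[OF i] nth[OF i'(3)] refines_iff[OF p[OF i'(1)] p[OF i'(2)]] r[OF i'(1)] r[OF i'(2)]
        by (rule mono) (use i in auto)
    next
      fix i assume "i \<in> {1..n}"
      then show "pair_count_size k n (?dec E ! 0) i = bs i" unfolding nth[OF l] using pcs by simp
    qed
    moreover have "central 1 (?dec E)"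
      unfolding central_def nth[OF l] using r[OF one] U(2)[OF one] by (simp add: add.commute)
    moreover have "?enc (?dec E) = E"
    proof
      fix i show "?enc (?dec E) i = E i"
      proof (cases "i \<in> {1..l}")
        case True
        then have "?dec E ! (i - 1) = ?part (E i)" using nth[of "i - 1"] by fastforce
        then show ?thesis using True r[OF True] du[OF True] by simp
      next
        case False
        then have "E i = {}" by (rule c(4))
        then show ?thesis using False by auto
      qed
    qed
    ultimately show ?thesis by blast
  qed
  show ?thesis
    by (rule bij_betw_byWitness[of _ ?dec]) (use enc dec in blast)+
qed

sublocale word_content M l "2 * k" n bs s
proof
  show "0 < 2 * k" using k by simp
  show "(\<Sum>d\<in>{2..l+1}. s d) = (\<Sum>i=1..n. bs i)" using tail_1 unfolding tail_def one_add_one .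
qed

definition ballot_words :: "(nat \<Rightarrow> nat \<Rightarrow> nat) set" where
  "ballot_words = {g \<in> W. \<forall>p<M. total l g p \<le> p}"

text \<open>The numbers of letters of colour above \<open>i\<close> satisfy the recursion of
  \<open>tail\<close>, so they determine the numbers of letters of each colour and conversely. The
  last position being \<open>M - 1\<close>, the bound on totals in \<open>words\<close> is the
  ballot condition for all \<open>p < M\<close>.\<close>

lemma ballot_words_iff:
  "g \<in> ballot_words \<longleftrightarrow> g \<in> words l (M - 1) (l + 2) \<and> (\<forall>i\<in>{1..l}. card (above i g) = tail i) \<and>
     (\<forall>i\<in>{1..n}. card (sized (2 * k * i) g) = bs i)"
proof -
  define supported where "supported \<longleftrightarrow> (\<forall>e d. g e d \<noteq> 0 \<longrightarrow> e < M \<and> d \<in> {2..l+1})"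
  have w: "g \<in> words l (M - 1) (l + 2) \<longleftrightarrow> supported \<and> (\<forall>p<M. total l g p \<le> p)"
  proof -
    have "e \<le> M - 1 \<longleftrightarrow> e < M" for e using M_pos by auto
    moreover have "2 \<le> d \<and> d \<le> l + 1 \<and> (e < M - 1 \<or> e = M - 1 \<and> d < l + 2) \<longleftrightarrow> e < M \<and> d \<in> {2..l+1}" for e d
      using M_pos by auto
    ultimately show ?thesis unfolding words_def supported_def by simp
  qed
  have cols: "(\<forall>i\<in>{1..l}. card (above i g) = tail i) \<longleftrightarrow>
      (\<forall>d\<in>{2..l+1}. card {e. g e d \<noteq> 0} = s d)" if sup: "supported"
  proof -
    let ?C = "\<lambda>i. \<Sum>d\<in>{i+1..l+1}. card {e. g e d \<noteq> 0}"
    have C: "card (above i g) = ?C i" if i: "1 \<le> i" for i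
    proof -
      let ?g = "\<lambda>e d. if i < d then g e d else 0"
      have "card {(e, d). ?g e d \<noteq> 0} = (\<Sum>d\<in>{2..l+1}. card {e. ?g e d \<noteq> 0})"
        by (rule card_support_columns) (use sup in \<open>auto simp: supported_def split: if_splits\<close>)
      also have "\<dots> = (\<Sum>d\<in>{i+1..l+1}. card {e. ?g e d \<noteq> 0})"
        by (rule sum.mono_neutral_right) (use i in auto)
      also have "\<dots> = ?C i" by (intro sum.cong refl) simp
      finally have "card {(e, d). ?g e d \<noteq> 0} = ?C i" .
      moreover have "{(e, d). ?g e d \<noteq> 0} = above i g" by auto
      ultimately show ?thesis by (simp only:)
    qed
    have Cstep: "?C i = card {e. g e (i + 1) \<noteq> 0} + ?C (i + 1)" if "i \<le> l" for i
      using that by (subst sum.atLeast_Suc_atMost) auto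
    show ?thesis
    proof
      assume h: "\<forall>i\<in>{1..l}. card (above i g) = tail i"
      have Ct: "?C i = tail i" if "1 \<le> i" "i \<le> l + 1" for i
        using h[rule_format, of i] C[OF that(1)] tail_top that by (cases "i = l + 1") auto
      show "\<forall>d\<in>{2..l+1}. card {e. g e d \<noteq> 0} = s d"
      proof
        fix d assume d: "d \<in> {2..l+1}"
        then have "1 \<le> d - 1" "d - 1 \<le> l" "d - 1 + 1 = d" by auto
        then show "card {e. g e d \<noteq> 0} = s d"
          using Ct[of "d - 1"] Ct[of d] Cstep[of "d - 1"] tail_step[of "d - 1"] d by simp
      qed
    next
      assume h: "\<forall>d\<in>{2..l+1}. card {e. g e d \<noteq> 0} = s d"
      show "\<forall>i\<in>{1..l}. card (above i g) = tail i"
      proof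
        fix i assume i: "i \<in> {1..l}"
        have "?C i = tail i" unfolding tail_def by (rule sum.cong) (use h i in auto)
        then show "card (above i g) = tail i" using C i by simp
      qed
    qed
  qed
  show ?thesis
    unfolding ballot_words_def content_def w using cols unfolding supported_def by blast
qed

text \<open>The statistics in \<open>chain_fits\<close> are those that define \<open>chains\<close>
  on one side and, by \<open>ballot_words_iff\<close>, the ballot words on the other; so the
  bijection of \<open>nc_chain_words\<close> restricts to these sets.\<close>

lemma card_central: "card {cs \<in> admissible. central 1 cs} = card ballot_words"
proof -
  obtain \<phi> where bij: "bij_betw \<phi> (words l (M - 1) (l + 2)) {E. nc_chain l (M - 1) E}"
    and fit: "\<And>g. g \<in> words l (M - 1) (l + 2) \<Longrightarrow> chain_fits l (M - 1) g (\<phi> g)"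
    using nc_chain_words[OF l] by blast
  have iff: "\<phi> g \<in> chains \<longleftrightarrow> g \<in> ballot_words" if g: "g \<in> words l (M - 1) (l + 2)" for g
  proof -
    have "nc_chain l (M - 1) (\<phi> g)" using bij g unfolding bij_betw_def by blast
    moreover have "0 < 2 * k * i" if "i \<in> {1..n}" for i using that k by simp
    ultimately show ?thesis
      unfolding chains_def ballot_words_iff using fit[OF g] g unfolding chain_fits_def by simp
  qed
  have "bij_betw \<phi> ballot_words chains"
  proof (rule bij_betw_imageI)
    have sub: "ballot_words \<subseteq> words l (M - 1) (l + 2)" using ballot_words_iff by blast
    show "inj_on \<phi> ballot_words" using bij sub inj_on_subset unfolding bij_betw_def by blast
    show "\<phi> ` ballot_words = chains"
    proof (intro equalityI subsetI)
      fix E assume "E \<in> \<phi> ` ballot_words"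
      then show "E \<in> chains" using iff sub by blast
    next
      fix E assume E: "E \<in> chains"
      then have "E \<in> \<phi> ` words l (M - 1) (l + 2)"
        using bij unfolding bij_betw_def chains_def by blast
      then show "E \<in> \<phi> ` ballot_words" using iff E by blast
    qed
  qed
  then show ?thesis using bij_betw_same_card[OF bij_betw_chains] bij_betw_same_card by metis
qed

end

section \<open>Rotation by one step\<close>

context antipodal
begin

text \<open>One step around the circle of \<open>2 * M\<close> points; as the identity elsewhere it
  is injective on all natural numbers.\<close>

definition turn :: "nat \<Rightarrow> nat" where
  "turn u = (if u = 2 * M then 1 else if u \<in> {1..<2 * M} then u + 1 else u)"

lemma turn_in: "u \<in> pts \<Longrightarrow> turn u \<in> pts"
  unfolding turn_def using M_pos by auto

lemma inj_turn: "inj turn"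
  unfolding inj_def turn_def using M_pos by auto

lemma turn_rho: "u \<in> pts \<Longrightarrow> turn (\<rho> u) = \<rho> (turn u)"
  unfolding turn_def rho_eq using M_pos by auto

lemma turn_image: "turn ` pts = pts"
  by (rule endo_inj_surj) (use turn_in inj_turn in \<open>auto intro: inj_on_subset\<close>)

lemma rho_block_turn:
  assumes "B \<subseteq> pts"
  shows "rho_block k n (turn ` B) = turn ` rho_block k n B"
proof -
  have "\<rho> ` turn ` B = (\<lambda>u. \<rho> (turn u)) ` B" by (rule image_image)
  also have "\<dots> = (\<lambda>u. turn (\<rho> u)) ` B" by (rule image_cong[OF refl]) (use turn_rho assms in force)
  also have "\<dots> = turn ` \<rho> ` B" by (rule image_image[symmetric])
  finally show ?thesis unfolding rho_block_def .
qed

lemma card_turn: "card (turn ` B) = card B"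
  by (rule card_image) (use inj_turn in \<open>auto intro: inj_on_subset\<close>)

abbreviation turned :: "nat set set \<Rightarrow> nat set set" where "turned P \<equiv> (`) turn ` P"

lemma inj_turned: "inj turned"
  using inj_turn by (simp add: inj_image_eq_iff inj_def)

lemma nc_turned:
  assumes P: "sym_nc P"
  shows "noncrossing (turned P)"
  unfolding noncrossing_def
proof (intro ballI impI notI)
  fix B' C' assume "B' \<in> turned P" "C' \<in> turned P" and ne: "B' \<noteq> C'"
  then obtain B C where BC: "B \<in> P" "C \<in> P" "B' = turn ` B" "C' = turn ` C" by (elim imageE)
  have neBC: "B \<noteq> C" using ne BC by blast
  assume "\<exists>a b c d. a < b \<and> b < c \<and> c < d \<and> a \<in> B' \<and> c \<in> B' \<and> b \<in> C' \<and> d \<in> C'"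
  then obtain a' b' c' d' where o': "a' < b'" "b' < c'" "c' < d'"
    and m': "a' \<in> turn ` B" "c' \<in> turn ` B" "b' \<in> turn ` C" "d' \<in> turn ` C"
    unfolding BC(3,4) by blast
  obtain a where a: "a' = turn a" "a \<in> B" using m'(1) by (rule imageE)
  obtain b where b: "b' = turn b" "b \<in> C" using m'(3) by (rule imageE)
  obtain c where c: "c' = turn c" "c \<in> B" using m'(2) by (rule imageE)
  obtain d where d: "d' = turn d" "d \<in> C" using m'(4) by (rule imageE)
  note o = o'[unfolded a(1) b(1) c(1) d(1)] and m = a(2) c(2) b(2) d(2)
  have ran: "a \<in> pts" "b \<in> pts" "c \<in> pts" "d \<in> pts"
    using sym_ncD(3)[OF P] BC m by blast+
  have nc: "\<not> (\<exists>a b c d. a < b \<and> b < c \<and> c < d \<and> a \<in> X \<and> c \<in> X \<and> b \<in> Y \<and> d \<in> Y)"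
    if X: "X \<in> P" and Y: "Y \<in> P" and XY: "X \<noteq> Y" for X Y
  proof -
    have N: "noncrossing P" using P unfolding sym_nc_def by blast
    show ?thesis by (rule bspec[OF bspec[OF N[unfolded noncrossing_def] X] Y, THEN mp, OF XY])
  qed
  have t: "turn u = u + 1" if "u \<in> pts" "turn u \<noteq> 1" for u
    using that unfolding turn_def by (auto split: if_splits)
  have "1 \<le> turn a" using turn_in[OF ran(1)] by simp
  then have "1 < turn b" using o(1) by (rule le_less_trans)
  moreover from this have "1 < turn c" using o(2) by (rule less_trans)
  moreover from this have "1 < turn d" using o(3) by (rule less_trans)
  ultimately have gt: "turn b \<noteq> 1" "turn c \<noteq> 1" "turn d \<noteq> 1" by simp_all
  have bcd: "b < c" "c < d"
    using o(2,3) unfolding t[OF ran(2) gt(1)] t[OF ran(3) gt(2)] t[OF ran(4) gt(3)] by linarith+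
  \<comment> \<open>Only the point \<open>2 * M\<close> is moved downwards. If it is
    \<open>a\<close>, then \<open>b < c < d < a\<close> before the turn, and the two blocks cross
    with exchanged roles; otherwise the four points had the same order before.\<close>
  show False
  proof (cases "turn a = 1")
    case True
    have "a = 2 * M"
    proof (rule ccontr)
      assume "a \<noteq> 2 * M"
      then have "turn a = a + 1" using ran(1) unfolding turn_def by simp
      then show False using True ran(1) by simp
    qed
    moreover have "d \<noteq> 2 * M"
    proof
      assume "d = 2 * M"
      then have "turn d = 1" unfolding turn_def by simp
      then show False using gt(3) by simp
    qed
    ultimately have "d < a" using ran(4) by simp
    then have "\<exists>a b c d. a < b \<and> b < c \<and> c < d \<and> a \<in> C \<and> c \<in> C \<and> b \<in> B \<and> d \<in> B"
      using bcd m by metis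
    then show False using nc[OF BC(2,1) neBC[symmetric]] by simp
  next
    case False
    then have "a < b" using o(1) t[OF ran(1)] t[OF ran(2) gt(1)] by simp
    then have "\<exists>a b c d. a < b \<and> b < c \<and> c < d \<and> a \<in> B \<and> c \<in> B \<and> b \<in> C \<and> d \<in> C"
      using bcd m by metis
    then show False using nc[OF BC(1,2) neBC] by simp
  qed
qed

lemma turned_sym_nc:
  assumes P: "sym_nc P"
  shows "sym_nc (turned P)"
  unfolding sym_nc_def
proof (intro conjI nc_turned[OF P])
  note P' = sym_ncD[OF P]
  have "partition_on (turn ` pts) (turned P - {{}})"
    by (rule partition_on_inj_image[OF P'(1)]) (use inj_turn in \<open>auto intro: inj_on_subset\<close>)
  moreover have "turned P - {{}} = turned P" using partition_onD3[OF P'(1)] by auto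
  ultimately show "partition_on pts (turned P)" unfolding turn_image by simp
  have "rho_block k n ` turned P = (\<lambda>B. rho_block k n (turn ` B)) ` P" by (rule image_image)
  also have "\<dots> = (\<lambda>B. turn ` rho_block k n B) ` P"
    by (rule image_cong[OF refl]) (use rho_block_turn P'(3) in blast)
  also have "\<dots> = turned (rho_block k n ` P)" by (rule image_image[symmetric])
  also have "rho_block k n ` P = P" using P unfolding sym_nc_def by blast
  finally show "rho_block k n ` turned P = turned P" .
qed

lemma turned_NCt: "P \<in> NCt k n \<Longrightarrow> turned P \<in> NCt k n"
  unfolding NCt_iff using turned_sym_nc card_turn by auto

lemma card_pairs_turned:
  assumes P: "sym_nc P"
  shows "card (pairs Q (turned P)) = card (pairs Q P)"
proof -
  note P' = sym_ncD[OF P]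
  have im: "turn ` X = turn ` Y \<longleftrightarrow> X = Y" for X Y by (rule inj_image_eq_iff[OF inj_turn])
  have "pairs Q (turned P) = turned ` pairs Q P"
  proof (intro equalityI subsetI)
    fix q assume "q \<in> pairs Q (turned P)"
    then obtain B where B: "B \<in> P" "q = {turn ` B, rho_block k n (turn ` B)}"
      "rho_block k n (turn ` B) \<noteq> turn ` B" "Q (card (turn ` B))"
      unfolding pairs_def by blast
    note r = rho_block_turn[OF P'(3)[OF B(1)]]
    have "{B, rho_block k n B} \<in> pairs Q P"
      using B(1,3,4) unfolding pairs_def r im card_turn by blast
    moreover have "q = turned {B, rho_block k n B}" unfolding B(2) r by simp
    ultimately show "q \<in> turned ` pairs Q P" by blast
  next
    fix q assume "q \<in> turned ` pairs Q P"
    then obtain B where B: "B \<in> P" "q = turned {B, rho_block k n B}"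
      "rho_block k n B \<noteq> B" "Q (card B)"
      unfolding pairs_def by blast
    note r = rho_block_turn[OF P'(3)[OF B(1)]]
    have q: "q = {turn ` B, rho_block k n (turn ` B)}" unfolding B(2) r by simp
    have "rho_block k n (turn ` B) \<noteq> turn ` B" "Q (card (turn ` B))" "turn ` B \<in> turned P"
      using B(1,3,4) unfolding r im card_turn by blast+
    then show "q \<in> pairs Q (turned P)" unfolding q pairs_def by blast
  qed
  then show ?thesis by (simp add: card_image[OF inj_on_subset[OF inj_turned subset_UNIV]])
qed

end

context chain_data
begin

lemma finite_admissible: "finite admissible"
proof (rule finite_subset)
  have "NCt k n \<subseteq> Pow (Pow pts)" using NCt_iff sym_ncD(3) by blast
  then show "admissible \<subseteq> {cs. set cs \<subseteq> Pow (Pow pts) \<and> length cs = l}"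
    unfolding admissible_def multichains_def by blast
  show "finite {cs. set cs \<subseteq> Pow (Pow pts) \<and> length cs = l}"
    by (rule finite_lists_length_eq) simp
qed

lemma turned_admissible: "cs \<in> admissible \<Longrightarrow> map turned cs \<in> admissible"
proof -
  assume cs: "cs \<in> admissible"
  note a = admissibleD[OF cs] and c = cs[unfolded admissible_iff]
  have nth: "map turned cs ! i = turned (cs ! i)" if "i < l" for i using that a(1) by simp
  show "map turned cs \<in> admissible"
    unfolding admissible_iff
  proof (intro conjI allI impI ballI)
    show "length (map turned cs) = l" using a(1) by simp
    fix i assume i: "i < l"
    show "map turned cs ! i \<in> NCt k n" unfolding nth[OF i] using c i turned_NCt by blast
    have "pair_count k n (turned (cs ! i)) = pair_count k n (cs ! i)"
      unfolding pair_count_pairs by (rule card_pairs_turned[OF a(2)[OF i]])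
    then show "pair_count k n (map turned cs ! i) = tail (i + 1)" unfolding nth[OF i] using c i by simp
  next
    fix i assume i: "i + 1 < l"
    then have i': "i < l" by simp
    have ref: "Defs.refines (cs ! i) (cs ! (i + 1))"
      using c[THEN conjunct2, THEN conjunct2, THEN conjunct1] i by simp
    show "Defs.refines (map turned cs ! i) (map turned cs ! (i + 1))"
      unfolding nth[OF i] nth[OF i'] Defs.refines_def
    proof
      fix B' assume "B' \<in> turned (cs ! i)"
      then obtain B where B: "B' = turn ` B" "B \<in> cs ! i" by (rule imageE)
      obtain C where C: "C \<in> cs ! (i + 1)" "B \<subseteq> C" using ref B(2) unfolding Defs.refines_def by blast
      show "\<exists>C'\<in>turned (cs ! (i + 1)). B' \<subseteq> C'"
        by (rule bexI[of _ "turn ` C"]) (use B(1) C in auto)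
    qed
  next
    fix i assume i: "i \<in> {1..n}"
    have "pair_count_size k n (turned (cs ! 0)) i = pair_count_size k n (cs ! 0) i"
      unfolding pair_count_size_pairs by (rule card_pairs_turned[OF a(2)[OF l]])
    then show "pair_count_size k n (map turned cs ! 0) i = bs i" unfolding nth[OF l] using c i by simp
  qed
qed

lemma bij_turned: "bij_betw (map turned) admissible admissible"
proof -
  have "inj (map turned)" using inj_turned by (rule inj_mapI)
  then have "inj_on (map turned) admissible" by (rule inj_on_subset) simp
  then show ?thesis
    unfolding bij_betw_def by (intro conjI endo_inj_surj finite_admissible image_subsetI turned_admissible)
qed

lemma central_turned:
  assumes "cs \<in> admissible" "1 \<le> z" "z < M"
  shows "central (z + 1) (map turned cs) \<longleftrightarrow> central z cs"
proof -
  have nth: "map turned cs ! 0 = turned (cs ! 0)" using admissibleD(1)[OF assms(1)] l by simp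
  have t: "turn z = z + 1" "turn (z + M) = z + 1 + M" using assms(2,3) unfolding turn_def by auto
  have "(turn u, turn v) \<in> rel_of (turned P) \<longleftrightarrow> (u, v) \<in> rel_of P" for u v P
    unfolding rel_of_def using inj_image_mem_iff[OF inj_turn] by blast
  then show ?thesis unfolding central_def nth by (metis t)
qed

text \<open>Turning permutes the admissible chains and carries the antipodal pair of a point of
  \<open>{1..<M}\<close> to that of the next, so the count known for the point 1 spreads over the
  lower half. The point is \<open>z + 1\<close>, which lets the induction start at 0.\<close>

lemma card_central_all:
  assumes "z < M"
  shows "card {cs \<in> admissible. central (z + 1) cs} = card ballot_words"
  using assms
proof (induction z)
  case 0
  then show ?case using card_central by simp
next
  case (Suc z)
  have "bij_betw (map turned) {cs \<in> admissible. central (z + 1) cs} {cs \<in> admissible. central (z + 2) cs}"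
  proof (rule bij_betw_imageI)
    show "inj_on (map turned) {cs \<in> admissible. central (z + 1) cs}"
      by (rule inj_on_subset[OF bij_betw_imp_inj_on[OF bij_turned]]) blast
    show "map turned ` {cs \<in> admissible. central (z + 1) cs} = {cs \<in> admissible. central (z + 2) cs}"
    proof (intro equalityI subsetI)
      fix ds assume "ds \<in> map turned ` {cs \<in> admissible. central (z + 1) cs}"
      then obtain cs where cs: "cs \<in> admissible" "central (z + 1) cs" "ds = map turned cs" by blast
      then show "ds \<in> {cs \<in> admissible. central (z + 2) cs}"
        using central_turned[OF cs(1), of "z + 1"] turned_admissible[OF cs(1)] Suc.prems by simp
    next
      fix ds assume ds: "ds \<in> {cs \<in> admissible. central (z + 2) cs}"
      then have "ds \<in> map turned ` admissible" using bij_betw_imp_surj_on[OF bij_turned] by simp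
      then obtain cs where cs: "cs \<in> admissible" "ds = map turned cs" by blast
      then have "central (z + 1) cs" using central_turned[OF cs(1), of "z + 1"] ds Suc.prems by simp
      then show "ds \<in> map turned ` {cs \<in> admissible. central (z + 1) cs}" using cs by blast
    qed
  qed
  then have "card {cs \<in> admissible. central (z + 1) cs} = card {cs \<in> admissible. central (z + 2) cs}"
    by (rule bij_betw_same_card)
  then show ?case using Suc by simp
qed

text \<open>\<open>M * card ballot_words\<close> equals \<open>(M - w) * card admissible\<close>, by
  counting the points of the fixed block, and also \<open>(M - w) * card W\<close>, by the cycle
  lemma.\<close>

lemma card_admissible: "card admissible = multinomial (\<Sum>i=1..n. bs i) n bs * (\<Prod>d\<in>{2..l+1}. M choose s d)"
proof -
  define w where "w = 2 * k * (\<Sum>i=1..n. i * bs i)"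
  have "w \<le> 2 * k * n" unfolding w_def using weight by simp
  \<comment> \<open>This makes \<open>M - w\<close> positive: \<open>2 * k * n\<close> falls short
    of \<open>M\<close> by \<open>k\<close>.\<close>
  then have w: "w < M" unfolding M using k by (simp add: algebra_simps)
  have centre: "card {z\<in>{1..M}. central z cs} = M - w" if "cs \<in> admissible" for cs
    using card_centre_half[OF admissibleD(2)[OF that l] admissibleD(3)[OF that]] unfolding w_def central_def by simp
  have "(\<Sum>cs\<in>admissible. card {z\<in>{1..M}. central z cs}) = (\<Sum>z\<in>{1..M}. card {cs \<in> admissible. central z cs})"
    by (rule sum_multicount_gen) (simp_all add: finite_admissible)
  moreover have "(\<Sum>cs\<in>admissible. card {z\<in>{1..M}. central z cs}) = (\<Sum>cs\<in>admissible. M - w)"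
    by (rule sum.cong[OF refl centre])
  moreover have "(\<Sum>z\<in>{1..M}. card {cs \<in> admissible. central z cs}) = (\<Sum>z\<in>{1..M}. card ballot_words)"
  proof (rule sum.cong[OF refl])
    fix z assume "z \<in> {1..M}"
    then have "z - 1 < M" "z - 1 + 1 = z" by auto
    then show "card {cs \<in> admissible. central z cs} = card ballot_words" using card_central_all[of "z - 1"] by simp
  qed
  ultimately have "card admissible * (M - w) = M * card ballot_words" by simp
  also have "\<dots> = (M - w) * card W"
    using card_ballot_content w unfolding w_def ballot_words_def by simp
  finally have "card admissible = card W" using w by simp
  then show ?thesis using card_content by simp
qed

end

theorem theorem6p2:
  fixes n k l b :: nat and bs s :: "nat \<Rightarrow> nat"
  assumes "n > 0" and "k > 0" and "l > 0"
    and "(\<Sum>i=1..n. bs i) = b"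
    and "(\<Sum>i=1..n. i * bs i) \<le> n"
    and "(\<Sum>i=1..l+1. s i) = n"
    and "s 1 = n - b"
  shows "card {cs \<in> multichains k n l. has_rank_jumps k n l cs s \<and> has_type k n (cs ! 0) b bs}
         = multinomial b n bs * (\<Prod>i=2..l+1. (2 * k * n + k) choose (s i))"
proof -
  interpret chain_data k n "k * (2 * n + 1)" l bs s
    by unfold_locales (use assms in simp_all)
  have M: "k * (2 * n + 1) = 2 * k * n + k" by simp
  show ?thesis using card_admissible unfolding admissible_def assms(4) M .
qed

end
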